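(* Let $(\mathrm{PA}_t)_{t\ge1}$ be the preferential attachment model with parameters $m\ge2$ and $\delta\in(-m,0)$, and $\tau=3+\delta/m$. Let $V_1^t$ and $V_2^t$ be two independent uniformly random vertices in $[t]$ (independent of the graph), and let $H_t$ be the graph distance between $V_1^t$ and $V_2^t$ in $\mathrm{PA}_t$. Then $$\frac{H_t}{\log\log t}\longrightarrow\frac{4}{|\log(\tau-2)|}$$ in probability as $t\to\infty$.
   Context: Preferential attachment model with parameters $m\in\mathbb{N}$, $\delta\in(-m,\infty)$: for $s\in\mathbb{N}$ and $j\in[m]$, $\xi_{s,j}\in[s]$ denotes the vertex to which the $j$-th edge of vertex $s$ is attached. Order pairs by $(s,i)\le(t,j)$ iff $s<t$, or $s=t$ and $i\le j$; set $(t,0):=(t-1,m)$. Degrees: $D_{t,k}(v)=\sum_{(s,i)\le(t,k)}(\mathbf 1_{\{\xi_{s,i}=v\}}+\mathbf 1_{\{s=v\}})$. Set $\xi_{1,j}=1$ for all $j$, and for $t\ge2$, conditionally on $(\xi_{s,i})_{(s,i)\le(t,j-1)}$, $\xi_{t,j}=v$ with probability $(D_{t,j-1}(v)+1+j\delta/m)/c_{t,j}$ if $v=t$ and $(D_{t,j-1}(v)+\delta)/c_{t,j}$ if $v<t$, where $c_{t,j}=[m(t-1)+(j-1)](2+\delta/m)+1+\delta/m$. $\mathrm{PA}_t$ is the multigraph on $[t]$ with an edge between $s$ and $\xi_{s,i}$ for every $(s,i)\le(t,m)$. *)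

theory Defs
  imports "HOL-Probability.Probability"
begin

text \<open>Encoding of the preferential attachment model PA_t(m, delta).
  The attachment history is a list xs of targets: position k (0-based) holds
  xi_{s,i} for the pair (s,i) with k = m*(s-1) + (i-1), i.e. s = k div m + 1,
  i = k mod m + 1.  A history of length m*t describes PA_t.\<close>

definition pa_src :: "nat \<Rightarrow> nat \<Rightarrow> nat" where
  "pa_src m k = k div m + 1"

definition pa_deg :: "nat \<Rightarrow> nat list \<Rightarrow> nat \<Rightarrow> nat" where
  "pa_deg m xs v = length (filter (\<lambda>x. x = v) xs) + card {k. k < length xs \<and> pa_src m k = v}"

definition pa_weight :: "nat \<Rightarrow> real \<Rightarrow> nat list \<Rightarrow> nat \<Rightarrow> real" where
  "pa_weight m \<delta> xs v =
     (let t = pa_src m (length xs); j = length xs mod m + 1 in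
      if v = t then real (pa_deg m xs v) + 1 + real j * \<delta> / real m
      else if 1 \<le> v \<and> v < t then real (pa_deg m xs v) + \<delta>
      else 0)"

definition pa_c :: "nat \<Rightarrow> real \<Rightarrow> nat \<Rightarrow> real" where
  "pa_c m \<delta> n =
     (let t = pa_src m n; j = n mod m + 1 in
      (real (m * (t - 1)) + real (j - 1)) * (2 + \<delta> / real m) + 1 + \<delta> / real m)"

definition pa_step :: "nat \<Rightarrow> real \<Rightarrow> nat list \<Rightarrow> nat pmf" where
  "pa_step m \<delta> xs =
     (if pa_src m (length xs) = 1 then return_pmf 1
      else embed_pmf (\<lambda>v. pa_weight m \<delta> xs v / pa_c m \<delta> (length xs)))"

fun pa_hist :: "nat \<Rightarrow> real \<Rightarrow> nat \<Rightarrow> nat list pmf" where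
  "pa_hist m \<delta> 0 = return_pmf []"
| "pa_hist m \<delta> (Suc n) =
     bind_pmf (pa_hist m \<delta> n) (\<lambda>xs. map_pmf (\<lambda>v. xs @ [v]) (pa_step m \<delta> xs))"

definition PA :: "nat \<Rightarrow> real \<Rightarrow> nat \<Rightarrow> nat list pmf" where
  "PA m \<delta> t = pa_hist m \<delta> (m * t)"

definition pa_adj :: "nat \<Rightarrow> nat list \<Rightarrow> nat \<Rightarrow> nat \<Rightarrow> bool" where
  "pa_adj m xs a b \<longleftrightarrow>
     (\<exists>k < length xs. (pa_src m k = a \<and> xs ! k = b) \<or> (pa_src m k = b \<and> xs ! k = a))"

definition walk_of_len :: "('a \<Rightarrow> 'a \<Rightarrow> bool) \<Rightarrow> 'a \<Rightarrow> 'a \<Rightarrow> nat \<Rightarrow> bool" where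
  "walk_of_len adj u v n \<longleftrightarrow>
     (\<exists>f :: nat \<Rightarrow> 'a. f 0 = u \<and> f n = v \<and> (\<forall>i < n. adj (f i) (f (Suc i))))"

definition graph_dist :: "('a \<Rightarrow> 'a \<Rightarrow> bool) \<Rightarrow> 'a \<Rightarrow> 'a \<Rightarrow> enat" where
  "graph_dist adj u v =
     (if \<exists>n. walk_of_len adj u v n then enat (LEAST n. walk_of_len adj u v n) else \<infinity>)"

definition typical_dist :: "nat \<Rightarrow> real \<Rightarrow> nat \<Rightarrow> enat pmf" where
  "typical_dist m \<delta> t =
     do { xs \<leftarrow> PA m \<delta> t;
          u \<leftarrow> pmf_of_set {1..t};
          v \<leftarrow> pmf_of_set {1..t};
          return_pmf (graph_dist (pa_adj m xs) u v) }"

end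

theory Submission
  imports Defs "HOL-Real_Asymp.Real_Asymp"
begin

text \<open>Write \<open>\<rho> = 1 + \<delta> / m = \<tau> - 2\<close> and \<open>\<gamma> = 1 / (1 + \<rho>)\<close>, so that the degree of vertex \<open>v\<close> at time
  \<open>t\<close> is of order \<open>(t / v) powr \<gamma>\<close>.

  Lower bound. The probability that a given self-avoiding path is present is at most the product over its
  edges of \<open>C * (min a b) powr - \<gamma> * (max a b) powr (\<gamma> - 1)\<close>. A first-moment bound over paths shows that
  within \<open>j\<close> steps a uniform vertex hardly ever reaches a vertex smaller than
  \<open>t * exp (- C * \<theta> ^ j)\<close>, where \<open>\<theta>\<close> is slightly larger than \<open>\<rho> powr (- 1/2)\<close>. Two vertices at distance below
  \<open>(4 / \<bar>ln \<rho>\<bar> - \<epsilon>) * ln (ln t)\<close> are then joined by a path all of whose vertices exceed \<open>t powr (1 - o(1))\<close>,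
  and the expected number of such paths is \<open>t powr (1 + o(1))\<close>, against \<open>t ^ 2\<close> pairs.

  Upper bound. Following first edges backwards, all but a small fraction of the vertices
  meet a vertex of large constant degree after boundedly many steps. From a vertex of degree \<open>h\<close>
  one reaches a vertex of degree \<open>h powr (1 / \<rho> - o(1))\<close> in two steps, through a young vertex whose first two edges
  hit both; the young vertices of successive climbing steps are taken from disjoint time windows. After
  \<open>ln (ln t) / \<bar>ln \<rho>\<bar>\<close> such double steps the climb ends in vertex 1.\<close>

section \<open>The expectation operator of the attachment history\<close>

text \<open>The obstacle is dependence: every attachment changes all later weights, so edges cannot
  be treated one by one. The proof uses no independence and no concentration inequality. Each
  estimate rests on a functional of the history whose one-step conditional mean is equal to, or at
  most, a deterministic multiple of itself (\<open>E_iter_eq\<close>, \<open>E_iter_le\<close>):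
  products of rising factorials of weights for path probabilities, a single weight or the total
  weight of the oldest vertices for means, and \<open>1 / (vol - 1)\<close> for lower tails. The
  deterministic factors then multiply up to powers with exponent \<open>\<gamma>\<close>. Admissible
  histories of a given length form a finite set, so conditional expectations are the finite sums of
  \<open>E_Suc\<close>. In the climb, conditioning is avoided by judging all targets by their
  degrees at one early time \<open>t0\<close>. The tail bound for the weight of the \<open>s\<close>
  oldest vertices holds down to \<open>s = 1\<close>, so the climb runs into vertex 1 without a
  separate analysis of a core of high-degree vertices. The constant 4 is 2 * 2: there are two ends
  to climb from, and each multiplication of the logarithmic degree by \<open>1 / \<rho>\<close>
  costs two edges.\<close>

lemma powr_one_plus_le:
  fixes x c :: real
  assumes "x > -1" "0 \<le> c" "c \<le> 1"
  shows "(1 + x) powr c \<le> 1 + c * x"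
proof -
  have "c * x \<ge> - c" if "x < 0" 
    using mult_left_mono[of "-1" x c] assms by simp
  then have "c * x > -1"
  proof (cases "c = 0")
    case False
    then have "c * x > c * (-1)" using assms by (intro mult_strict_left_mono) auto
    then show ?thesis using assms by simp
  qed simp
  define y where "y = 1 + c * x"
  have y: "y > 0" using \<open>c * x > -1\<close> by (simp add: y_def)
  have 1: "ln ((1 + x) / y) \<le> (1 + x) / y - 1"
    using y assms by (intro ln_le_minus_one) auto
  have 2: "ln (1 / y) \<le> 1 / y - 1"
    using y by (intro ln_le_minus_one) auto
  \<comment> \<open>Weighted AM-GM for \<open>1 + x\<close> and \<open>1\<close> with weights
    \<open>c\<close> and \<open>1 - c\<close>: both are divided by their mean \<open>y\<close>, so
    that the bounds from \<open>ln z \<le> z - 1\<close> cancel.\<close>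
  have "c * ln ((1 + x) / y) + (1 - c) * ln (1 / y) \<le> c * ((1 + x) / y - 1) + (1 - c) * (1 / y - 1)"
    using 1 2 assms by (intro add_mono mult_left_mono) auto
  also have "\<dots> = (1 + c * x) / y - 1" using y by (simp add: field_simps)
  also have "\<dots> = 0" using y by (simp add: y_def)
  finally have "c * ln (1 + x) - ln y \<le> 0"
    using y assms by (simp add: ln_div algebra_simps)
  then have "exp (c * ln (1 + x)) \<le> exp (ln y)" by simp
  then have "exp (c * ln (1 + x)) \<le> y" using y by simp
  then show ?thesis using assms by (simp add: powr_def y_def)
qed

lemma pochhammer_shift:
  fixes x :: real
  assumes "x > 0"
  shows "pochhammer (x + 1) r = pochhammer x r * (1 + real r / x)"
proof -
  have "x * pochhammer (x + 1) r = pochhammer x r * (x + real r)"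
    using pochhammer_rec[of x r] pochhammer_Suc[of x r] by simp
  then show ?thesis using assms by (simp add: field_simps)
qed

lemma exp_dominates:
  fixes p r C :: real
  assumes "p < r"
  shows "\<exists>L0. \<forall>L\<ge>L0. C * exp (p * L) \<le> exp (r * L) / 2"
proof -
  have "((\<lambda>L. C * exp ((p - r) * L)) \<longlongrightarrow> C * 0) at_top"
  proof (intro tendsto_intros)
    have "filterlim (\<lambda>L. (p - r) * L) at_bot at_top"
      using assms by (intro filterlim_tendsto_neg_mult_at_bot[OF tendsto_const] filterlim_ident) auto
    then show "((\<lambda>L. exp ((p - r) * L)) \<longlongrightarrow> 0) at_top"
      by (rule filterlim_compose[OF exp_at_bot])
  qed
  then have "eventually (\<lambda>L. C * exp ((p - r) * L) < 1 / 2) at_top"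
    by (intro order_tendstoD) auto
  then obtain L0 where L0: "\<And>L. L \<ge> L0 \<Longrightarrow> C * exp ((p - r) * L) < 1 / 2"
    by (auto simp: eventually_at_top_linorder)
  have "C * exp (p * L) \<le> exp (r * L) / 2" if "L \<ge> L0" for L
  proof -
    have "C * exp (p * L) = C * exp ((p - r) * L) * exp (r * L)"
      by (simp add: exp_add[symmetric] algebra_simps)
    also have "\<dots> \<le> 1 / 2 * exp (r * L)" using L0[OF that] by (intro mult_right_mono) auto
    finally show ?thesis by simp
  qed
  then show ?thesis by blast
qed

section \<open>Degrees and admissible histories\<close>

lemma pa_deg_snoc:
  "pa_deg m (xs @ [v]) u = pa_deg m xs u + (if v = u then 1 else 0)
     + (if pa_src m (length xs) = u then 1 else 0)"
proof -
  have "{k. k < Suc (length xs) \<and> pa_src m k = u} =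
     {k. k < length xs \<and> pa_src m k = u} \<union> (if pa_src m (length xs) = u then {length xs} else {})"
    by (auto simp: less_Suc_eq)
  then show ?thesis by (auto simp: pa_deg_def card_insert_if)
qed

lemma pa_deg_append_ge: "pa_deg m xs v \<le> pa_deg m (xs @ ys) v"
proof -
  have "card {k. k < length xs \<and> pa_src m k = v} \<le> card {k. k < length xs + length ys \<and> pa_src m k = v}"
    by (intro card_mono) auto
  then show ?thesis by (simp add: pa_deg_def)
qed

lemma pa_adj_append: "pa_adj m xs a b \<Longrightarrow> pa_adj m (xs @ ys) a b"
  unfolding pa_adj_def by (metis length_append nth_append trans_less_add1)

text \<open>A finite superset of the support of \<open>pa_hist\<close>; its finiteness makes every
  expectation a finite sum.\<close>

definition pa_valid :: "nat \<Rightarrow> nat \<Rightarrow> nat list \<Rightarrow> bool" where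
  "pa_valid m n xs \<longleftrightarrow> length xs = n \<and> (\<forall>k<n. xs ! k \<in> {1..pa_src m k})"

lemma pa_valid_0 [simp]: "pa_valid m 0 xs \<longleftrightarrow> xs = []"
  by (auto simp: pa_valid_def)

lemma pa_valid_snoc [simp]:
  "pa_valid m (Suc n) (xs @ [v]) \<longleftrightarrow> pa_valid m n xs \<and> v \<in> {1..pa_src m n}"
  by (auto simp: pa_valid_def less_Suc_eq nth_append)

lemma pa_valid_Suc:
  "pa_valid m (Suc n) ys \<longleftrightarrow> (\<exists>xs v. ys = xs @ [v] \<and> pa_valid m n xs \<and> v \<in> {1..pa_src m n})"
proof
  assume a: "pa_valid m (Suc n) ys"
  then have "ys \<noteq> []" by (auto simp: pa_valid_def)
  then have e: "ys = butlast ys @ [last ys]" by simp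
  with a have "pa_valid m (Suc n) (butlast ys @ [last ys])" by simp
  then show "\<exists>xs v. ys = xs @ [v] \<and> pa_valid m n xs \<and> v \<in> {1..pa_src m n}"
    unfolding pa_valid_snoc using e by blast
qed auto

lemma pa_valid_length: "pa_valid m n xs \<Longrightarrow> length xs = n"
  by (simp add: pa_valid_def)

lemma pa_valid_take: "pa_valid m n xs \<Longrightarrow> k \<le> n \<Longrightarrow> pa_valid m k (take k xs)"
  by (auto simp: pa_valid_def)

lemma finite_pa_valid: "finite {xs. pa_valid m n xs}"
proof (induction n)
  case (Suc n)
  have "{xs. pa_valid m (Suc n) xs} \<subseteq> (\<lambda>(xs, v). xs @ [v]) ` ({xs. pa_valid m n xs} \<times> {1..pa_src m n})"
    by (auto simp: pa_valid_Suc image_iff)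
  then show ?case using Suc by (meson finite_SigmaI finite_atLeastAtMost finite_imageI finite_subset)
qed auto

lemma pa_src_mono: "a \<le> b \<Longrightarrow> pa_src m a \<le> pa_src m b"
  by (simp add: pa_src_def div_le_mono)

section \<open>Weights and transition probabilities\<close>

locale pref_att =
  fixes m :: nat and \<delta> :: real
  assumes m2: "m \<ge> 2" and delta_gt: "- real m < \<delta>" and delta_neg: "\<delta> < 0"
begin

definition \<gamma> :: real where "\<gamma> = 1 / (2 + \<delta> / m)"
definition \<rho> :: real where "\<rho> = 1 + \<delta> / m"

abbreviation "valid \<equiv> pa_valid m"
abbreviation "src \<equiv> pa_src m"
abbreviation "cc \<equiv> pa_c m \<delta>"
abbreviation "dg \<equiv> pa_deg m"

text \<open>This is the attachment weight only of vertices older than the current source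
  (\<open>pa_weight_old\<close>). The source has a different weight in the model, hence the
  condition \<open>m * v \<le> length xs\<close>, in one form or another, when \<open>wt\<close> is
  tied to attachment probabilities.\<close>

definition wt :: "nat list \<Rightarrow> nat \<Rightarrow> real" where "wt xs v = real (dg xs v) + \<delta>"
definition q :: "nat list \<Rightarrow> nat \<Rightarrow> real" where
  "q xs v = pa_weight m \<delta> xs v / cc (length xs)"
definition E :: "nat \<Rightarrow> (nat list \<Rightarrow> real) \<Rightarrow> real" where
  "E n h = measure_pmf.expectation (pa_hist m \<delta> n) h"

lemma m_pos: "m > 0" using m2 by simp

lemma rho: "0 < \<rho>" "\<rho> < 1"
  using delta_gt delta_neg m_pos by (auto simp: \<rho>_def field_simps)

lemma chi: "1/2 < \<gamma>" "\<gamma> < 1" "\<gamma> * (1 + \<rho>) = 1" "1 - \<gamma> = \<rho> * \<gamma>" "0 < \<gamma>"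
proof -
  have e: "\<gamma> = 1 / (1 + \<rho>)" by (simp add: \<gamma>_def \<rho>_def)
  show "1/2 < \<gamma>" "\<gamma> < 1" "\<gamma> * (1 + \<rho>) = 1" "1 - \<gamma> = \<rho> * \<gamma>" "0 < \<gamma>"
    using rho unfolding e by (auto simp: field_simps)
qed

text \<open>The two indices of the normalisation enter only through the number
  \<open>n = m * (t - 1) + (j - 1)\<close> of earlier edges; this is what makes the linear numbering
  of edges convenient.\<close>

lemma cc_eq: "cc n = real n * (1 + \<rho>) + \<rho>"
proof -
  have "real (m * (n div m)) + real (n mod m) = real n"
    by (metis mult_div_mod_eq of_nat_add)
  then show ?thesis by (simp add: pa_c_def Let_def pa_src_def \<rho>_def)
qed

lemma cc_pos: "cc n > 0" using rho by (simp add: cc_eq add_nonneg_pos)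

lemma inv_cc: "1 / cc n = \<gamma> / (real n + 1 - \<gamma>)"
proof -
  have "cc n * \<gamma> = real n * (\<gamma> * (1 + \<rho>)) + \<rho> * \<gamma>" by (simp add: cc_eq algebra_simps)
  also have "\<dots> = real n + 1 - \<gamma>" using chi by simp
  finally have "cc n = (real n + 1 - \<gamma>) / \<gamma>" using chi by (simp add: field_simps)
  then show ?thesis by simp
qed

lemma mono_cc: "a \<le> b \<Longrightarrow> cc a \<le> cc b"
  using rho by (simp add: cc_eq mult_right_mono)

lemma div_m_iff: "k div m = w \<longleftrightarrow> m * w \<le> k \<and> k < m * w + m"
proof
  assume "k div m = w"
  moreover have "k = m * (k div m) + k mod m" "k mod m < m" using m_pos by simp_all
  ultimately show "m * w \<le> k \<and> k < m * w + m" by (metis add_left_mono le_add1 nat_add_left_cancel_less)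
next
  assume "m * w \<le> k \<and> k < m * w + m"
  then show "k div m = w" by (intro div_nat_eqI) auto
qed

lemma card_src: "card {k. k < n \<and> src k = v} =
   (if v = 0 then 0 else if v < src n then m else if v = src n then n mod m else 0)"
proof (cases "v = 0")
  case False
  then obtain w where w: "v = Suc w" by (cases v) auto
  have "{k. k < n \<and> src k = v} = {m * w..<min n (m * w + m)}"
    by (auto simp: w pa_src_def div_m_iff)
  then have c: "card {k. k < n \<and> src k = v} = min n (m * w + m) - m * w" by simp
  have n: "m * (n div m) \<le> n" "n < m * (n div m) + m"
    using div_m_iff[of n "n div m"] by auto
  consider "w < n div m" | "w = n div m" | "w > n div m" by linarith
  then show ?thesis
  proof cases
    case 1
    then have "m * Suc w \<le> m * (n div m)" by (intro mult_le_mono2) simp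
    then have "m * w + m \<le> n" using n(1) unfolding mult_Suc_right by linarith
    then show ?thesis using 1 c by (simp add: w pa_src_def)
  next
    case 2
    then show ?thesis using n c by (simp add: w pa_src_def minus_mult_div_eq_mod)
  next
    case 3
    then have "m * Suc (n div m) \<le> m * w" by (intro mult_le_mono2) simp
    then have "n \<le> m * w" using n(2) unfolding mult_Suc_right by linarith
    then show ?thesis using 3 c by (simp add: w pa_src_def)
  qed
qed (auto simp: pa_src_def)

lemma deg_ge_m: "1 \<le> v \<Longrightarrow> v < src (length xs) \<Longrightarrow> dg xs v \<ge> m"
  using card_src[of "length xs" v] by (simp add: pa_deg_def)

lemma wt_pos: "1 \<le> v \<Longrightarrow> v < src (length xs) \<Longrightarrow> wt xs v > 0"
  using deg_ge_m[of v xs] delta_gt by (simp add: wt_def)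

lemma wt_ge: "1 \<le> v \<Longrightarrow> v < src (length xs) \<Longrightarrow> wt xs v \<ge> m + \<delta>"
  using deg_ge_m[of v xs] by (simp add: wt_def)

lemma pa_weight_old: "1 \<le> v \<Longrightarrow> v < src (length xs) \<Longrightarrow> pa_weight m \<delta> xs v = wt xs v"
  by (simp add: pa_weight_def Let_def wt_def)

lemma pa_weight_pos:
  assumes "v \<in> {1..src (length xs)}"
  shows "pa_weight m \<delta> xs v > 0"
proof (cases "v < src (length xs)")
  case True
  then show ?thesis using assms wt_pos pa_weight_old by auto
next
  case False
  then have v: "v = src (length xs)" using assms by simp
  \<comment> \<open>The edges already sent out by the source give it degree at least
    \<open>j - 1\<close>, so its weight is at least \<open>j * \<rho>\<close> with
    \<open>j = length xs mod m + 1\<close>.\<close>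
  have "dg xs v \<ge> length xs mod m"
    using card_src[of "length xs" v] assms v by (simp add: pa_deg_def)
  then have "real (dg xs v) \<ge> real (length xs mod m)" by simp
  moreover have "real (length xs mod m) + 1 + real (length xs mod m + 1) * \<delta> / m
     = real (length xs mod m + 1) * \<rho>" by (simp add: \<rho>_def algebra_simps add_divide_distrib)
  moreover have "real (length xs mod m + 1) * \<rho> > 0" using rho by simp
  ultimately show ?thesis unfolding v pa_weight_def Let_def by simp
qed

lemma pa_weight_zero: "v \<notin> {1..src (length xs)} \<Longrightarrow> pa_weight m \<delta> xs v = 0"
  by (auto simp: pa_weight_def Let_def pa_src_def)

text \<open>Every edge adds one at its source and one at its target, self-loops included. The
  alternative \<open>n = m * s\<close> covers the moment when vertex \<open>s\<close> is complete
  and the next source is already \<open>s + 1\<close>.\<close>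

lemma sum_deg:
  assumes "valid n xs" "src n \<le> s \<or> n = m * s"
  shows "(\<Sum>v\<in>{1..s}. real (dg xs v)) = 2 * real n"
proof -
  have src_le: "k < n \<Longrightarrow> src k \<le> s" for k
  proof -
    assume k: "k < n"
    show "src k \<le> s"
    proof (cases "n = m * s")
      case True
      then have "k div m < s" using k by (simp add: less_mult_imp_div_less mult.commute)
      then show ?thesis by (simp add: pa_src_def)
    next
      case False
      then have "src n \<le> s" using assms by simp
      then show ?thesis using pa_src_mono[of k n m] k by simp
    qed
  qed
  have "(\<Sum>v\<in>{1..s}. dg ys v) = 2 * length ys" if "valid k ys" "k \<le> n" for k ys
    using that
  proof (induction k arbitrary: ys)
    case 0
    then show ?case by (simp add: pa_deg_def)
  next
    case (Suc k)
    then obtain zs v where z: "ys = zs @ [v]" "valid k zs" "v \<in> {1..src k}"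
      by (auto simp: pa_valid_Suc)
    have l: "length zs = k" using z pa_valid_length by blast
    have "src k \<le> s" using src_le[of k] Suc by simp
    moreover have "src k \<ge> 1" by (simp add: pa_src_def)
    ultimately have "v \<in> {1..s}" "src k \<in> {1..s}" using z by auto
    then show ?case using Suc.IH[OF z(2)] Suc.prems(2)
      by (simp add: z(1) pa_deg_snoc l sum.distrib)
  qed
  from this[OF assms(1)] have "real (\<Sum>v\<in>{1..s}. dg xs v) = real (2 * n)"
    using pa_valid_length[OF assms(1)] by simp
  then show ?thesis by simp
qed

lemma sum_pa_weight:
  assumes "valid n xs"
  shows "(\<Sum>v\<in>{1..src n}. pa_weight m \<delta> xs v) = cc n"
proof -
  have l: "length xs = n" using assms pa_valid_length by blast
  have "(\<Sum>v\<in>{1..src n}. pa_weight m \<delta> xs v) =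
     (\<Sum>v\<in>{1..src n}. real (dg xs v) + (if v = src n then 1 + real (n mod m + 1) * \<delta> / m else \<delta>))"
    by (intro sum.cong) (auto simp: pa_weight_def Let_def l)
  also have "\<dots> = 2 * real n + (\<Sum>v\<in>{1..src n}. if v = src n then 1 + real (n mod m + 1) * \<delta> / m else \<delta>)"
    using sum_deg[OF assms, of "src n"] by (simp add: sum.distrib)
  also have "(\<Sum>v\<in>{1..src n}. if v = src n then 1 + real (n mod m + 1) * \<delta> / m else \<delta>)
     = 1 + real (n mod m + 1) * \<delta> / m + real (n div m) * \<delta>"
  proof -
    have "{1..src n} = insert (src n) {1..n div m}"
      by (auto simp: pa_src_def)
    moreover
    have "(\<Sum>v\<in>{1..n div m}. if v = src n then 1 + real (n mod m + 1) * \<delta> / m else \<delta>) = (\<Sum>v\<in>{1..n div m}. \<delta>)"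
      by (intro sum.cong) (auto simp: pa_src_def)
    ultimately show ?thesis by (auto simp: pa_src_def)
  qed
  also have "2 * real n + \<dots> = cc n"
  proof -
    have e: "real n = real m * real (n div m) + real (n mod m)"
      by (metis mult_div_mod_eq of_nat_add of_nat_mult)
    have "real n * \<delta> / m = real (n div m) * \<delta> + real (n mod m) * \<delta> / m"
      unfolding e using m_pos by (simp add: field_simps)
    then show ?thesis by (simp add: cc_eq \<rho>_def algebra_simps add_divide_distrib)
  qed
  finally show ?thesis .
qed

lemma q_nonneg: "q xs v \<ge> 0"
  using pa_weight_pos[of v xs] pa_weight_zero[of v xs] cc_pos[of "length xs"]
  by (cases "v \<in> {1..src (length xs)}") (auto simp: q_def)

lemma q_zero: "v \<notin> {1..src (length xs)} \<Longrightarrow> q xs v = 0"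
  by (simp add: q_def pa_weight_zero)

lemma q_old: "1 \<le> v \<Longrightarrow> v < src (length xs) \<Longrightarrow> q xs v = wt xs v / cc (length xs)"
  by (simp add: q_def pa_weight_old)

lemma sum_q: "valid n xs \<Longrightarrow> (\<Sum>v\<in>{1..src n}. q xs v) = 1"
  using sum_pa_weight[of n xs] cc_pos[of n] pa_valid_length[of m n xs]
  by (simp add: q_def sum_divide_distrib[symmetric])

lemma pmf_pa_step:
  assumes "valid n xs"
  shows "pmf (pa_step m \<delta> xs) v = q xs v"
proof (cases "src n = 1")
  case True
  have l: "length xs = n" using assms pa_valid_length by blast
  have "q xs 1 = 1" using sum_q[OF assms] by (simp add: True)
  then show ?thesis using q_zero[of v xs]
    by (cases "v = 1") (auto simp: pa_step_def l True)
next
  case False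
  have l: "length xs = n" using assms pa_valid_length by blast
  have "(\<integral>\<^sup>+ x. ennreal (q xs x) \<partial>count_space UNIV) = (\<Sum>x\<in>{1..src n}. ennreal (q xs x))"
    using q_zero[of _ xs] by (intro nn_integral_count_space'[of "{1..src n}"]) (auto simp: l)
  also have "\<dots> = 1" using sum_q[OF assms] q_nonneg by (subst sum_ennreal) auto
  finally have "pmf (embed_pmf (q xs)) v = q xs v"
    using q_nonneg by (intro pmf_embed_pmf) auto
  then show ?thesis using False by (simp add: pa_step_def l q_def[abs_def])
qed

lemma set_pmf_pa_step: "valid n xs \<Longrightarrow> set_pmf (pa_step m \<delta> xs) \<subseteq> {1..src n}"
  using pmf_pa_step[of n xs] q_zero[of _ xs] pa_valid_length[of m n xs]
  unfolding set_pmf_eq by fastforce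

section \<open>Expectations over histories\<close>

lemma set_pa_hist: "set_pmf (pa_hist m \<delta> n) \<subseteq> {xs. valid n xs}"
proof (induction n)
  case (Suc n)
  then show ?case using set_pmf_pa_step by fastforce
qed auto

lemma finite_pa_hist: "finite (set_pmf (pa_hist m \<delta> n))"
  using finite_subset[OF set_pa_hist finite_pa_valid] .

lemma integrable_pa_hist [simp]: "integrable (measure_pmf (pa_hist m \<delta> n)) (h :: _ \<Rightarrow> real)"
  by (rule integrable_measure_pmf_finite[OF finite_pa_hist])

lemma E_eq_sum: "E n h = (\<Sum>xs | valid n xs. pmf (pa_hist m \<delta> n) xs * h xs)"
  unfolding E_def using set_pa_hist
  by (subst integral_measure_pmf[OF finite_pa_valid[of m n]]) auto

lemma E_0: "E 0 h = h []"
  by (simp add: E_def)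

text \<open>Conditioning on everything but the last edge. This recursion takes the place of
  conditional expectations throughout.\<close>

lemma E_Suc: "E (Suc n) h = E n (\<lambda>xs. \<Sum>v\<in>{1..src n}. q xs v * h (xs @ [v]))"
proof -
  have "E (Suc n) h = (\<Sum>xs | valid n xs. pmf (pa_hist m \<delta> n) xs *
      measure_pmf.expectation (map_pmf (\<lambda>v. xs @ [v]) (pa_step m \<delta> xs)) h)"
    unfolding E_def pa_hist.simps using set_pa_hist set_pmf_pa_step
    by (subst pmf_expectation_bind[OF finite_pa_valid[of m n]])
       (auto intro: finite_subset[OF set_pmf_pa_step])
  also have "\<dots> = (\<Sum>xs | valid n xs. pmf (pa_hist m \<delta> n) xs * (\<Sum>v\<in>{1..src n}. q xs v * h (xs @ [v])))"
  proof (intro sum.cong refl arg_cong2[where f = "(*)"])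
    fix xs assume "xs \<in> {xs. valid n xs}"
    then have v: "valid n xs" by simp
    have "measure_pmf.expectation (pa_step m \<delta> xs) (\<lambda>v. h (xs @ [v])) = (\<Sum>v\<in>{1..src n}. q xs v * h (xs @ [v]))"
      using set_pmf_pa_step[OF v] pmf_pa_step[OF v] by (subst integral_measure_pmf[of "{1..src n}"]) auto
    then show "measure_pmf.expectation (map_pmf (\<lambda>v. xs @ [v]) (pa_step m \<delta> xs)) h = \<dots>"
      by simp
  qed
  finally show ?thesis by (simp add: E_eq_sum)
qed

lemma E_mono: "(\<And>xs. valid n xs \<Longrightarrow> f xs \<le> g xs) \<Longrightarrow> E n f \<le> E n g"
  unfolding E_eq_sum by (intro sum_mono mult_left_mono) auto

lemma E_cong: "(\<And>xs. valid n xs \<Longrightarrow> f xs = g xs) \<Longrightarrow> E n f = E n g"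
  unfolding E_eq_sum by (intro sum.cong) auto

lemma E_cmult: "E n (\<lambda>xs. c * f xs) = c * E n f"
  by (simp add: E_eq_sum sum_distrib_left algebra_simps)

lemma E_add: "E n (\<lambda>xs. f xs + g xs) = E n f + E n g"
  by (simp add: E_eq_sum sum.distrib algebra_simps)

lemma E_sum: "E n (\<lambda>xs. \<Sum>i\<in>I. f i xs) = (\<Sum>i\<in>I. E n (f i))"
  unfolding E_def by (intro Bochner_Integration.integral_sum) auto

lemma E_const: "E n (\<lambda>_. c) = c"
  by (simp add: E_def)

text \<open>The transition probabilities sum to one, so edges after \<open>n\<close> can be
  forgotten.\<close>

lemma E_take: "n \<le> N \<Longrightarrow> E N (\<lambda>xs. h (take n xs)) = E n h"
proof (induction N rule: dec_induct)
  case base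
  show ?case by (intro E_cong) (auto simp: pa_valid_def)
next
  case (step k)
  have "E (Suc k) (\<lambda>xs. h (take n xs)) = E k (\<lambda>xs. h (take n xs))"
    unfolding E_Suc
  proof (intro E_cong)
    fix xs assume v: "valid k xs"
    then have "length xs = k" by (rule pa_valid_length)
    then show "(\<Sum>v\<in>{1..src k}. q xs v * h (take n (xs @ [v]))) = h (take n xs)"
      using sum_q[OF v] step by (simp add: sum_distrib_right[symmetric])
  qed
  then show ?case using step by simp
qed

text \<open>Multiplicative form of a supermartingale bound. The functional \<open>h k\<close> may
  depend on time, which allows constraints to expire and vertices to become complete along the
  way.\<close>

lemma E_iter_le:
  assumes "n \<le> N" and nonneg: "\<And>k. n \<le> k \<Longrightarrow> k < N \<Longrightarrow> \<phi> k \<ge> 0"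
  and step: "\<And>k xs. n \<le> k \<Longrightarrow> k < N \<Longrightarrow> valid k xs \<Longrightarrow>
     (\<Sum>v\<in>{1..src k}. q xs v * h (Suc k) (xs @ [v])) \<le> \<phi> k * h k xs"
  shows "E N (h N) \<le> (\<Prod>k\<in>{n..<N}. \<phi> k) * E n (h n)"
  using assms(1) nonneg step
proof (induction N rule: dec_induct)
  case (step k)
  have "E (Suc k) (h (Suc k)) \<le> E k (\<lambda>xs. \<phi> k * h k xs)"
    unfolding E_Suc using step by (intro E_mono) auto
  also have "\<dots> \<le> \<phi> k * ((\<Prod>k\<in>{n..<k}. \<phi> k) * E n (h n))"
    unfolding E_cmult using step by (intro mult_left_mono) auto
  finally show ?case using step by (simp add: mult_ac prod.atLeastLessThan_Suc)
qed auto

lemma E_iter_eq: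
  assumes "n \<le> N"
  and step: "\<And>k xs. n \<le> k \<Longrightarrow> k < N \<Longrightarrow> valid k xs \<Longrightarrow>
     (\<Sum>v\<in>{1..src k}. q xs v * h (Suc k) (xs @ [v])) = \<phi> k * h k xs"
  shows "E N (h N) = (\<Prod>k\<in>{n..<N}. \<phi> k) * E n (h n)"
  using assms(1) step
proof (induction N rule: dec_induct)
  case (step k)
  have "E (Suc k) (h (Suc k)) = E k (\<lambda>xs. \<phi> k * h k xs)"
    unfolding E_Suc using step by (intro E_cong) auto
  also have "\<dots> = \<phi> k * ((\<Prod>k\<in>{n..<k}. \<phi> k) * E n (h n))"
    unfolding E_cmult using step by simp
  finally show ?case using step by (simp add: mult_ac prod.atLeastLessThan_Suc)
qed auto

text \<open>The mean growth factor of the weight of a complete vertex from edge \<open>a\<close> to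
  edge \<open>b\<close>. By \<open>inv_cc\<close> it is a ratio of Gamma functions, of order
  \<open>(b / a) powr \<gamma>\<close>.\<close>

definition growth :: "nat \<Rightarrow> nat \<Rightarrow> real" where
  "growth a b = (\<Prod>k\<in>{a..<b}. 1 + 1 / cc k)"

lemma growth_pos: "growth a b > 0"
  unfolding growth_def using cc_pos by (intro prod_pos) (simp add: add_pos_pos)

text \<open>Each factor is \<open>(k + 1) / (k + 1 - \<gamma>)\<close>, by concavity of the power at
  most \<open>((k + 1) / k) powr \<gamma>\<close>, and these bounds telescope.\<close>

lemma growth_le:
  assumes "1 \<le> a" "a \<le> b" shows "growth a b \<le> (real b / real a) powr \<gamma>"
  using assms(2)
proof (induction b rule: dec_induct)
  case base
  then show ?case using assms by (simp add: growth_def)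
next
  case (step k)
  have k: "k \<ge> 1" using step assms by simp
  have "(real k / (real k + 1)) powr \<gamma> = (1 + - 1 / (real k + 1)) powr \<gamma>"
    by (simp add: field_simps)
  also have "\<dots> \<le> 1 + \<gamma> * (- 1 / (real k + 1))"
    using chi k by (intro powr_one_plus_le) (auto simp: field_simps)
  finally have 1: "(real k / (real k + 1)) powr \<gamma> \<le> (real k + 1 - \<gamma>) / (real k + 1)"
    by (simp add: field_simps)
  have "1 + 1 / cc k = (real k + 1) / (real k + 1 - \<gamma>)"
    using chi k unfolding inv_cc by (simp add: field_simps)
  also have "\<dots> = 1 / ((real k + 1 - \<gamma>) / (real k + 1))" by simp
  also have "\<dots> \<le> 1 / (real k / (real k + 1)) powr \<gamma>"
    using 1 k chi by (intro divide_left_mono mult_pos_pos divide_pos_pos) auto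
  also have "\<dots> = ((real k + 1) / real k) powr \<gamma>"
    using k by (simp add: powr_divide)
  finally have 2: "1 + 1 / cc k \<le> ((real k + 1) / real k) powr \<gamma>" .
  have "growth a (Suc k) = growth a k * (1 + 1 / cc k)"
    using step by (simp add: growth_def prod.atLeastLessThan_Suc)
  also have "\<dots> \<le> (real k / real a) powr \<gamma> * ((real k + 1) / real k) powr \<gamma>"
    using 2 step cc_pos[of k] by (intro mult_mono) (auto simp: add_nonneg_nonneg)
  also have "\<dots> = (real (Suc k) / real a) powr \<gamma>"
    using k assms by (simp add: powr_mult[symmetric] add.commute)
  finally show ?case .
qed

text \<open>The same telescoping with \<open>((k + 2) / (k + 1)) powr \<gamma>\<close> as a lower
  bound. Undoing the shift by one costs at most the factor 2, because
  \<open>a + 1 \<le> 2 * a\<close> and \<open>\<gamma> < 1\<close>.\<close>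

lemma growth_ge:
  assumes "1 \<le> a" "a \<le> b" shows "growth a b \<ge> (real b / real a) powr \<gamma> / 2"
proof -
  have *: "growth a b \<ge> ((real b + 1) / (real a + 1)) powr \<gamma>"
    using assms(2)
  proof (induction b rule: dec_induct)
    case base
    then show ?case using assms by (simp add: growth_def)
  next
    case (step k)
    have "((real k + 2) / (real k + 1)) powr \<gamma> = (1 + 1 / (real k + 1)) powr \<gamma>"
      by (simp add: field_simps)
    also have "\<dots> \<le> 1 + \<gamma> * (1 / (real k + 1))"
      using chi by (intro powr_one_plus_le) (auto simp: add_pos_pos intro: less_trans[of "-1" 0])
    also have "\<dots> \<le> 1 + 1 / cc k" unfolding inv_cc using chi by (simp add: divide_left_mono)
    finally have 2: "((real k + 2) / (real k + 1)) powr \<gamma> \<le> 1 + 1 / cc k" .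
    have "(real (Suc k) + 1) / (real a + 1) = (real k + 1) / (real a + 1) * ((real k + 2) / (real k + 1))"
      by (simp add: divide_simps)
    then have "((real (Suc k) + 1) / (real a + 1)) powr \<gamma> = ((real k + 1) / (real a + 1)) powr \<gamma> * ((real k + 2) / (real k + 1)) powr \<gamma>"
      by (simp add: powr_mult[symmetric] add.commute)
    also have "\<dots> \<le> growth a k * (1 + 1 / cc k)"
      using 2 step growth_pos[of a k] by (intro mult_mono) auto
    also have "\<dots> = growth a (Suc k)"
      using step by (simp add: growth_def prod.atLeastLessThan_Suc)
    finally show ?case .
  qed
  have "(real b / real a) powr \<gamma> / 2 \<le> (real b / real a) powr \<gamma> / 2 powr \<gamma>"
    using powr_mono[of \<gamma> 1 2] chi by (intro divide_left_mono) auto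
  also have "\<dots> = (real b / (2 * real a)) powr \<gamma>"
    using assms by (simp add: powr_divide powr_mult)
  also have "\<dots> \<le> ((real b + 1) / (real a + 1)) powr \<gamma>"
    using assms chi by (intro powr_mono2 frac_le) auto
  finally show ?thesis using * by simp
qed

text \<open>From \<open>(1 - x) * (1 + x) \<le> 1\<close> the decay is at most the inverse growth;
  starting at \<open>a \<ge> 1\<close> keeps all factors nonnegative.\<close>

lemma decay_le:
  assumes "1 \<le> a" "a \<le> b"
  shows "(\<Prod>k\<in>{a..<b}. 1 - 1 / cc k) \<le> 2 * (real a / real b) powr \<gamma>"
proof -
  have "(\<Prod>k\<in>{a..<b}. 1 - 1 / cc k) \<le> (\<Prod>k\<in>{a..<b}. inverse (1 + 1 / cc k))"
  proof (intro prod_mono conjI)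
    fix k assume k: "k \<in> {a..<b}"
    then have "k \<ge> 1" using assms by simp
    then have "real k * (1 + \<rho>) \<ge> 1 * 1" using rho by (intro mult_mono) auto
    then have "cc k \<ge> 1" unfolding cc_eq using rho by linarith
    then show "0 \<le> 1 - 1 / cc k" by simp
    have "(1 - 1 / cc k) * (1 + 1 / cc k) \<le> 1" by (simp add: algebra_simps)
    then show "1 - 1 / cc k \<le> inverse (1 + 1 / cc k)"
      using \<open>cc k \<ge> 1\<close> by (simp add: pos_le_divide_eq add_pos_pos inverse_eq_divide)
  qed
  also have "\<dots> = inverse (growth a b)" unfolding growth_def using prod_inversef[of "\<lambda>k. 1 + 1 / cc k" "{a..<b}"] by (simp add: o_def)
  also have "\<dots> \<le> inverse ((real b / real a) powr \<gamma> / 2)"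
    using growth_ge[OF assms] assms by (intro le_imp_inverse_le) auto
  also have "\<dots> = 2 * (real a / real b) powr \<gamma>"
    using assms by (simp add: powr_divide field_simps)
  finally show ?thesis .
qed

section \<open>Path probabilities\<close>

text \<open>Up to its completion only the vertex's own \<open>m\<close> edges can hit it, and each
  counts at most twice, the second time as a self-loop.\<close>

lemma deg_birth:
  assumes "valid n xs" "n \<le> m * v" "v \<ge> 1"
  shows "dg xs v \<le> 2 * m"
proof -
  have l: "length xs = n" using assms pa_valid_length by blast
  have "card {k. k < n \<and> xs ! k = v} \<le> card {m * (v - 1)..<m * v}"
  proof (intro card_mono subsetI)
    fix k assume "k \<in> {k. k < n \<and> xs ! k = v}"
    then have k: "k < n" "xs ! k = v" by auto
    then have "v \<le> src k" using assms(1) by (auto simp: pa_valid_def)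
    then have "v - 1 \<le> k div m" by (simp add: pa_src_def)
    then have "m * (v - 1) \<le> m * (k div m)" by simp
    also have "\<dots> \<le> k" by simp
    finally show "k \<in> {m * (v - 1)..<m * v}" using k assms by auto
  qed auto
  also have "\<dots> = m" using assms(3) by (cases v) auto
  finally have 1: "card {k. k < n \<and> xs ! k = v} \<le> m" .
  have 2: "card {k. k < n \<and> src k = v} \<le> m"
    unfolding card_src using m_pos by (auto intro: less_imp_le)
  have "length (filter (\<lambda>x. x = v) xs) = card {k. k < n \<and> xs ! k = v}"
    by (simp add: length_filter_conv_card l)
  then show ?thesis using 1 2 by (simp add: pa_deg_def l)
qed

lemma src_gt_iff: "v < src n \<longleftrightarrow> m * v \<le> n"
proof
  assume "v < src n"
  then have "v \<le> n div m" by (simp add: pa_src_def)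
  then have "m * v \<le> m * (n div m)" by simp
  also have "\<dots> \<le> n" by simp
  finally show "m * v \<le> n" .
next
  assume "m * v \<le> n"
  then have "v \<le> n div m" using m_pos by (simp add: less_eq_div_iff_mult_less_eq mult.commute)
  then show "v < src n" by (simp add: pa_src_def)
qed

lemma wt_snoc_old:
  assumes "m * u \<le> length xs"
  shows "wt (xs @ [v]) u = wt xs u + (if v = u then 1 else 0)"
  using assms src_gt_iff[of u "length xs"] by (auto simp: wt_def pa_deg_snoc)

text \<open>The product of the rising factorials \<open>pochhammer (wt xs v) r\<close>, with \<open>r\<close> the number of outstanding
  constraints on \<open>v\<close>, is a supermartingale up to the factors in the bound. Before vertex \<open>v\<close> is complete
  its weight may not be used, and the factor is replaced by a power of \<open>2 * m + 1\<close>.\<close>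

lemma constraint_prob:
  fixes I :: "nat set" and \<kappa> w :: "nat \<Rightarrow> nat"
  assumes fin: "finite I" and inj: "inj_on \<kappa> I" and \<kappa>N: "\<And>i. i \<in> I \<Longrightarrow> \<kappa> i < N"
    and w1: "\<And>i. i \<in> I \<Longrightarrow> 1 \<le> w i" and w2: "\<And>i. i \<in> I \<Longrightarrow> w i < src (\<kappa> i)"
    and mult: "\<And>v. card {i \<in> I. w i = v} \<le> 2"
  shows "E N (\<lambda>xs. of_bool (\<forall>i\<in>I. xs ! \<kappa> i = w i))
     \<le> (\<Prod>i\<in>I. (2 * m + 1) * growth (m * w i) (\<kappa> i) / cc (\<kappa> i))"
proof -
  define C where "C = real (2 * m + 1)"
  define rem where "rem n v = card {i \<in> I. w i = v \<and> n \<le> \<kappa> i}" for n v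
  define Y where "Y n xs v = (if n < m * v then C ^ rem n v else pochhammer (wt xs v) (rem n v))" for n xs v
  define W where "W = w ` I"
  define h where "h n xs = of_bool (\<forall>i\<in>I. \<kappa> i < n \<longrightarrow> xs ! \<kappa> i = w i) * (\<Prod>v\<in>W. Y n xs v)" for n xs
  \<comment> \<open>The factor of one step: a prescribed edge costs \<open>1 / cc n\<close>, and
    each outstanding constraint with a complete target contributes the mean growth
    \<open>1 + 1 / cc n\<close> of that target's weight.\<close>
  define \<phi> where "\<phi> n = (\<Prod>i\<in>I. if \<kappa> i = n then 1 / cc n else if m * w i \<le> n \<and> n < \<kappa> i then 1 + 1 / cc n else 1)" for n
  have finW: "finite W" by (simp add: W_def fin)
  have W1: "v \<in> W \<Longrightarrow> 1 \<le> v" for v using w1 by (auto simp: W_def)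
  have mw: "i \<in> I \<Longrightarrow> m * w i \<le> \<kappa> i" for i using w2 src_gt_iff by auto
  have C1: "C \<ge> 1" by (simp add: C_def)
  have wtp: "wt xs v > 0" if "m * v \<le> n" "valid n xs" "1 \<le> v" for n xs v
    using that wt_pos[of v xs] src_gt_iff[of v n] pa_valid_length by auto
  have Y0: "Y n xs v \<ge> 0" if "valid n xs" "v \<in> W" for n xs v
    using that C1 wtp[of v n xs] W1 by (auto simp: Y_def intro!: pochhammer_nonneg)
  have \<phi>0: "\<phi> n \<ge> 0" for n
    unfolding \<phi>_def using cc_pos[of n] by (intro prod_nonneg) (auto intro: add_nonneg_nonneg)
  have rem2: "rem n v \<le> 2" for n v
    unfolding rem_def using fin by (intro order_trans[OF card_mono mult[of v]]) auto
  have rem_eq: "rem (Suc n) v = rem n v" if "\<And>i. i \<in> I \<Longrightarrow> w i = v \<Longrightarrow> \<kappa> i \<noteq> n" for n v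
  proof -
    have "{i \<in> I. w i = v \<and> Suc n \<le> \<kappa> i} = {i \<in> I. w i = v \<and> n \<le> \<kappa> i}"
      using that by (auto simp: Suc_le_eq le_less)
    then show ?thesis by (simp add: rem_def)
  qed
  have Ystep: "Y (Suc n) (xs @ [v]) u \<le> Y n xs u * (1 + (if v = u \<and> m * u \<le> n then rem n u / wt xs u else 0))"
    if va: "valid n xs" "v \<in> {1..src n}" "u \<in> W" and ne: "\<And>i. i \<in> I \<Longrightarrow> w i = u \<Longrightarrow> \<kappa> i \<noteq> n" for n xs v u
  proof -
    have l: "length xs = n" using va pa_valid_length by blast
    have re: "rem (Suc n) u = rem n u" using ne by (rule rem_eq)
    consider "Suc n < m * u" | "Suc n = m * u" | "m * u \<le> n" by linarith
    then show ?thesis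
    proof cases
      case 1
      then show ?thesis by (simp add: Y_def re)
    next
      case 2
      have "dg (xs @ [v]) u \<le> 2 * m"
        using va 2 W1[of u] pa_valid_snoc[of m n xs v] by (intro deg_birth[of "Suc n"]) auto
      then have b: "wt (xs @ [v]) u \<le> 2 * m" using delta_neg by (simp add: wt_def)
      have p: "wt (xs @ [v]) u > 0" using 2 va W1[of u] pa_valid_snoc[of m n xs v] by (intro wtp[of u "Suc n"]) auto
      \<comment> \<open>Vertex \<open>u\<close> has just become complete. Its weight is at most
        \<open>2 * m\<close>, and with at most two constraints left every factor of the rising
        factorial is at most \<open>2 * m + 1\<close>; this dictates \<open>C\<close>.\<close>
      have "pochhammer (wt (xs @ [v]) u) (rem n u) \<le> C ^ rem n u"
      proof -
        have "pochhammer (wt (xs @ [v]) u) (rem n u) = (\<Prod>i\<in>{0..<rem n u}. wt (xs @ [v]) u + real i)"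
          by (simp add: pochhammer_prod)
        also have "\<dots> \<le> (\<Prod>i\<in>{0..<rem n u}. C)"
          using p b rem2[of n u] by (intro prod_mono) (auto simp: C_def)
        finally show ?thesis by simp
      qed
      then show ?thesis unfolding Y_def re using 2 by simp
    next
      case 3
      have "wt (xs @ [v]) u = wt xs u + (if v = u then 1 else 0)"
        using 3 l by (intro wt_snoc_old) auto
      moreover have "wt xs u > 0" using 3 va W1 by (intro wtp[of u n]) auto
      ultimately show ?thesis using 3 pochhammer_shift[of "wt xs u" "rem n u"] by (simp add: Y_def re)
    qed
  qed
  have step: "(\<Sum>v\<in>{1..src n}. q xs v * h (Suc n) (xs @ [v])) \<le> \<phi> n * h n xs"
    if n: "n < N" and va: "valid n xs" for n xs
  proof (cases "\<forall>i\<in>I. \<kappa> i < n \<longrightarrow> xs ! \<kappa> i = w i")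
    case False
    have l: "length xs = n" using va pa_valid_length by blast
    have "h (Suc n) (xs @ [v]) = 0" for v
      using False l by (auto simp: h_def nth_append)
    moreover have "h n xs = 0" using False by (auto simp: h_def)
    ultimately show ?thesis by simp
  next
    case True
    have l: "length xs = n" using va pa_valid_length by blast
    have hn: "h n xs = (\<Prod>v\<in>W. Y n xs v)" using True by (simp add: h_def)
    have hn0: "(\<Prod>v\<in>W. Y n xs v) \<ge> 0" using Y0[OF va] by (intro prod_nonneg) auto
    show ?thesis
    proof (cases "\<exists>i\<in>I. \<kappa> i = n")
      case ex: True
      then obtain i0 where i0: "i0 \<in> I" "\<kappa> i0 = n" by auto
      define u where "u = w i0"
      have u: "u \<in> W" "m * u \<le> n" "1 \<le> u" "u < src n"
        using i0 mw[of i0] w1[of i0] w2[of i0] by (auto simp: u_def W_def)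
      have uniq: "i = i0" if "i \<in> I" "\<kappa> i = n" for i
        using inj i0 that by (auto simp: inj_on_def)
      have hS: "h (Suc n) (xs @ [v]) = of_bool (v = u) * (\<Prod>v'\<in>W. Y (Suc n) (xs @ [v]) v')" for v
      proof -
        have "(\<forall>i\<in>I. \<kappa> i < Suc n \<longrightarrow> (xs @ [v]) ! \<kappa> i = w i) \<longleftrightarrow> v = u"
        proof
          assume "\<forall>i\<in>I. \<kappa> i < Suc n \<longrightarrow> (xs @ [v]) ! \<kappa> i = w i"
          then have "(xs @ [v]) ! \<kappa> i0 = w i0" using i0 by blast
          then show "v = u" using i0(2) l by (simp add: u_def nth_append)
        next
          assume vu: "v = u"
          show "\<forall>i\<in>I. \<kappa> i < Suc n \<longrightarrow> (xs @ [v]) ! \<kappa> i = w i"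
          proof (intro ballI impI)
            fix i assume i: "i \<in> I" "\<kappa> i < Suc n"
            show "(xs @ [v]) ! \<kappa> i = w i"
            proof (cases "\<kappa> i = n")
              case eq: True
              then show ?thesis using uniq[OF i(1)] l vu by (simp add: u_def nth_append)
            next
              case False
              then show ?thesis using i True l by (simp add: nth_append)
            qed
          qed
        qed
        then show ?thesis unfolding h_def by simp
      qed
      have "(\<Sum>v\<in>{1..src n}. q xs v * h (Suc n) (xs @ [v])) = q xs u * (\<Prod>v'\<in>W. Y (Suc n) (xs @ [u]) v')"
      proof -
        have "(\<Sum>v\<in>{1..src n}. q xs v * h (Suc n) (xs @ [v])) = (\<Sum>v\<in>{1..src n}. if v = u then q xs u * (\<Prod>v'\<in>W. Y (Suc n) (xs @ [u]) v') else 0)"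
          by (intro sum.cong) (auto simp: hS)
        then show ?thesis using u by simp
      qed
      also have "\<dots> = q xs u * Y (Suc n) (xs @ [u]) u * (\<Prod>v'\<in>W - {u}. Y (Suc n) (xs @ [u]) v')"
        using finW u by (simp add: prod.remove)
      \<comment> \<open>Hitting \<open>u\<close> raises its weight by one and uses up one
        constraint. Since \<open>pochhammer x (Suc r) = x * pochhammer (x + 1) r\<close>, the
        attachment probability supplies exactly the missing factor.\<close>
      also have "q xs u * Y (Suc n) (xs @ [u]) u = Y n xs u / cc n"
      proof -
        have "{i \<in> I. w i = u \<and> n \<le> \<kappa> i} = insert i0 {i \<in> I. w i = u \<and> Suc n \<le> \<kappa> i}"
        proof (intro equalityI subsetI)
          fix i assume i: "i \<in> {i \<in> I. w i = u \<and> n \<le> \<kappa> i}"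
          show "i \<in> insert i0 {i \<in> I. w i = u \<and> Suc n \<le> \<kappa> i}"
          proof (cases "\<kappa> i = n")
            case eq: True
            then have "i = i0" using i uniq[of i] by blast
            then show ?thesis by simp
          next
            case False
            then show ?thesis using i by auto
          qed
        next
          fix i assume i: "i \<in> insert i0 {i \<in> I. w i = u \<and> Suc n \<le> \<kappa> i}"
          show "i \<in> {i \<in> I. w i = u \<and> n \<le> \<kappa> i}"
          proof (cases "i = i0")
            case eq: True
            show ?thesis unfolding eq using i0 by (simp add: u_def)
          next
            case False
            then show ?thesis using i by auto
          qed
        qed
        then have r: "rem n u = Suc (rem (Suc n) u)" using fin i0 by (simp add: rem_def)
        have "wt (xs @ [u]) u = wt xs u + 1" using u l by (subst wt_snoc_old) auto
        then have "wt xs u * Y (Suc n) (xs @ [u]) u = Y n xs u"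
          using u(2) by (simp add: Y_def r pochhammer_rec)
        then show ?thesis using q_old[of u xs] u l by simp
      qed
      also have "Y n xs u / cc n * (\<Prod>v'\<in>W - {u}. Y (Suc n) (xs @ [u]) v')
          \<le> Y n xs u / cc n * (\<Prod>v'\<in>W - {u}. Y n xs v')"
      proof (intro mult_left_mono prod_mono conjI)
        fix v' assume v': "v' \<in> W - {u}"
        then show "0 \<le> Y (Suc n) (xs @ [u]) v'" using va u by (intro Y0) auto
        have "Y (Suc n) (xs @ [u]) v' \<le> Y n xs v' * (1 + (if u = v' \<and> m * v' \<le> n then rem n v' / wt xs v' else 0))"
        proof (rule Ystep)
          fix i assume "i \<in> I" "w i = v'"
          then show "\<kappa> i \<noteq> n" using uniq[of i] v' by (metis DiffD2 singletonI u_def)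
        qed (use va u v' in auto)
        then show "Y (Suc n) (xs @ [u]) v' \<le> Y n xs v'" using v' by simp
      qed (use Y0[OF va] u cc_pos[of n] in auto)
      also have "\<dots> = 1 / cc n * h n xs"
        using finW u by (simp add: hn prod.remove)
      also have "\<dots> \<le> \<phi> n * h n xs"
      proof (intro mult_right_mono)
        have "\<phi> n = 1 / cc n * (\<Prod>i\<in>I - {i0}. if \<kappa> i = n then 1 / cc n else if m * w i \<le> n \<and> n < \<kappa> i then 1 + 1 / cc n else 1)"
          using fin i0 by (simp add: \<phi>_def prod.remove)
        moreover have "(\<Prod>i\<in>I - {i0}. if \<kappa> i = n then 1 / cc n else if m * w i \<le> n \<and> n < \<kappa> i then 1 + 1 / cc n else 1) \<ge> 1"
        proof (intro prod_ge_1)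
          fix i assume "i \<in> I - {i0}"
          then have "\<kappa> i \<noteq> n" using uniq[of i] by blast
          then show "1 \<le> (if \<kappa> i = n then 1 / cc n else if m * w i \<le> n \<and> n < \<kappa> i then 1 + 1 / cc n else 1)"
            using cc_pos[of n] by simp
        qed
        ultimately show "1 / cc n \<le> \<phi> n" using cc_pos[of n]
          by (simp add: divide_right_mono)
      qed (use hn hn0 in auto)
      finally show ?thesis .
    next
      case nex: False
      have hS: "h (Suc n) (xs @ [v]) = (\<Prod>v'\<in>W. Y (Suc n) (xs @ [v]) v')" for v
      proof -
        have "(\<forall>i\<in>I. \<kappa> i < Suc n \<longrightarrow> (xs @ [v]) ! \<kappa> i = w i)"
          using True nex l by (auto simp: nth_append less_Suc_eq)
        then show ?thesis unfolding h_def by simp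
      qed
      define b where "b u = (if m * u \<le> n then rem n u / wt xs u else 0)" for u
      have "(\<Sum>v\<in>{1..src n}. q xs v * h (Suc n) (xs @ [v]))
         \<le> (\<Sum>v\<in>{1..src n}. q xs v * (h n xs * (1 + (\<Sum>u\<in>W. if v = u then b u else 0))))"
      proof (intro sum_mono mult_left_mono q_nonneg)
        fix v assume v: "v \<in> {1..src n}"
        have "h (Suc n) (xs @ [v]) \<le> (\<Prod>u\<in>W. Y n xs u * (1 + (if v = u then b u else 0)))"
          unfolding hS
        proof (intro prod_mono conjI)
          fix u assume u: "u \<in> W"
          then show "0 \<le> Y (Suc n) (xs @ [v]) u" using va v by (intro Y0) auto
          have "Y (Suc n) (xs @ [v]) u \<le> Y n xs u * (1 + (if v = u \<and> m * u \<le> n then rem n u / wt xs u else 0))"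
            using u v va nex by (intro Ystep) auto
          also have "(if v = u \<and> m * u \<le> n then rem n u / wt xs u else 0) = (if v = u then b u else 0)"
            by (simp add: b_def)
          finally show "Y (Suc n) (xs @ [v]) u \<le> Y n xs u * (1 + (if v = u then b u else 0))" .
        qed
        also have "\<dots> = h n xs * (\<Prod>u\<in>W. 1 + (if v = u then b u else 0))"
          by (simp add: prod.distrib hn)
        \<comment> \<open>The new target \<open>v\<close> equals at most one \<open>u\<close>, so at
          most one factor differs from 1.\<close>
        also have "(\<Prod>u\<in>W. 1 + (if v = u then b u else 0)) = 1 + (\<Sum>u\<in>W. if v = u then b u else 0)"
        proof -
          have "(\<Prod>u\<in>W. 1 + (if v = u then b u else 0)) = (\<Prod>u\<in>W. if v = u then 1 + b u else 1)"
            by (intro prod.cong) auto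
          then show ?thesis using finW by simp
        qed
        finally show "h (Suc n) (xs @ [v]) \<le> h n xs * (1 + (\<Sum>u\<in>W. if v = u then b u else 0))" .
      qed
      also have "\<dots> = h n xs * ((\<Sum>v\<in>{1..src n}. q xs v) + (\<Sum>v\<in>{1..src n}. \<Sum>u\<in>W. q xs v * (if v = u then b u else 0)))"
        by (simp add: sum_distrib_left sum.distrib algebra_simps)
      also have "(\<Sum>v\<in>{1..src n}. \<Sum>u\<in>W. q xs v * (if v = u then b u else 0))
         = (\<Sum>u\<in>W. \<Sum>v\<in>{1..src n}. if v = u then q xs u * b u else 0)"
        by (subst sum.swap) (intro sum.cong; auto)
      also have "\<dots> = (\<Sum>u\<in>W. if m * u \<le> n then rem n u / cc n else 0)"
      proof (intro sum.cong refl)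
        fix u assume u: "u \<in> W"
        show "(\<Sum>v\<in>{1..src n}. if v = u then q xs u * b u else 0) = (if m * u \<le> n then rem n u / cc n else 0)"
        proof (cases "m * u \<le> n")
          case True
          then have "u < src n" using src_gt_iff by simp
          then have "q xs u = wt xs u / cc n" using q_old[of u xs] W1[OF u] l by simp
          moreover have "wt xs u > 0" using True va W1[OF u] by (intro wtp[of u n]) auto
          ultimately have "q xs u * b u = rem n u / cc n" using True by (simp add: b_def)
          then show ?thesis using True \<open>u < src n\<close> W1[OF u] by simp
        qed (auto simp: b_def)
      qed
      also have "\<dots> = real (card {i \<in> I. m * w i \<le> n \<and> n < \<kappa> i}) / cc n"
      proof -
        have "(\<Sum>u\<in>W. if m * u \<le> n then rem n u / cc n else 0) = (\<Sum>u\<in>{u\<in>W. m * u \<le> n}. real (rem n u)) / cc n"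
          using finW by (simp add: sum.inter_filter sum_divide_distrib if_distrib[of "\<lambda>z. z / _"] cong: if_cong)
        also have "(\<Sum>u\<in>{u\<in>W. m * u \<le> n}. real (rem n u)) = real (\<Sum>u\<in>{u\<in>W. m * u \<le> n}. card {i \<in> I. w i = u \<and> n \<le> \<kappa> i})"
          by (simp add: rem_def)
        also have "(\<Sum>u\<in>{u\<in>W. m * u \<le> n}. card {i \<in> I. w i = u \<and> n \<le> \<kappa> i})
           = card (\<Union>u\<in>{u\<in>W. m * u \<le> n}. {i \<in> I. w i = u \<and> n \<le> \<kappa> i})"
          using finW fin by (subst card_UN_disjoint) auto
        also have "(\<Union>u\<in>{u\<in>W. m * u \<le> n}. {i \<in> I. w i = u \<and> n \<le> \<kappa> i}) = {i \<in> I. m * w i \<le> n \<and> n < \<kappa> i}"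
          using nex by (auto simp: W_def le_less)
        finally show ?thesis .
      qed
      also have "(\<Sum>v\<in>{1..src n}. q xs v) = 1" using va by (rule sum_q)
      also have "h n xs * (1 + real (card {i \<in> I. m * w i \<le> n \<and> n < \<kappa> i}) / cc n) \<le> h n xs * \<phi> n"
      proof (intro mult_left_mono)
        \<comment> \<open>With no edge prescribed at \<open>n\<close>, the factor is a pure power,
          and Bernoulli's inequality compares it with the sum over the targets.\<close>
        have "\<phi> n = (\<Prod>i\<in>I. if m * w i \<le> n \<and> n < \<kappa> i then 1 + 1 / cc n else 1)"
          unfolding \<phi>_def using nex by (intro prod.cong) auto
        also have "\<dots> = (1 + 1 / cc n) ^ card {i \<in> I. m * w i \<le> n \<and> n < \<kappa> i}"
          using fin by (subst prod.inter_filter[symmetric]) auto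
        also have "\<dots> \<ge> 1 + real (card {i \<in> I. m * w i \<le> n \<and> n < \<kappa> i}) * (1 / cc n)"
          using cc_pos[of n] by (intro Bernoulli_inequality) (auto intro: order_trans[of _ 0])
        finally show "1 + real (card {i \<in> I. m * w i \<le> n \<and> n < \<kappa> i}) / cc n \<le> \<phi> n" by simp
      qed (use hn hn0 in auto)
      finally show ?thesis by (simp add: mult.commute)
    qed
  qed
  have "E N (h N) \<le> (\<Prod>k\<in>{0..<N}. \<phi> k) * E 0 (h 0)"
    using step \<phi>0 by (intro E_iter_le) auto
  moreover have "E N (h N) = E N (\<lambda>xs. of_bool (\<forall>i\<in>I. xs ! \<kappa> i = w i))"
  proof (intro E_cong)
    fix xs
    have "rem N v = 0" for v using \<kappa>N fin by (auto simp: rem_def not_le card_eq_0_iff)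
    then have "Y N xs v = 1" for v unfolding Y_def by simp
    then have "(\<Prod>v\<in>W. Y N xs v) = 1" by simp
    then show "h N xs = of_bool (\<forall>i\<in>I. xs ! \<kappa> i = w i)"
      using \<kappa>N by (auto simp: h_def)
  qed
  \<comment> \<open>At time 0 no target is complete, so every constraint contributes one factor
    \<open>C\<close>.\<close>
  moreover have "E 0 (h 0) = C ^ card I"
  proof -
    have "E 0 (h 0) = (\<Prod>v\<in>W. C ^ card {i \<in> I. w i = v})"
      unfolding E_0 h_def using W1 m_pos by (auto simp: Y_def rem_def Suc_le_eq intro!: prod.cong)
    also have "\<dots> = C ^ (\<Sum>v\<in>W. card {i \<in> I. w i = v})" by (simp add: power_sum)
    also have "(\<Sum>v\<in>W. card {i \<in> I. w i = v}) = card (\<Union>v\<in>W. {i \<in> I. w i = v})"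
      using finW fin by (subst card_UN_disjoint) auto
    also have "(\<Union>v\<in>W. {i \<in> I. w i = v}) = I" by (auto simp: W_def)
    finally show ?thesis .
  qed
  \<comment> \<open>Exchanging the products over time and over constraints leaves each constraint
    with the growth of its target from completion to the prescribed edge, and with one
    \<open>1 / cc\<close>.\<close>
  moreover have "(\<Prod>k\<in>{0..<N}. \<phi> k) = (\<Prod>i\<in>I. growth (m * w i) (\<kappa> i) / cc (\<kappa> i))"
  proof -
    have "(\<Prod>k\<in>{0..<N}. \<phi> k) = (\<Prod>i\<in>I. \<Prod>k\<in>{0..<N}. if \<kappa> i = k then 1 / cc k else if m * w i \<le> k \<and> k < \<kappa> i then 1 + 1 / cc k else 1)"
      unfolding \<phi>_def by (rule prod.swap)
    also have "\<dots> = (\<Prod>i\<in>I. growth (m * w i) (\<kappa> i) / cc (\<kappa> i))"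
    proof (intro prod.cong refl)
      fix i assume i: "i \<in> I"
      have "(\<Prod>k\<in>{0..<N}. if \<kappa> i = k then 1 / cc k else if m * w i \<le> k \<and> k < \<kappa> i then 1 + 1 / cc k else 1)
         = (\<Prod>k\<in>{0..<N}. (if \<kappa> i = k then 1 / cc k else 1) * (if m * w i \<le> k \<and> k < \<kappa> i then 1 + 1 / cc k else 1))"
        by (intro prod.cong) auto
      also have "\<dots> = 1 / cc (\<kappa> i) * (\<Prod>k\<in>{k\<in>{0..<N}. m * w i \<le> k \<and> k < \<kappa> i}. 1 + 1 / cc k)"
        using \<kappa>N[OF i] unfolding prod.distrib by (subst prod.inter_filter) auto
      also have "{k\<in>{0..<N}. m * w i \<le> k \<and> k < \<kappa> i} = {m * w i..<\<kappa> i}"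
        using \<kappa>N[OF i] by auto
      finally show "(\<Prod>k\<in>{0..<N}. if \<kappa> i = k then 1 / cc k else if m * w i \<le> k \<and> k < \<kappa> i then 1 + 1 / cc k else 1)
        = growth (m * w i) (\<kappa> i) / cc (\<kappa> i)" by (simp add: growth_def)
    qed
    finally show ?thesis .
  qed
  ultimately have "E N (\<lambda>xs. of_bool (\<forall>i\<in>I. xs ! \<kappa> i = w i)) \<le> C ^ card I * (\<Prod>i\<in>I. growth (m * w i) (\<kappa> i) / cc (\<kappa> i))"
    by (simp add: mult.commute)
  also have "\<dots> = (\<Prod>i\<in>I. C * (growth (m * w i) (\<kappa> i) / cc (\<kappa> i)))"
    unfolding prod.distrib prod_constant ..
  finally show ?thesis by (simp add: C_def)
qed

section \<open>First-moment bound for a single path\<close>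

definition K0 :: real where "K0 = 4 * real m + 2"

text \<open>The price of one path edge, with all \<open>m\<close> slots of the younger end taken
  together. In \<open>K0 = 2 * (2 * m + 1)\<close> the second factor comes from
  \<open>constraint_prob\<close>, and the 2 from \<open>cc k \<ge> m * M / 2\<close> in
  \<open>edge_bound\<close>.\<close>

definition pk :: "nat \<Rightarrow> nat \<Rightarrow> real" where
  "pk a b = K0 * real (min a b) powr (- \<gamma>) * real (max a b) powr (\<gamma> - 1)"

lemma K0_pos: "K0 > 0" by (simp add: K0_def add_pos_nonneg)

lemma pk_nonneg: "pk a b \<ge> 0" using K0_pos by (simp add: pk_def)

lemma edge_bound:
  assumes "1 \<le> w" "w < M" "k \<in> {m * (M - 1)..<m * M}"
  shows "real (2 * m + 1) * growth (m * w) k / cc k \<le> K0 / m * real w powr (- \<gamma>) * real M powr (\<gamma> - 1)"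
proof -
  have "m * w \<le> m * (M - 1)" using assms by (intro mult_le_mono2) auto
  also have "\<dots> \<le> k" using assms by simp
  finally have mw: "1 \<le> m * w" "m * w \<le> k" using assms m_pos by auto
  have "growth (m * w) k \<le> (real k / real (m * w)) powr \<gamma>" by (rule growth_le[OF mw])
  also have "\<dots> \<le> (real M / real w) powr \<gamma>"
  proof (intro powr_mono2)
    have "real k \<le> real (m * M)" using assms by (intro of_nat_mono) auto
    then have "real k / real (m * w) \<le> real (m * M) / real (m * w)" by (intro divide_right_mono) auto
    then show "real k / real (m * w) \<le> real M / real w" using m_pos by simp
  qed (use chi in auto)
  finally have g: "growth (m * w) k \<le> (real M / real w) powr \<gamma>" .
  have "2 * (m * (M - 1)) \<ge> m * M" using assms m_pos by (cases M) (auto simp: algebra_simps)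
  then have "real (m * M) / 2 \<le> real (m * (M - 1))" by linarith
  also have "\<dots> \<le> real k" using assms by (intro of_nat_mono) auto
  also have "\<dots> \<le> real k * (1 + \<rho>)" using rho by (simp add: mult_le_cancel_left1)
  also have "\<dots> \<le> cc k" using rho by (simp add: cc_eq)
  finally have c: "real (m * M) / 2 \<le> cc k" .
  have "real (2 * m + 1) * growth (m * w) k / cc k \<le> real (2 * m + 1) * (real M / real w) powr \<gamma> / (real (m * M) / 2)"
    using g c growth_pos[of "m * w" k] assms m_pos by (intro frac_le mult_left_mono) auto
  also have "\<dots> = K0 / m * real w powr (- \<gamma>) * (real M powr \<gamma> / real M)"
    using assms m_pos by (simp add: K0_def powr_divide powr_minus_divide field_simps)
  also have "real M powr \<gamma> / real M = real M powr (\<gamma> - 1)"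
    using assms by (simp add: powr_diff)
  finally show ?thesis .
qed

definition is_path :: "nat list \<Rightarrow> nat list \<Rightarrow> bool" where
  "is_path xs vs \<longleftrightarrow> (\<forall>i. Suc i < length vs \<longrightarrow> pa_adj m xs (vs ! i) (vs ! Suc i))"

text \<open>Union bound over slots: each path edge occupies one of the \<open>m\<close> slots of its
  younger end, recorded by \<open>\<kappa>\<close>, and \<open>constraint_prob\<close> bounds the
  probability of each assignment.\<close>

lemma path_prob:
  assumes dist: "distinct vs" and len: "length vs = Suc n" and vs: "set vs \<subseteq> {1..t}"
  shows "E (m * t) (\<lambda>xs. of_bool (is_path xs vs)) \<le> (\<Prod>i<n. pk (vs ! i) (vs ! Suc i))"
proof -
  define w where "w i = min (vs ! i) (vs ! Suc i)" for i
  define M where "M i = max (vs ! i) (vs ! Suc i)" for i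
  define A where "A i = {m * (M i - 1)..<m * M i}" for i
  define P where "P = PiE {..<n} A"
  have finP: "finite P" unfolding P_def A_def by (intro finite_PiE) auto
  have neq: "vs ! i \<noteq> vs ! Suc i" if "i < n" for i
    using dist that len by (simp add: nth_eq_iff_index_eq)
  have rng: "vs ! i \<in> {1..t}" if "i \<le> n" for i
    using subsetD[OF vs nth_mem[of i vs]] that len by simp
  have wM: "1 \<le> w i" "w i < M i" "M i \<le> t" if "i < n" for i
    using neq[OF that] rng[of i] rng[of "Suc i"] that by (auto simp: w_def M_def)
  have srcA: "src k = M i" if "k \<in> A i" "i < n" for k i
  proof -
    have M: "M i \<ge> 1" using wM[OF that(2)] by simp
    then obtain M' where M': "M i = Suc M'" by (cases "M i") auto
    have "k div m = M'" using that M' by (simp add: A_def div_m_iff)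
    then show ?thesis by (simp add: pa_src_def M')
  qed
  have "E (m * t) (\<lambda>xs. of_bool (is_path xs vs))
    \<le> E (m * t) (\<lambda>xs. \<Sum>\<kappa>\<in>P. of_bool (\<forall>i\<in>{..<n}. xs ! \<kappa> i = w i))"
  proof (intro E_mono)
    fix xs assume v: "valid (m * t) xs"
    show "of_bool (is_path xs vs) \<le> (\<Sum>\<kappa>\<in>P. of_bool (\<forall>i\<in>{..<n}. xs ! \<kappa> i = w i) :: real)"
    proof (cases "is_path xs vs")
      case True
      have "\<exists>k. k \<in> A i \<and> xs ! k = w i" if "i < n" for i
      proof -
        have "pa_adj m xs (vs ! i) (vs ! Suc i)" using True that len by (simp add: is_path_def)
        then obtain k where k: "k < length xs"
          "(src k = vs ! i \<and> xs ! k = vs ! Suc i) \<or> (src k = vs ! Suc i \<and> xs ! k = vs ! i)"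
          by (auto simp: pa_adj_def)
        have "xs ! k \<le> src k" using v k(1) by (auto simp: pa_valid_def)
        then have s: "src k = M i" "xs ! k = w i" using k(2) by (auto simp: M_def w_def)
        obtain M' where M': "M i = Suc M'" using wM(2)[of i] \<open>i < n\<close> by (cases "M i") auto
        have "k div m = M'" using s M' by (simp add: pa_src_def)
        then have "k \<in> A i" by (simp add: A_def div_m_iff M')
        then show ?thesis using s by auto
      qed
      then obtain k where k: "\<And>i. i < n \<Longrightarrow> k i \<in> A i \<and> xs ! k i = w i" by metis
      define \<kappa> where "\<kappa> = restrict k {..<n}"
      have "\<kappa> \<in> P" using k by (auto simp: P_def \<kappa>_def)
      moreover have "\<forall>i\<in>{..<n}. xs ! \<kappa> i = w i" using k by (auto simp: \<kappa>_def)
      ultimately have "1 \<le> (\<Sum>\<kappa>\<in>P. of_bool (\<forall>i\<in>{..<n}. xs ! \<kappa> i = w i) :: real)"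
        using finP by (subst sum.remove[of _ \<kappa>]) (auto intro!: sum_nonneg)
      then show ?thesis by (auto intro: order_trans[rotated])
    qed (auto intro!: sum_nonneg)
  qed
  also have "\<dots> = (\<Sum>\<kappa>\<in>P. E (m * t) (\<lambda>xs. of_bool (\<forall>i\<in>{..<n}. xs ! \<kappa> i = w i)))"
    by (rule E_sum)
  also have "\<dots> \<le> (\<Sum>\<kappa>\<in>P. \<Prod>i<n. pk (vs ! i) (vs ! Suc i) / m)"
  proof (intro sum_mono)
    fix \<kappa> assume "\<kappa> \<in> P"
    then have \<kappa>: "\<kappa> i \<in> A i" if "i < n" for i using that by (auto simp: P_def)
    show "E (m * t) (\<lambda>xs. of_bool (\<forall>i\<in>{..<n}. xs ! \<kappa> i = w i)) \<le> (\<Prod>i<n. pk (vs ! i) (vs ! Suc i) / m)"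
    proof (cases "inj_on \<kappa> {..<n}")
      case True
      have "E (m * t) (\<lambda>xs. of_bool (\<forall>i\<in>{..<n}. xs ! \<kappa> i = w i))
         \<le> (\<Prod>i\<in>{..<n}. real (2 * m + 1) * growth (m * w i) (\<kappa> i) / cc (\<kappa> i))"
      proof (rule constraint_prob)
        fix i assume "i \<in> {..<n}"
        then have i: "i < n" by simp
        have "\<kappa> i < m * M i" using \<kappa>[OF i] by (simp add: A_def)
        also have "\<dots> \<le> m * t" using wM[OF i] by simp
        finally show "\<kappa> i < m * t" .
        show "1 \<le> w i" using wM[OF i] by simp
        show "w i < src (\<kappa> i)" using srcA[OF \<kappa>[OF i] i] wM[OF i] by simp
      next
        fix v
        \<comment> \<open>On a self-avoiding path a vertex meets at most two edges, hence is the
          older end of at most two.\<close>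
        show "card {i \<in> {..<n}. w i = v} \<le> 2"
        proof (cases "v \<in> set vs")
          case True
          then obtain p where p: "p < length vs" "vs ! p = v" by (auto simp: in_set_conv_nth)
          have "{i \<in> {..<n}. w i = v} \<subseteq> {p - 1, p}"
          proof
            fix i assume "i \<in> {i \<in> {..<n}. w i = v}"
            then have i: "i < n" "w i = v" by auto
            then have "vs ! i = v \<or> vs ! Suc i = v" by (auto simp: w_def min_def split: if_splits)
            then have "i = p \<or> Suc i = p" using p dist i len by (auto simp: nth_eq_iff_index_eq)
            then show "i \<in> {p - 1, p}" by auto
          qed
          then have "card {i \<in> {..<n}. w i = v} \<le> card {p - 1, p}" by (intro card_mono) auto
          also have "\<dots> \<le> 2" by (simp add: card_insert_if)
          finally show ?thesis .
        next
          case False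
          have "{i \<in> {..<n}. w i = v} = {}"
            using False len nth_mem by (fastforce simp: w_def min_def split: if_splits)
          then show ?thesis by (metis card.empty zero_le)
        qed
      qed (use True in auto)
      also have "\<dots> \<le> (\<Prod>i<n. pk (vs ! i) (vs ! Suc i) / m)"
      proof (intro prod_mono conjI)
        fix i assume "i \<in> {..<n}"
        then have i: "i < n" by simp
        show "0 \<le> real (2 * m + 1) * growth (m * w i) (\<kappa> i) / cc (\<kappa> i)"
          using growth_pos[of "m * w i" "\<kappa> i"] cc_pos[of "\<kappa> i"] by auto
        have "real (2 * m + 1) * growth (m * w i) (\<kappa> i) / cc (\<kappa> i) \<le> K0 / m * real (w i) powr (- \<gamma>) * real (M i) powr (\<gamma> - 1)"
          using wM[OF i] \<kappa>[OF i] by (intro edge_bound) (auto simp: A_def)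
        also have "\<dots> = pk (vs ! i) (vs ! Suc i) / m" by (simp add: pk_def w_def M_def)
        finally show "real (2 * m + 1) * growth (m * w i) (\<kappa> i) / cc (\<kappa> i) \<le> pk (vs ! i) (vs ! Suc i) / m" .
      qed
      finally show ?thesis .
    next
      case False
      \<comment> \<open>A slot holds a single target. Two path edges with the same younger end have
        different older ends, so an assignment using a slot twice describes the empty event.\<close>
      then obtain i j where ij: "i < n" "j < n" "i \<noteq> j" "\<kappa> i = \<kappa> j" by (auto simp: inj_on_def)
      have "M i = M j" using srcA[OF \<kappa>] ij by metis
      moreover have "w i \<noteq> w j"
      proof
        assume "w i = w j"
        with \<open>M i = M j\<close> have "(vs ! i = vs ! j \<and> vs ! Suc i = vs ! Suc j) \<or> (vs ! i = vs ! Suc j \<and> vs ! Suc i = vs ! j)"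
          by (auto simp: w_def M_def min_def max_def split: if_splits)
        then show False using dist ij len by (auto simp: nth_eq_iff_index_eq)
      qed
      ultimately have "\<not> (\<forall>i\<in>{..<n}. xs ! \<kappa> i = w i)" for xs using ij by (metis lessThan_iff)
      then have "(\<lambda>xs. of_bool (\<forall>i\<in>{..<n}. xs ! \<kappa> i = w i) :: real) = (\<lambda>_. 0)" by auto
      then show ?thesis using E_const[of "m * t" 0] pk_nonneg by (auto intro!: prod_nonneg)
    qed
  qed
  also have "\<dots> = real (card P) * (\<Prod>i<n. pk (vs ! i) (vs ! Suc i) / m)" by simp
  also have "card P = m ^ n"
  proof -
    have "card (A i) = m" if "i < n" for i using wM[OF that] by (cases "M i") (auto simp: A_def)
    then have "(\<Prod>i<n. card (A i)) = (\<Prod>i<n. m)" by (intro prod.cong) auto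
    then show ?thesis unfolding P_def by (subst card_PiE) auto
  qed
  also have "real (m ^ n) * (\<Prod>i<n. pk (vs ! i) (vs ! Suc i) / m) = (\<Prod>i<n. pk (vs ! i) (vs ! Suc i))"
    using m_pos by (simp add: prod_dividef)
  finally show ?thesis .
qed

text \<open>\<open>F t g j w\<close> sums the edge weights over all vertex sequences of length \<open>j\<close> ending in \<open>w\<close>
  whose \<open>i\<close>-th vertex is at least \<open>g i\<close> for \<open>i < j\<close>.\<close>

fun path_sum :: "nat \<Rightarrow> (nat \<Rightarrow> real) \<Rightarrow> nat \<Rightarrow> nat \<Rightarrow> real" where
  "path_sum t g 0 w = 1"
| "path_sum t g (Suc j) w = (\<Sum>z\<in>{z\<in>{1..t}. g j \<le> real z}. path_sum t g j z * pk z w)"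

text \<open>The first vertex is left free: summing over it amounts, up to the factor
  \<open>t\<close>, to averaging over a uniform starting vertex.\<close>

definition plists :: "nat \<Rightarrow> (nat \<Rightarrow> real) \<Rightarrow> nat \<Rightarrow> nat set \<Rightarrow> nat list set" where
  "plists t g j B = {vs. length vs = Suc j \<and> set vs \<subseteq> {1..t} \<and> (\<forall>i<j. g i \<le> real (vs ! i)) \<and> vs ! j \<in> B}"

lemma finite_plists: "finite (plists t g j B)"
proof (rule finite_subset)
  show "plists t g j B \<subseteq> {vs. set vs \<subseteq> {1..t} \<and> length vs = Suc j}" by (auto simp: plists_def)
qed (auto intro: finite_lists_length_eq)

lemma plists_Suc:
  "plists t g (Suc j) B = (\<lambda>(vs, w). vs @ [w]) ` (plists t g j {z. g j \<le> real z} \<times> (B \<inter> {1..t}))"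
proof (intro equalityI subsetI)
  fix vs assume "vs \<in> plists t g (Suc j) B"
  then have vs: "length vs = Suc (Suc j)" "set vs \<subseteq> {1..t}" "\<And>i. i < Suc j \<Longrightarrow> g i \<le> real (vs ! i)" "vs ! Suc j \<in> B"
    by (auto simp: plists_def)
  define us where "us = butlast vs"
  have e: "vs = us @ [last vs]" using vs(1) by (metis append_butlast_last_id us_def list.size(3) nat.distinct(1))
  have lu: "length us = Suc j" using vs(1) by (simp add: us_def)
  have n: "us ! i = vs ! i" if "i < Suc j" for i using that lu by (subst e) (simp add: nth_append)
  have l: "last vs = vs ! Suc j" using lu by (subst (2) e) (simp add: nth_append)
  have "set us \<subseteq> {1..t}" using vs(2) e by (metis le_sup_iff set_append)
  then have "us \<in> plists t g j {z. g j \<le> real z}" using lu n vs(3) by (auto simp: plists_def)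
  moreover have "last vs \<in> B \<inter> {1..t}" using l vs(4) vs(1) subsetD[OF vs(2) nth_mem[of "Suc j" vs]] by simp
  ultimately show "vs \<in> (\<lambda>(vs, w). vs @ [w]) ` (plists t g j {z. g j \<le> real z} \<times> (B \<inter> {1..t}))"
    using e by (intro image_eqI[of _ _ "(us, last vs)"]) auto
next
  fix vs assume "vs \<in> (\<lambda>(vs, w). vs @ [w]) ` (plists t g j {z. g j \<le> real z} \<times> (B \<inter> {1..t}))"
  then show "vs \<in> plists t g (Suc j) B"
    by (auto simp: plists_def nth_append less_Suc_eq)
qed

lemma sum_plists: "(\<Sum>vs\<in>plists t g j B. \<Prod>i<j. pk (vs ! i) (vs ! Suc i)) = (\<Sum>w\<in>B \<inter> {1..t}. path_sum t g j w)"
proof (induction j arbitrary: B)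
  case 0
  have "plists t g 0 B = (\<lambda>w. [w]) ` (B \<inter> {1..t})"
  proof (intro equalityI subsetI)
    fix vs assume "vs \<in> plists t g 0 B"
    then show "vs \<in> (\<lambda>w. [w]) ` (B \<inter> {1..t})" by (cases vs) (auto simp: plists_def)
  qed (auto simp: plists_def)
  then show ?case by (simp add: card_image inj_on_def)
next
  case (Suc j)
  have "(\<Sum>vs\<in>plists t g (Suc j) B. \<Prod>i<Suc j. pk (vs ! i) (vs ! Suc i))
     = (\<Sum>(vs, w)\<in>plists t g j {z. g j \<le> real z} \<times> (B \<inter> {1..t}). \<Prod>i<Suc j. pk ((vs @ [w]) ! i) ((vs @ [w]) ! Suc i))"
    unfolding plists_Suc by (subst sum.reindex) (auto simp: inj_on_def case_prod_beta)
  also have "\<dots> = (\<Sum>(vs, w)\<in>plists t g j {z. g j \<le> real z} \<times> (B \<inter> {1..t}). (\<Prod>i<j. pk (vs ! i) (vs ! Suc i)) * pk (vs ! j) w)"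
    by (intro sum.cong) (auto simp: plists_def nth_append intro!: arg_cong2[where f = "(*)"] prod.cong)
  also have "\<dots> = (\<Sum>w\<in>B \<inter> {1..t}. \<Sum>vs\<in>plists t g j {z. g j \<le> real z}. (\<Prod>i<j. pk (vs ! i) (vs ! Suc i)) * pk (vs ! j) w)"
    by (subst sum.swap) (simp add: sum.cartesian_product)
  also have "\<dots> = (\<Sum>w\<in>B \<inter> {1..t}. path_sum t g (Suc j) w)"
  proof (intro sum.cong refl)
    fix w
    define Z where "Z = {z. g j \<le> real z} \<inter> {1..t}"
    have "(\<Sum>vs\<in>plists t g j {z. g j \<le> real z}. (\<Prod>i<j. pk (vs ! i) (vs ! Suc i)) * pk (vs ! j) w)
      = (\<Sum>z\<in>Z. \<Sum>vs\<in>{vs\<in>plists t g j {z. g j \<le> real z}. vs ! j = z}. (\<Prod>i<j. pk (vs ! i) (vs ! Suc i)) * pk (vs ! j) w)"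
    proof (rule sum.group[symmetric])
      show "(\<lambda>vs. vs ! j) ` plists t g j {z. g j \<le> real z} \<subseteq> Z"
      proof
        fix z assume "z \<in> (\<lambda>vs. vs ! j) ` plists t g j {z. g j \<le> real z}"
        then obtain vs where v: "vs \<in> plists t g j {z. g j \<le> real z}" "z = vs ! j" by auto
        then have "set vs \<subseteq> {1..t}" "length vs = Suc j" by (auto simp: plists_def)
        then have "z \<in> {1..t}" using v nth_mem[of j vs] by (metis lessI subsetD)
        then show "z \<in> Z" using v by (auto simp: Z_def plists_def)
      qed
    qed (auto simp: finite_plists Z_def)
    also have "\<dots> = (\<Sum>z\<in>Z. (\<Sum>vs\<in>plists t g j {z}. \<Prod>i<j. pk (vs ! i) (vs ! Suc i)) * pk z w)"
    proof (intro sum.cong refl)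
      fix z assume z: "z \<in> Z"
      have "{vs\<in>plists t g j {z. g j \<le> real z}. vs ! j = z} = plists t g j {z}"
        using z by (auto simp: plists_def Z_def)
      then show "(\<Sum>vs\<in>{vs\<in>plists t g j {z. g j \<le> real z}. vs ! j = z}. (\<Prod>i<j. pk (vs ! i) (vs ! Suc i)) * pk (vs ! j) w)
        = (\<Sum>vs\<in>plists t g j {z}. \<Prod>i<j. pk (vs ! i) (vs ! Suc i)) * pk z w"
        unfolding sum_distrib_right by (intro sum.cong) (auto simp: plists_def)
    qed
    also have "\<dots> = (\<Sum>z\<in>Z. path_sum t g j z * pk z w)"
      using Suc.IH by (intro sum.cong) (auto simp: Z_def)
    also have "Z = {z\<in>{1..t}. g j \<le> real z}" by (auto simp: Z_def)
    finally show "(\<Sum>vs\<in>plists t g j {z. g j \<le> real z}. (\<Prod>i<j. pk (vs ! i) (vs ! Suc i)) * pk (vs ! j) w) = path_sum t g (Suc j) w"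
      by simp
  qed
  finally show ?case .
qed

lemma E_paths:
  "E (m * t) (\<lambda>xs. \<Sum>vs\<in>{vs\<in>plists t g j B. distinct vs}. of_bool (is_path xs vs)) \<le> (\<Sum>w\<in>B \<inter> {1..t}. path_sum t g j w)"
proof -
  have "E (m * t) (\<lambda>xs. \<Sum>vs\<in>{vs\<in>plists t g j B. distinct vs}. of_bool (is_path xs vs))
    = (\<Sum>vs\<in>{vs\<in>plists t g j B. distinct vs}. E (m * t) (\<lambda>xs. of_bool (is_path xs vs)))"
    by (rule E_sum)
  also have "\<dots> \<le> (\<Sum>vs\<in>{vs\<in>plists t g j B. distinct vs}. \<Prod>i<j. pk (vs ! i) (vs ! Suc i))"
    by (intro sum_mono path_prob) (auto simp: plists_def)
  also have "\<dots> \<le> (\<Sum>vs\<in>plists t g j B. \<Prod>i<j. pk (vs ! i) (vs ! Suc i))"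
    by (intro sum_mono2 finite_plists) (auto intro!: prod_nonneg pk_nonneg)
  finally show ?thesis by (simp add: sum_plists)
qed

end

section \<open>The lower bound\<close>

lemma sum_powr_le:
  fixes a g :: real
  assumes a: "0 < a" "a \<le> 1" and g: "0 \<le> g"
  shows "(\<Sum>z\<in>{z\<in>{1..t}. real z \<le> g}. real z powr (a - 1)) \<le> g powr a / a"
proof -
  \<comment> \<open>The comparison with the integral of \<open>z powr (a - 1)\<close>, obtained by
    telescoping with \<open>powr_one_plus_le\<close> instead of integrating.\<close>
  have *: "(\<Sum>z\<in>{1..N}. real z powr (a - 1)) \<le> real N powr a / a" for N
  proof (induction N)
    case (Suc N)
    have "(real N / (real N + 1)) powr a = (1 + - 1 / (real N + 1)) powr a" by (simp add: field_simps)
    also have "\<dots> \<le> 1 + a * (- 1 / (real N + 1))" if "N > 0"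
      using a that by (intro powr_one_plus_le) (auto simp: field_simps)
    finally have 1: "(real N / (real N + 1)) powr a \<le> 1 - a / (real N + 1)"
      using a by (cases "N = 0") auto
    have p: "(real N + 1) powr a > 0" by simp
    have "real N powr a = (real N / (real N + 1)) powr a * (real N + 1) powr a"
      by (simp add: powr_divide)
    also have "\<dots> \<le> (1 - a / (real N + 1)) * (real N + 1) powr a"
      using 1 p by (intro mult_right_mono) auto
    also have "\<dots> = (real N + 1) powr a - a * ((real N + 1) powr a / (real N + 1))"
      by (simp add: algebra_simps)
    also have "(real N + 1) powr a / (real N + 1) = (real N + 1) powr (a - 1)"
      by (simp add: powr_diff)
    finally have "real N powr a / a \<le> (real N + 1) powr a / a - (real N + 1) powr (a - 1)"
      using a by (simp add: field_simps)
    then show ?case using Suc by (simp add: add.commute)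
  qed simp
  have "(\<Sum>z\<in>{z\<in>{1..t}. real z \<le> g}. real z powr (a - 1)) \<le> (\<Sum>z\<in>{1..nat \<lfloor>g\<rfloor>}. real z powr (a - 1))"
    by (intro sum_mono2) (auto simp: le_nat_floor)
  also have "\<dots> \<le> real (nat \<lfloor>g\<rfloor>) powr a / a" by (rule *)
  also have "\<dots> \<le> g powr a / a" using a g by (intro divide_right_mono powr_mono2) auto
  finally show ?thesis .
qed

lemma sum_powr_scaled:
  fixes a y :: real
  assumes a: "0 < a" "a \<le> 1" and y: "0 \<le> y" and t: "t \<ge> 1"
  shows "(\<Sum>z\<in>{z\<in>{1..t}. real z \<le> real t * y}. 1 / real t * (real z / real t) powr (a - 1)) \<le> y powr a / a"
proof -
  have "(\<Sum>z\<in>{z\<in>{1..t}. real z \<le> real t * y}. 1 / real t * (real z / real t) powr (a - 1))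
     = 1 / real t * real t powr (1 - a) * (\<Sum>z\<in>{z\<in>{1..t}. real z \<le> real t * y}. real z powr (a - 1))"
    unfolding sum_distrib_left
  proof (intro sum.cong refl)
    fix z
    have "real t powr (1 - a) = 1 / real t powr (a - 1)" by (metis minus_diff_eq powr_minus_divide)
    then show "1 / real t * (real z / real t) powr (a - 1) = 1 / real t * real t powr (1 - a) * real z powr (a - 1)"
      by (simp add: powr_divide)
  qed
  also have "\<dots> \<le> 1 / real t * real t powr (1 - a) * ((real t * y) powr a / a)"
    using a y by (intro mult_left_mono sum_powr_le) auto
  also have "\<dots> = (real t powr (1 - a) * real t powr a / real t) * (y powr a / a)"
    using y by (simp add: powr_mult)
  also have "real t powr (1 - a) * real t powr a / real t = 1"
    using t by (simp add: powr_add[symmetric])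
  finally show ?thesis by simp
qed

lemma sum_powr_unit:
  fixes a :: real
  assumes a: "0 < a" "a \<le> 1" and t: "t \<ge> 1" and Z: "Z \<subseteq> {1..t}"
  shows "(\<Sum>z\<in>Z. 1 / real t * (real z / real t) powr (a - 1)) \<le> 1 / a"
proof -
  have "(\<Sum>z\<in>Z. 1 / real t * (real z / real t) powr (a - 1))
     \<le> (\<Sum>z\<in>{z\<in>{1..t}. real z \<le> real t * 1}. 1 / real t * (real z / real t) powr (a - 1))"
    using Z by (intro sum_mono2) auto
  also have "\<dots> \<le> 1 powr a / a" using assms by (intro sum_powr_scaled) auto
  finally show ?thesis by simp
qed

context pref_att
begin

section \<open>The rescaled edge kernel and the recursion for path sums\<close>

lemma pk_scaled:
  assumes "z \<ge> 1" "w \<ge> 1" "t \<ge> 1"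
  shows "pk z w = K0 / real t * (min (real z / t) (real w / t) powr (- \<gamma>) * max (real z / t) (real w / t) powr (\<gamma> - 1))"
proof -
  have t: "real t > 0" using assms by simp
  have m1: "min (real z / t) (real w / t) = real (min z w) / t"
    using t by (auto simp: min_def divide_le_cancel)
  have m2: "max (real z / t) (real w / t) = real (max z w) / t"
    using t by (auto simp: max_def divide_le_cancel)
  have "real t powr (- \<gamma>) * real t powr (\<gamma> - 1) = 1 / real t"
    using t by (simp add: powr_add[symmetric])
  then have "1 / (real t powr (- \<gamma>) * real t powr (\<gamma> - 1)) = real t" by simp
  then have "K0 / real t * ((real (min z w) / t) powr (- \<gamma>) * (real (max z w) / t) powr (\<gamma> - 1))
     = K0 / real t * (real (min z w) powr (- \<gamma>) * real (max z w) powr (\<gamma> - 1) * real t)"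
    by (simp add: powr_divide divide_simps)
  then show ?thesis unfolding m1 m2 pk_def using t by simp
qed

text \<open>Multiplying the powers produces \<open>x powr (- 1)\<close> and
  \<open>x powr (- 2 * \<gamma>)\<close>, which are not summable at 0. Above the cutoff
  \<open>xj\<close> they are traded for \<open>x powr (\<nu> - 1)\<close> at the price of a negative
  power of \<open>xj\<close>; a small \<open>\<nu>\<close> does the work of the logarithm that
  summing \<open>1 / x\<close> would create.\<close>

lemma kernel_split:
  fixes x y xj a b \<nu> :: real
  assumes "0 < xj" "xj \<le> x" "0 < y" "0 \<le> a" "0 \<le> b" "0 < \<nu>"
  shows "(a * x powr (- \<gamma>) + b * x powr (\<gamma> - 1)) * (min x y powr (- \<gamma>) * max x y powr (\<gamma> - 1))
    \<le> y powr (- \<gamma>) * (a * xj powr (- \<nu>) * x powr (\<nu> - 1) + b * x powr (2 * \<gamma> - 1 - 1))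
     + y powr (\<gamma> - 1) * ((a * xj powr (1 - 2 * \<gamma> - \<nu>) + b * xj powr (- \<nu>)) * x powr (\<nu> - 1))"
    (is "?L \<le> ?P + ?Q")
proof -
  have x: "x > 0" using assms by simp
  have i1: "x powr (-1) \<le> xj powr (- \<nu>) * x powr (\<nu> - 1)"
  proof -
    have "x powr (-1) = x powr (- \<nu>) * x powr (\<nu> - 1)" by (simp add: powr_add[symmetric])
    also have "\<dots> \<le> xj powr (- \<nu>) * x powr (\<nu> - 1)"
      using assms by (intro mult_right_mono powr_mono2') auto
    finally show ?thesis .
  qed
  have i2: "x powr (- 2 * \<gamma>) \<le> xj powr (1 - 2 * \<gamma> - \<nu>) * x powr (\<nu> - 1)"
  proof -
    have "x powr (- 2 * \<gamma>) = x powr (1 - 2 * \<gamma> - \<nu>) * x powr (\<nu> - 1)" by (simp add: powr_add[symmetric])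
    also have "\<dots> \<le> xj powr (1 - 2 * \<gamma> - \<nu>) * x powr (\<nu> - 1)"
      using assms chi by (intro mult_right_mono powr_mono2') auto
    finally show ?thesis .
  qed
  have P0: "?P \<ge> 0" and Q0: "?Q \<ge> 0" using assms by auto
  show ?thesis
  proof (cases "x \<le> y")
    case True
    have "?L = y powr (\<gamma> - 1) * (a * (x powr (- \<gamma>) * x powr (- \<gamma>)) + b * (x powr (\<gamma> - 1) * x powr (- \<gamma>)))"
      using True by (simp add: min_def max_def algebra_simps)
    also have "x powr (- \<gamma>) * x powr (- \<gamma>) = x powr (- 2 * \<gamma>)" by (simp add: powr_add[symmetric])
    also have "x powr (\<gamma> - 1) * x powr (- \<gamma>) = x powr (-1)" by (simp add: powr_add[symmetric])
    also have "y powr (\<gamma> - 1) * (a * x powr (- 2 * \<gamma>) + b * x powr (-1))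
      \<le> y powr (\<gamma> - 1) * (a * (xj powr (1 - 2 * \<gamma> - \<nu>) * x powr (\<nu> - 1)) + b * (xj powr (- \<nu>) * x powr (\<nu> - 1)))"
      using i1 i2 assms by (intro mult_left_mono add_mono) auto
    also have "\<dots> = ?Q" by (simp add: algebra_simps)
    finally show ?thesis using P0 by simp
  next
    case False
    have "?L = y powr (- \<gamma>) * (a * (x powr (- \<gamma>) * x powr (\<gamma> - 1)) + b * (x powr (\<gamma> - 1) * x powr (\<gamma> - 1)))"
      using False by (simp add: min_def max_def algebra_simps)
    also have "x powr (- \<gamma>) * x powr (\<gamma> - 1) = x powr (-1)" by (simp add: powr_add[symmetric])
    also have "x powr (\<gamma> - 1) * x powr (\<gamma> - 1) = x powr (2 * \<gamma> - 1 - 1)" by (simp add: powr_add[symmetric])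
    also have "y powr (- \<gamma>) * (a * x powr (-1) + b * x powr (2 * \<gamma> - 1 - 1))
      \<le> y powr (- \<gamma>) * (a * (xj powr (- \<nu>) * x powr (\<nu> - 1)) + b * x powr (2 * \<gamma> - 1 - 1))"
      using i1 assms by (intro mult_left_mono add_mono) auto
    also have "\<dots> = ?P" by (simp add: algebra_simps)
    finally show ?thesis using Q0 by simp
  qed
qed

text \<open>The kernel reproduces two exponents: a step to an older vertex yields
  \<open>- \<gamma>\<close>, a step to a younger one \<open>\<gamma> - 1\<close>. Path sums thus
  stay in a two-parameter family, and only the coefficients \<open>a\<close>, \<open>b\<close> need
  to be followed.\<close>

lemma path_sum_step:
  fixes a b \<nu> xj :: real
  assumes t: "t \<ge> 1" and xj: "xj > 0" and g: "g j = real t * xj" and ab: "0 \<le> a" "0 \<le> b" and \<nu>: "0 < \<nu>" "\<nu> \<le> 1"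
    and IH: "\<And>z. z \<in> {1..t} \<Longrightarrow> path_sum t g j z \<le> a * (real z / t) powr (- \<gamma>) + b * (real z / t) powr (\<gamma> - 1)"
    and w: "w \<in> {1..t}"
  shows "path_sum t g (Suc j) w \<le> K0 * (a * xj powr (- \<nu>) / \<nu> + b / (2 * \<gamma> - 1)) * (real w / t) powr (- \<gamma>)
     + K0 * ((a * xj powr (1 - 2 * \<gamma> - \<nu>) + b * xj powr (- \<nu>)) / \<nu>) * (real w / t) powr (\<gamma> - 1)"
proof -
  define Z where "Z = {z\<in>{1..t}. g j \<le> real z}"
  define y where "y = real w / t"
  define A1 where "A1 = a * xj powr (- \<nu>)"
  define A2 where "A2 = a * xj powr (1 - 2 * \<gamma> - \<nu>) + b * xj powr (- \<nu>)"
  have y: "y > 0" using w t by (simp add: y_def)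
  have Z: "Z \<subseteq> {1..t}" by (auto simp: Z_def)
  have "path_sum t g (Suc j) w = (\<Sum>z\<in>Z. path_sum t g j z * pk z w)" by (simp add: Z_def)
  also have "\<dots> \<le> (\<Sum>z\<in>Z. K0 * y powr (- \<gamma>) * A1 * (1 / real t * (real z / t) powr (\<nu> - 1))
       + K0 * y powr (- \<gamma>) * b * (1 / real t * (real z / t) powr (2 * \<gamma> - 1 - 1))
       + K0 * y powr (\<gamma> - 1) * A2 * (1 / real t * (real z / t) powr (\<nu> - 1)))"
  proof (intro sum_mono)
    fix z assume z: "z \<in> Z"
    define x where "x = real z / t"
    have z1: "z \<in> {1..t}" and gz: "real t * xj \<le> real z" using z g by (auto simp: Z_def)
    have xx: "xj \<le> x" using gz t by (simp add: x_def field_simps)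
    have pk: "pk z w = K0 / real t * (min x y powr (- \<gamma>) * max x y powr (\<gamma> - 1))"
      unfolding x_def y_def using z1 w t by (intro pk_scaled) auto
    have "path_sum t g j z * pk z w \<le> (a * x powr (- \<gamma>) + b * x powr (\<gamma> - 1)) * pk z w"
      using IH[OF z1] by (intro mult_right_mono pk_nonneg) (auto simp: x_def)
    also have "\<dots> = K0 / real t * ((a * x powr (- \<gamma>) + b * x powr (\<gamma> - 1)) * (min x y powr (- \<gamma>) * max x y powr (\<gamma> - 1)))"
      unfolding pk by simp
    also have "\<dots> \<le> K0 / real t * (y powr (- \<gamma>) * (A1 * x powr (\<nu> - 1) + b * x powr (2 * \<gamma> - 1 - 1))
        + y powr (\<gamma> - 1) * (A2 * x powr (\<nu> - 1)))"
      unfolding A1_def A2_def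
      using xx xj y ab \<nu> K0_pos by (intro mult_left_mono kernel_split) auto
    also have "\<dots> = K0 * y powr (- \<gamma>) * A1 * (1 / real t * x powr (\<nu> - 1))
       + K0 * y powr (- \<gamma>) * b * (1 / real t * x powr (2 * \<gamma> - 1 - 1))
       + K0 * y powr (\<gamma> - 1) * A2 * (1 / real t * x powr (\<nu> - 1))"
      by (simp add: algebra_simps)
    finally show "path_sum t g j z * pk z w \<le> K0 * y powr (- \<gamma>) * A1 * (1 / real t * (real z / t) powr (\<nu> - 1))
       + K0 * y powr (- \<gamma>) * b * (1 / real t * (real z / t) powr (2 * \<gamma> - 1 - 1))
       + K0 * y powr (\<gamma> - 1) * A2 * (1 / real t * (real z / t) powr (\<nu> - 1))"
      unfolding x_def .
  qed
  also have "\<dots> = K0 * y powr (- \<gamma>) * A1 * (\<Sum>z\<in>Z. 1 / real t * (real z / t) powr (\<nu> - 1))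
       + K0 * y powr (- \<gamma>) * b * (\<Sum>z\<in>Z. 1 / real t * (real z / t) powr (2 * \<gamma> - 1 - 1))
       + K0 * y powr (\<gamma> - 1) * A2 * (\<Sum>z\<in>Z. 1 / real t * (real z / t) powr (\<nu> - 1))"
    unfolding sum.distrib sum_distrib_left ..
  also have "\<dots> \<le> K0 * y powr (- \<gamma>) * A1 * (1 / \<nu>) + K0 * y powr (- \<gamma>) * b * (1 / (2 * \<gamma> - 1))
       + K0 * y powr (\<gamma> - 1) * A2 * (1 / \<nu>)"
  proof -
    have s1: "(\<Sum>z\<in>Z. 1 / real t * (real z / t) powr (\<nu> - 1)) \<le> 1 / \<nu>"
      using \<nu> t Z by (intro sum_powr_unit) auto
    have s2: "(\<Sum>z\<in>Z. 1 / real t * (real z / t) powr (2 * \<gamma> - 1 - 1)) \<le> 1 / (2 * \<gamma> - 1)"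
      using chi t Z by (intro sum_powr_unit) auto
    have "A1 \<ge> 0" "A2 \<ge> 0" using ab by (auto simp: A1_def A2_def)
    then show ?thesis using s1 s2 ab K0_pos by (intro add_mono mult_left_mono) auto
  qed
  also have "\<dots> = K0 * (A1 / \<nu> + b / (2 * \<gamma> - 1)) * y powr (- \<gamma>) + K0 * (A2 / \<nu>) * y powr (\<gamma> - 1)"
    by (simp add: algebra_simps)
  finally show ?thesis by (simp add: A1_def A2_def y_def)
qed

text \<open>With \<open>\<Lambda> = B * \<theta> ^ j\<close> the path sums are bounded by
  \<open>exp \<Lambda> * x powr - \<gamma> + exp (\<zeta> * \<Lambda>) * x powr (\<gamma> - 1)\<close> at the rescaled vertex \<open>x = w / t\<close>; the first
  term feeds the second in one step and conversely, which makes the exponents grow by \<open>1 / \<rho>\<close> every two steps.\<close>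

lemma leave_bound:
  fixes \<theta> :: real
  assumes th: "1 / \<rho> < \<theta>\<^sup>2" "1 < \<theta>" "\<theta> \<le> 1 / \<rho>"
  shows "\<exists>s>0. \<exists>\<mu>>0. \<exists>B0. \<forall>B\<ge>B0. \<forall>t\<ge>1. \<forall>j.
    (\<Sum>w\<in>{w. real w < real t * exp (- \<mu> * (B * \<theta> ^ j))} \<inter> {1..t}. path_sum t (\<lambda>i. real t * exp (- \<mu> * (B * \<theta> ^ i))) j w)
      \<le> real t * ((1 / (1 - \<gamma>) + 1 / \<gamma>) * exp (- s * (B * \<theta> ^ j)))"
proof -
  define r where "r = 1 / \<rho>"
  have r0: "r > 1" using rho by (simp add: r_def)
  have gr: "\<gamma> / (1 - \<gamma>) = r" using chi rho by (simp add: r_def)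
  \<comment> \<open>\<open>s\<close> is solved from
    \<open>(1 - s) * \<theta>\<^sup>2 - (1 + s) * r = \<eta>\<close>, where \<open>\<eta>\<close> is
    half of the slack \<open>\<theta>\<^sup>2 - r\<close>.\<close>
  define s where "s = (\<theta>\<^sup>2 - r) / (2 * (\<theta>\<^sup>2 + r))"
  define \<eta> where "\<eta> = (\<theta>\<^sup>2 - r) / 2"
  have thr: "\<theta>\<^sup>2 > r" using th by (simp add: r_def)
  have s: "s > 0" "s < 1 / 2" using thr r0 by (auto simp: s_def field_simps)
  have s_eq: "(1 - s) * \<theta>\<^sup>2 - (1 + s) * r = \<eta>"
  proof -
    have "s * (\<theta>\<^sup>2 + r) = (\<theta>\<^sup>2 - r) / 2" using thr r0 by (simp add: s_def field_simps)
    then show ?thesis by (simp add: \<eta>_def algebra_simps)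
  qed
  \<comment> \<open>At the barrier \<open>x = exp (- \<mu> * \<Lambda>)\<close> this exponent gives
    \<open>exp \<Lambda> * x powr (1 - \<gamma>) = exp (- s * \<Lambda>)\<close>: crossing the
    barrier becomes rare.\<close>
  define \<mu> where "\<mu> = (1 + s) / (1 - \<gamma>)"
  define \<zeta> where "\<zeta> = (1 - s) * \<theta>"
  have \<mu>0: "\<mu> > 0" using s chi by (simp add: \<mu>_def)
  have \<eta>0: "\<eta> > 0" using thr by (simp add: \<eta>_def)
  \<comment> \<open>Small enough for the cutoff loss \<open>\<nu> * \<mu>\<close> to fit into the
    slack of \<open>p1\<close>, \<open>p3\<close> and \<open>p4\<close>.\<close>
  define \<nu> where "\<nu> = min 1 (min \<eta> ((\<theta> - 1) / 2) / (2 * \<mu>))"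
  have \<nu>: "0 < \<nu>" "\<nu> \<le> 1" using \<mu>0 \<eta>0 th by (auto simp: \<nu>_def)
  have "\<nu> \<le> min \<eta> ((\<theta> - 1) / 2) / (2 * \<mu>)" by (simp add: \<nu>_def)
  then have "\<nu> * \<mu> \<le> min \<eta> ((\<theta> - 1) / 2) / 2" using \<mu>0 by (simp add: field_simps)
  then have nm: "\<nu> * \<mu> < \<eta>" "\<nu> * \<mu> < (\<theta> - 1) / 2" using \<eta>0 th by auto
  have lam: "1 / 2 < \<zeta>" "\<zeta> < \<theta>"
  proof -
    have "1 / 2 * 1 < (1 - s) * \<theta>" using s th by (intro mult_strict_mono) auto
    then show "1 / 2 < \<zeta>" by (simp add: \<zeta>_def)
    show "\<zeta> < \<theta>" using s th by (simp add: \<zeta>_def)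
  qed
  have p1: "1 + \<nu> * \<mu> < \<theta>" using nm th by argo
  \<comment> \<open>The critical inequality: the \<open>- \<gamma>\<close> coefficient feeds the
    other one with a loss of \<open>(2 * \<gamma> - 1) * \<mu>\<close>. Apart from
    \<open>\<nu>\<close>, the left side is \<open>(1 + s) * r - s\<close> and the right side
    \<open>(1 - s) * \<theta>\<^sup>2\<close>, so this is where
    \<open>\<theta>\<^sup>2 > 1 / \<rho>\<close> enters.\<close>
  have p3: "1 + (2 * \<gamma> - 1 + \<nu>) * \<mu> < \<zeta> * \<theta>"
  proof -
    have "(1 + s) * r = (1 + s) + (1 + s) * ((2 * \<gamma> - 1) / (1 - \<gamma>))"
      unfolding gr[symmetric] using chi by (simp add: field_simps)
    also have "(1 + s) * ((2 * \<gamma> - 1) / (1 - \<gamma>)) = (2 * \<gamma> - 1) * \<mu>" by (simp add: \<mu>_def)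
    finally have "1 + (2 * \<gamma> - 1) * \<mu> < (1 + s) * r" using s by simp
    moreover have "\<zeta> * \<theta> = (1 - s) * \<theta>\<^sup>2" by (simp add: \<zeta>_def power2_eq_square)
    ultimately show ?thesis using s_eq nm by (simp add: algebra_simps)
  qed
  have p4: "\<zeta> + \<nu> * \<mu> < \<zeta> * \<theta>"
  proof -
    have "1 / 2 * (\<theta> - 1) < \<zeta> * (\<theta> - 1)" using lam th by (intro mult_strict_right_mono) auto
    then have "\<zeta> * \<theta> - \<zeta> > (\<theta> - 1) / 2" by (simp add: algebra_simps)
    then show ?thesis using nm(2) by linarith
  qed
  obtain L1 where L1: "\<And>L. L \<ge> L1 \<Longrightarrow> (K0 / \<nu>) * exp ((1 + \<nu> * \<mu>) * L) \<le> exp (\<theta> * L) / 2"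
    using exp_dominates[OF p1] by blast
  obtain L2 where L2: "\<And>L. L \<ge> L2 \<Longrightarrow> (K0 / (2 * \<gamma> - 1)) * exp (\<zeta> * L) \<le> exp (\<theta> * L) / 2"
    using exp_dominates[OF lam(2)] by blast
  obtain L3 where L3: "\<And>L. L \<ge> L3 \<Longrightarrow> (K0 / \<nu>) * exp ((1 + (2 * \<gamma> - 1 + \<nu>) * \<mu>) * L) \<le> exp (\<zeta> * \<theta> * L) / 2"
    using exp_dominates[OF p3] by blast
  obtain L4 where L4: "\<And>L. L \<ge> L4 \<Longrightarrow> (K0 / \<nu>) * exp ((\<zeta> + \<nu> * \<mu>) * L) \<le> exp (\<zeta> * \<theta> * L) / 2"
    using exp_dominates[OF p4] by blast
  \<comment> \<open>The constants of the recursion are absorbed once \<open>\<Lambda>\<close> is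
    large; as \<open>\<theta> > 1\<close>, a large \<open>B\<close> achieves this for all
    \<open>j\<close> at once.\<close>
  define B0 where "B0 = Max {0, L1, L2, L3, L4}"
  have B0: "B0 \<ge> 0" "B0 \<ge> L1" "B0 \<ge> L2" "B0 \<ge> L3" "B0 \<ge> L4" by (auto simp: B0_def)
  have main: "(\<Sum>w\<in>{w. real w < real t * exp (- \<mu> * (B * \<theta> ^ j))} \<inter> {1..t}. path_sum t (\<lambda>i. real t * exp (- \<mu> * (B * \<theta> ^ i))) j w)
      \<le> real t * ((1 / (1 - \<gamma>) + 1 / \<gamma>) * exp (- s * (B * \<theta> ^ j)))"
    if B: "B \<ge> B0" and t: "t \<ge> 1" for B t j
  proof -
    define g where "g i = real t * exp (- \<mu> * (B * \<theta> ^ i))" for i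
    have LB: "B * \<theta> ^ i \<ge> B0" for i
    proof -
      have "B * 1 \<le> B * \<theta> ^ i" using B B0 th by (intro mult_left_mono one_le_power) auto
      then show ?thesis using B by simp
    qed
    have Fb: "path_sum t g i w \<le> exp (B * \<theta> ^ i) * (real w / t) powr (- \<gamma>) + exp (\<zeta> * (B * \<theta> ^ i)) * (real w / t) powr (\<gamma> - 1)"
      if "w \<in> {1..t}" for i w
      using that
    proof (induction i arbitrary: w)
      case 0
      have "real w / t \<le> 1" "real w / t > 0" using 0 by (auto simp: field_simps)
      then have "(real w / t) powr (- \<gamma>) \<ge> (real w / t) powr 0"
        using chi by (intro powr_mono') auto
      then have "1 \<le> (real w / t) powr (- \<gamma>)" using \<open>real w / t > 0\<close> by (metis less_irrefl powr_zero_eq_one)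
      moreover have "exp (B * \<theta> ^ 0) \<ge> 1" using LB[of 0] B0 by simp
      ultimately have "1 * 1 \<le> exp (B * \<theta> ^ 0) * (real w / t) powr (- \<gamma>)" by (intro mult_mono) auto
      then show ?case by (simp add: add_increasing2)
    next
      case (Suc i)
      define \<Lambda> where "\<Lambda> = B * \<theta> ^ i"
      define x where "x = exp (- \<mu> * \<Lambda>)"
      have \<Lambda>: "\<Lambda> \<ge> B0" using LB by (simp add: \<Lambda>_def)
      have xp: "x powr c = exp (- \<mu> * \<Lambda> * c)" for c by (simp add: x_def powr_def mult.commute)
      have x0: "x > 0" by (simp add: x_def)
      have gi: "g i = real t * x" by (simp add: g_def x_def \<Lambda>_def)
      have IH: "path_sum t g i z \<le> exp \<Lambda> * (real z / t) powr (- \<gamma>) + exp (\<zeta> * \<Lambda>) * (real z / t) powr (\<gamma> - 1)"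
        if "z \<in> {1..t}" for z using Suc.IH[OF that] by (simp add: \<Lambda>_def)
      have "path_sum t g (Suc i) w \<le> K0 * (exp \<Lambda> * x powr (- \<nu>) / \<nu> + exp (\<zeta> * \<Lambda>) / (2 * \<gamma> - 1)) * (real w / t) powr (- \<gamma>)
        + K0 * ((exp \<Lambda> * x powr (1 - 2 * \<gamma> - \<nu>) + exp (\<zeta> * \<Lambda>) * x powr (- \<nu>)) / \<nu>) * (real w / t) powr (\<gamma> - 1)"
        by (rule path_sum_step[OF t x0 gi _ _ \<nu> IH Suc.prems]) auto
      also have "\<dots> \<le> exp (\<theta> * \<Lambda>) * (real w / t) powr (- \<gamma>) + exp (\<zeta> * \<theta> * \<Lambda>) * (real w / t) powr (\<gamma> - 1)"
      proof (intro add_mono mult_right_mono)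
        have "K0 * (exp \<Lambda> * x powr (- \<nu>) / \<nu> + exp (\<zeta> * \<Lambda>) / (2 * \<gamma> - 1))
          = (K0 / \<nu>) * exp ((1 + \<nu> * \<mu>) * \<Lambda>) + (K0 / (2 * \<gamma> - 1)) * exp (\<zeta> * \<Lambda>)"
          unfolding xp by (simp add: algebra_simps exp_add add_divide_distrib)
        also have "\<dots> \<le> exp (\<theta> * \<Lambda>) / 2 + exp (\<theta> * \<Lambda>) / 2"
          using \<Lambda> B0 by (intro add_mono L1 L2) auto
        finally show "K0 * (exp \<Lambda> * x powr (- \<nu>) / \<nu> + exp (\<zeta> * \<Lambda>) / (2 * \<gamma> - 1)) \<le> exp (\<theta> * \<Lambda>)" by simp
        have e1: "exp \<Lambda> * x powr (1 - 2 * \<gamma> - \<nu>) = exp ((1 + (2 * \<gamma> - 1 + \<nu>) * \<mu>) * \<Lambda>)"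
          unfolding xp exp_add[symmetric] by (rule arg_cong[where f = exp]) (simp add: algebra_simps)
        have e2: "exp (\<zeta> * \<Lambda>) * x powr (- \<nu>) = exp ((\<zeta> + \<nu> * \<mu>) * \<Lambda>)"
          unfolding xp exp_add[symmetric] by (rule arg_cong[where f = exp]) (simp add: algebra_simps)
        have "K0 * ((exp \<Lambda> * x powr (1 - 2 * \<gamma> - \<nu>) + exp (\<zeta> * \<Lambda>) * x powr (- \<nu>)) / \<nu>)
          = (K0 / \<nu>) * exp ((1 + (2 * \<gamma> - 1 + \<nu>) * \<mu>) * \<Lambda>) + (K0 / \<nu>) * exp ((\<zeta> + \<nu> * \<mu>) * \<Lambda>)"
          unfolding e1 e2 by (simp add: add_divide_distrib distrib_left)
        also have "\<dots> \<le> exp (\<zeta> * \<theta> * \<Lambda>) / 2 + exp (\<zeta> * \<theta> * \<Lambda>) / 2"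
          using \<Lambda> B0 by (intro add_mono L3 L4) auto
        finally show "K0 * ((exp \<Lambda> * x powr (1 - 2 * \<gamma> - \<nu>) + exp (\<zeta> * \<Lambda>) * x powr (- \<nu>)) / \<nu>) \<le> exp (\<zeta> * \<theta> * \<Lambda>)" by simp
      qed auto
      finally show ?case by (simp add: \<Lambda>_def mult_ac)
    qed
    define \<Lambda> where "\<Lambda> = B * \<theta> ^ j"
    define x where "x = exp (- \<mu> * \<Lambda>)"
    have \<Lambda>: "\<Lambda> \<ge> 0" using LB[of j] B0 by (simp add: \<Lambda>_def)
    have xp: "x powr c = exp (- \<mu> * \<Lambda> * c)" for c by (simp add: x_def powr_def mult.commute)
    define Z where "Z = {w. real w < real t * x} \<inter> {1..t}"
    define Z' where "Z' = {z\<in>{1..t}. real z \<le> real t * x}"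
    have ZZ: "Z \<subseteq> Z'" "finite Z'" by (auto simp: Z_def Z'_def)
    have "(\<Sum>w\<in>Z. path_sum t g j w) \<le> (\<Sum>w\<in>Z. exp \<Lambda> * (real w / t) powr (- \<gamma>) + exp (\<zeta> * \<Lambda>) * (real w / t) powr (\<gamma> - 1))"
      unfolding \<Lambda>_def by (intro sum_mono Fb) (auto simp: Z_def)
    also have "\<dots> \<le> (\<Sum>w\<in>Z'. exp \<Lambda> * (real w / t) powr (- \<gamma>) + exp (\<zeta> * \<Lambda>) * (real w / t) powr (\<gamma> - 1))"
      using ZZ by (intro sum_mono2) auto
    also have "\<dots> = real t * (exp \<Lambda> * (\<Sum>w\<in>Z'. 1 / real t * (real w / t) powr ((1 - \<gamma>) - 1))
        + exp (\<zeta> * \<Lambda>) * (\<Sum>w\<in>Z'. 1 / real t * (real w / t) powr (\<gamma> - 1)))"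
      using t by (simp add: sum_distrib_left sum.distrib algebra_simps)
    also have "\<dots> \<le> real t * (exp \<Lambda> * (x powr (1 - \<gamma>) / (1 - \<gamma>)) + exp (\<zeta> * \<Lambda>) * (x powr \<gamma> / \<gamma>))"
      unfolding Z'_def using chi t
      by (intro mult_left_mono add_mono sum_powr_scaled) (auto simp: x_def)
    also have "\<dots> \<le> real t * (exp (- s * \<Lambda>) / (1 - \<gamma>) + exp (- s * \<Lambda>) / \<gamma>)"
    proof (intro mult_left_mono add_mono)
      have "exp \<Lambda> * x powr (1 - \<gamma>) = exp (\<Lambda> - \<mu> * (1 - \<gamma>) * \<Lambda>)"
        unfolding xp exp_add[symmetric] by (rule arg_cong[where f = exp]) (simp add: algebra_simps)
      also have "\<mu> * (1 - \<gamma>) = 1 + s" using chi(2) by (simp add: \<mu>_def)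
      finally have "exp \<Lambda> * x powr (1 - \<gamma>) = exp (- s * \<Lambda>)" by (simp add: algebra_simps)
      then show "exp \<Lambda> * (x powr (1 - \<gamma>) / (1 - \<gamma>)) \<le> exp (- s * \<Lambda>) / (1 - \<gamma>)" by simp
      have "exp (\<zeta> * \<Lambda>) * x powr \<gamma> = exp ((\<zeta> - \<mu> * \<gamma>) * \<Lambda>)"
        unfolding xp exp_add[symmetric] by (rule arg_cong[where f = exp]) (simp add: algebra_simps)
      also have "\<dots> \<le> exp (- s * \<Lambda>)"
      proof -
        have "\<mu> * \<gamma> = (1 + s) * r" unfolding gr[symmetric] by (simp add: \<mu>_def)
        moreover have "\<zeta> \<le> r" using lam th by (simp add: r_def)
        moreover have "s * r \<ge> s * 1" using s r0 by (intro mult_left_mono) auto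
        ultimately have "\<zeta> - \<mu> * \<gamma> \<le> - s" by (simp add: algebra_simps)
        then have "(\<zeta> - \<mu> * \<gamma>) * \<Lambda> \<le> - s * \<Lambda>" using \<Lambda> by (intro mult_right_mono) auto
        then show ?thesis by simp
      qed
      finally show "exp (\<zeta> * \<Lambda>) * (x powr \<gamma> / \<gamma>) \<le> exp (- s * \<Lambda>) / \<gamma>"
        using chi by (simp add: divide_right_mono)
    qed auto
    also have "\<dots> = real t * ((1 / (1 - \<gamma>) + 1 / \<gamma>) * exp (- s * \<Lambda>))" by (simp add: algebra_simps)
    finally show ?thesis by (simp add: Z_def g_def[abs_def] x_def \<Lambda>_def)
  qed
  show ?thesis
    by (rule exI[of _ s], rule conjI[OF s(1)], rule exI[of _ \<mu>], rule conjI[OF \<mu>0], rule exI[of _ B0])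
       (use main in blast)
qed

end

section \<open>From short distances to self-avoiding paths\<close>

lemma walk_shortcut:
  assumes f: "f 0 = u" "f n = v" "\<forall>i<n. adj (f i) (f (Suc i))" and ij: "i < j" "j \<le> n" "f i = f j"
  shows "walk_of_len adj u v (n - (j - i))"
proof -
  define d where "d = j - i"
  define g where "g k = (if k \<le> i then f k else f (k + d))" for k
  have d: "d > 0" "i + d = j" "d \<le> n" using ij by (auto simp: d_def)
  have "g 0 = u" using f by (simp add: g_def)
  moreover have "g (n - d) = v"
  proof (cases "n - d \<le> i")
    case True
    then have "n = j" using d ij by linarith
    then show ?thesis using f ij d by (auto simp: g_def)
  next
    case False
    then show ?thesis using f d by (simp add: g_def)
  qed
  moreover have "adj (g k) (g (Suc k))" if k: "k < n - d" for k
  proof -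
    consider "Suc k \<le> i" | "k = i" | "k > i" by linarith
    then show ?thesis
    proof cases
      case 1
      then show ?thesis using f k by (simp add: g_def)
    next
      case 2
      have "adj (f j) (f (Suc j))" using f k 2 d by simp
      moreover have "g k = f j" using 2 ij by (simp add: g_def)
      moreover have "g (Suc k) = f (Suc j)" using 2 d by (simp add: g_def)
      ultimately show ?thesis by simp
    next
      case 3
      have "adj (f (k + d)) (f (Suc (k + d)))" using f k by simp
      then show ?thesis using 3 by (simp add: g_def)
    qed
  qed
  ultimately show ?thesis unfolding walk_of_len_def d_def by blast
qed

text \<open>A shortest walk repeats no vertex, since a loop could be cut out. Distinctness is what
  \<open>path_prob\<close> requires.\<close>

lemma graph_dist_path:
  assumes "graph_dist adj u v = enat n"
  shows "\<exists>vs. length vs = Suc n \<and> distinct vs \<and> vs ! 0 = u \<and> vs ! n = v \<and> (\<forall>i<n. adj (vs ! i) (vs ! Suc i))"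
proof -
  have ex: "\<exists>n. walk_of_len adj u v n" and n: "n = (LEAST n. walk_of_len adj u v n)"
    using assms by (auto simp: graph_dist_def split: if_splits)
  have "walk_of_len adj u v n" unfolding n using ex by (metis LeastI)
  then obtain f where f: "f 0 = u" "f n = v" "\<forall>i<n. adj (f i) (f (Suc i))" by (auto simp: walk_of_len_def)
  have least: "n \<le> k" if "walk_of_len adj u v k" for k unfolding n using that by (rule Least_le)
  define vs where "vs = map f [0..<Suc n]"
  have nth: "vs ! i = f i" if "i \<le> n" for i
    using that nth_map_upt[of i "Suc n" 0 f] unfolding vs_def by simp
  have "f i \<noteq> f j" if "i < j" "j \<le> n" for i j
  proof
    assume "f i = f j"
    then have "n \<le> n - (j - i)" using walk_shortcut[OF f that] least by blast
    then show False using that by linarith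
  qed
  then have "inj_on f {0..<Suc n}"
    by (intro inj_onI) (metis atLeastLessThan_iff less_Suc_eq_le linorder_neqE_nat)
  then have "distinct vs" unfolding vs_def distinct_map using distinct_upt by (metis set_upt)
  then show ?thesis using f nth by (intro exI[of _ vs]) (auto simp: vs_def)
qed

context pref_att
begin

definition leave :: "nat \<Rightarrow> (nat \<Rightarrow> real) \<Rightarrow> nat \<Rightarrow> nat list \<Rightarrow> nat \<Rightarrow> bool" where
  "leave t g K xs u \<longleftrightarrow> (\<exists>j\<le>K. \<exists>vs\<in>plists t g j {w. real w < g j}. distinct vs \<and> is_path xs vs \<and> vs ! 0 = u)"

definition mid :: "nat \<Rightarrow> real \<Rightarrow> nat \<Rightarrow> nat list \<Rightarrow> nat \<Rightarrow> nat \<Rightarrow> bool" where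
  "mid t G K xs u v \<longleftrightarrow> (\<exists>n\<le>2 * K. \<exists>vs\<in>plists t (\<lambda>_. G) n {w. G \<le> real w}.
     distinct vs \<and> is_path xs vs \<and> vs ! 0 = u \<and> vs ! n = v)"

text \<open>Cutting the path at its first vertex below the barrier gives a list in
  \<open>plists\<close>.\<close>

lemma leaveI:
  assumes "length vs = Suc n" "distinct vs" "is_path xs vs" "set vs \<subseteq> {1..t}" "i \<le> n" "i \<le> K" "real (vs ! i) < g i"
  shows "leave t g K xs (vs ! 0)"
proof -
  define j where "j = (LEAST i. i \<le> n \<and> i \<le> K \<and> real (vs ! i) < g i)"
  have j: "j \<le> n" "j \<le> K" "real (vs ! j) < g j"
    using LeastI[of "\<lambda>i. i \<le> n \<and> i \<le> K \<and> real (vs ! i) < g i" i] assms by (auto simp: j_def)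
  have less: "g k \<le> real (vs ! k)" if "k < j" for k
    using not_less_Least[of k "\<lambda>i. i \<le> n \<and> i \<le> K \<and> real (vs ! i) < g i"] that j by (fastforce simp: j_def)
  define us where "us = take (Suc j) vs"
  have l: "length us = Suc j" using assms j by (simp add: us_def)
  have "set us \<subseteq> {1..t}" using assms(4) unfolding us_def by (meson order_trans set_take_subset)
  then have "us \<in> plists t g j {w. real w < g j}"
    using l less j by (auto simp: plists_def us_def)
  moreover have "distinct us" using assms by (simp add: us_def)
  moreover have "is_path xs us" using assms(3,1) j by (auto simp: is_path_def us_def)
  moreover have "us ! 0 = vs ! 0" by (simp add: us_def)
  ultimately show ?thesis using j unfolding leave_def by blast
qed

lemma pa_adj_sym: "pa_adj m xs a b \<longleftrightarrow> pa_adj m xs b a"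
  unfolding pa_adj_def by blast

lemma pa_adj_range:
  assumes "valid (m * t) xs" "pa_adj m xs a b"
  shows "a \<in> {1..t}" "b \<in> {1..t}"
proof -
  obtain k where k: "k < m * t" "(src k = a \<and> xs ! k = b) \<or> (src k = b \<and> xs ! k = a)"
    using assms by (auto simp: pa_adj_def pa_valid_def)
  have "xs ! k \<in> {1..src k}" using assms(1) k(1) by (auto simp: pa_valid_def)
  moreover have "src k \<le> t" using k(1) by (simp add: pa_src_def Suc_le_eq less_mult_imp_div_less mult.commute)
  moreover have "src k \<ge> 1" by (simp add: pa_src_def)
  ultimately show "a \<in> {1..t}" "b \<in> {1..t}" using k(2) by auto
qed

text \<open>Each vertex of a path of length at most \<open>2 * K\<close> is within \<open>K\<close>
  steps of one end. Reading the path from both ends, either the decreasing barrier is crossed from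
  one of them, or all vertices stay above its lowest value \<open>g K\<close>.\<close>

lemma near_cases:
  assumes va: "valid (m * t) xs" and u: "u \<in> {1..t}" and d: "graph_dist (pa_adj m xs) u v = enat n" and n: "n \<le> 2 * K"
    and anti: "\<And>i j. i \<le> j \<Longrightarrow> g j \<le> g i"
  shows "leave t g K xs u \<or> leave t g K xs v \<or> mid t (g K) K xs u v"
proof -
  obtain vs where vs: "length vs = Suc n" "distinct vs" "vs ! 0 = u" "vs ! n = v"
    "\<And>i. i < n \<Longrightarrow> pa_adj m xs (vs ! i) (vs ! Suc i)"
    using graph_dist_path[OF d] by blast
  have path: "is_path xs vs" using vs by (simp add: is_path_def)
  have "vs ! i \<in> {1..t}" if "i \<le> n" for i
  proof (cases i)
    case 0
    then show ?thesis using vs u by simp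
  next
    case (Suc k)
    then show ?thesis using pa_adj_range(2)[OF va vs(5)[of k]] that by simp
  qed
  then have set: "set vs \<subseteq> {1..t}" using vs(1) by (metis in_set_conv_nth less_Suc_eq_le subsetI)
  show ?thesis
  proof (cases "\<exists>i\<le>n. i \<le> K \<and> real (vs ! i) < g i")
    case True
    then obtain i where "i \<le> n" "i \<le> K" "real (vs ! i) < g i" by blast
    then have "leave t g K xs (vs ! 0)" using vs path set by (intro leaveI[of vs n])
    then show ?thesis using vs by simp
  next
    case F1: False
    show ?thesis
    proof (cases "\<exists>i\<le>n. i \<le> K \<and> real (vs ! (n - i)) < g i")
      case True
      then obtain i where i: "i \<le> n" "i \<le> K" "real (vs ! (n - i)) < g i" by blast
      have rn: "rev vs ! k = vs ! (n - k)" if "k \<le> n" for k using that vs(1) by (simp add: rev_nth)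
      have "is_path xs (rev vs)"
        unfolding is_path_def
      proof (intro allI impI)
        fix k assume "Suc k < length (rev vs)"
        then have k: "k < n" using vs by simp
        then have "n - k = Suc (n - Suc k)" by simp
        then have "pa_adj m xs (vs ! (n - Suc k)) (vs ! (n - k))" using vs(5)[of "n - Suc k"] k by simp
        then show "pa_adj m xs (rev vs ! k) (rev vs ! Suc k)" using rn[of k] rn[of "Suc k"] k pa_adj_sym by simp
      qed
      then have "leave t g K xs (rev vs ! 0)"
        using vs set i rn[of i] by (intro leaveI[of "rev vs" n _ _ i]) auto
      then show ?thesis using vs rn[of 0] by simp
    next
      case F2: False
      have "g K \<le> real (vs ! i)" if "i \<le> n" for i
      proof (cases "i \<le> K")
        case True
        then show ?thesis using F1 that anti[of i K] by (meson not_less order_trans)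
      next
        case False
        then have "n - i \<le> K" "n - (n - i) = i" using n that by auto
        then have "\<not> real (vs ! i) < g (n - i)" using F2 by (metis diff_le_self)
        then show ?thesis using anti[OF \<open>n - i \<le> K\<close>] by linarith
      qed
      then have "vs \<in> plists t (\<lambda>_. g K) n {w. g K \<le> real w}" using vs(1) set by (simp add: plists_def)
      then have "mid t (g K) K xs u v" unfolding mid_def using vs path n by blast
      then show ?thesis by simp
    qed
  qed
qed

lemma E_leave:
  "E (m * t) (\<lambda>xs. \<Sum>u\<in>{1..t}. of_bool (leave t g K xs u)) \<le> (\<Sum>j\<le>K. \<Sum>w\<in>{w. real w < g j} \<inter> {1..t}. path_sum t g j w)"
proof -
  define P where "P j = {vs\<in>plists t g j {w. real w < g j}. distinct vs}" for j
  have fP: "finite (P j)" for j using finite_plists by (simp add: P_def)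
  have "(\<Sum>u\<in>{1..t}. of_bool (leave t g K xs u)) \<le> (\<Sum>j\<le>K. \<Sum>vs\<in>P j. of_bool (is_path xs vs) :: real)" for xs
  proof -
    have "(\<Sum>u\<in>{1..t}. of_bool (leave t g K xs u)) \<le> (\<Sum>u\<in>{1..t}. \<Sum>j\<le>K. \<Sum>vs\<in>P j. of_bool (is_path xs vs \<and> vs ! 0 = u) :: real)"
    proof (intro sum_mono)
      fix u
      show "of_bool (leave t g K xs u) \<le> (\<Sum>j\<le>K. \<Sum>vs\<in>P j. of_bool (is_path xs vs \<and> vs ! 0 = u) :: real)"
      proof (cases "leave t g K xs u")
        case True
        then obtain j vs where jv: "j \<le> K" "vs \<in> P j" "is_path xs vs \<and> vs ! 0 = u"
          unfolding leave_def P_def by blast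
        have "1 \<le> (\<Sum>vs\<in>P j. of_bool (is_path xs vs \<and> vs ! 0 = u) :: real)"
          using member_le_sum[of vs "P j" "\<lambda>vs. of_bool (is_path xs vs \<and> vs ! 0 = u) :: real"] jv fP by auto
        also have "\<dots> \<le> (\<Sum>j\<le>K. \<Sum>vs\<in>P j. of_bool (is_path xs vs \<and> vs ! 0 = u) :: real)"
          using jv by (intro member_le_sum) (auto intro!: sum_nonneg)
        finally show ?thesis by (auto intro: order_trans[rotated])
      qed (auto intro!: sum_nonneg)
    qed
    also have "\<dots> = (\<Sum>j\<le>K. \<Sum>vs\<in>P j. \<Sum>u\<in>{1..t}. of_bool (is_path xs vs \<and> vs ! 0 = u) :: real)"
      by (subst sum.swap) (intro sum.cong refl, rule sum.swap)
    also have "\<dots> \<le> (\<Sum>j\<le>K. \<Sum>vs\<in>P j. of_bool (is_path xs vs) :: real)"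
    proof (intro sum_mono)
      fix j vs
      have "(\<Sum>u\<in>{1..t}. of_bool (is_path xs vs \<and> vs ! 0 = u) :: real) = (\<Sum>u\<in>{1..t}. if u = vs ! 0 then of_bool (is_path xs vs) else 0)"
        by (intro sum.cong) auto
      also have "\<dots> \<le> of_bool (is_path xs vs)" by (subst sum.delta) auto
      finally show "(\<Sum>u\<in>{1..t}. of_bool (is_path xs vs \<and> vs ! 0 = u) :: real) \<le> of_bool (is_path xs vs)" .
    qed
    finally show ?thesis .
  qed
  then have "E (m * t) (\<lambda>xs. \<Sum>u\<in>{1..t}. of_bool (leave t g K xs u)) \<le> E (m * t) (\<lambda>xs. \<Sum>j\<le>K. \<Sum>vs\<in>P j. of_bool (is_path xs vs))"
    by (intro E_mono)
  also have "\<dots> = (\<Sum>j\<le>K. E (m * t) (\<lambda>xs. \<Sum>vs\<in>P j. of_bool (is_path xs vs)))" by (rule E_sum)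
  also have "\<dots> \<le> (\<Sum>j\<le>K. \<Sum>w\<in>{w. real w < g j} \<inter> {1..t}. path_sum t g j w)"
    unfolding P_def by (intro sum_mono E_paths)
  finally show ?thesis .
qed

lemma E_mid:
  "E (m * t) (\<lambda>xs. \<Sum>u\<in>{1..t}. \<Sum>v\<in>{1..t}. of_bool (mid t G K xs u v))
     \<le> (\<Sum>n\<le>2 * K. \<Sum>w\<in>{w. G \<le> real w} \<inter> {1..t}. path_sum t (\<lambda>_. G) n w)"
proof -
  define P where "P n = {vs\<in>plists t (\<lambda>_. G) n {w. G \<le> real w}. distinct vs}" for n
  have fP: "finite (P j)" for j using finite_plists by (simp add: P_def)
  have "(\<Sum>u\<in>{1..t}. \<Sum>v\<in>{1..t}. of_bool (mid t G K xs u v)) \<le> (\<Sum>n\<le>2 * K. \<Sum>vs\<in>P n. of_bool (is_path xs vs) :: real)" for xs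
  proof -
    define I where "I n vs u v = (of_bool (is_path xs vs \<and> vs ! 0 = u \<and> vs ! n = v) :: real)" for n vs u v
    have "(\<Sum>u\<in>{1..t}. \<Sum>v\<in>{1..t}. of_bool (mid t G K xs u v)) \<le> (\<Sum>u\<in>{1..t}. \<Sum>v\<in>{1..t}. \<Sum>n\<le>2*K. \<Sum>vs\<in>P n. I n vs u v)"
    proof (intro sum_mono)
      fix u v
      show "of_bool (mid t G K xs u v) \<le> (\<Sum>n\<le>2*K. \<Sum>vs\<in>P n. I n vs u v)"
      proof (cases "mid t G K xs u v")
        case True
        then obtain n vs where jv: "n \<le> 2 * K" "vs \<in> P n" "is_path xs vs \<and> vs ! 0 = u \<and> vs ! n = v"
          unfolding mid_def P_def by blast
        have "1 \<le> (\<Sum>vs\<in>P n. I n vs u v)"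
          using member_le_sum[of vs "P n" "\<lambda>vs. I n vs u v"] jv fP by (auto simp: I_def)
        also have "\<dots> \<le> (\<Sum>n\<le>2*K. \<Sum>vs\<in>P n. I n vs u v)"
          using jv by (intro member_le_sum) (auto intro!: sum_nonneg simp: I_def)
        finally show ?thesis by (auto intro: order_trans[rotated])
      qed (auto intro!: sum_nonneg simp: I_def)
    qed
    also have "\<dots> = (\<Sum>(u, v)\<in>{1..t} \<times> {1..t}. \<Sum>n\<le>2*K. \<Sum>vs\<in>P n. I n vs u v)"
      by (rule sum.cartesian_product)
    also have "\<dots> = (\<Sum>n\<le>2*K. \<Sum>vs\<in>P n. \<Sum>(u, v)\<in>{1..t} \<times> {1..t}. I n vs u v)"
      unfolding case_prod_beta by (subst sum.swap) (intro sum.cong refl, rule sum.swap)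
    also have "\<dots> \<le> (\<Sum>n\<le>2*K. \<Sum>vs\<in>P n. of_bool (is_path xs vs) :: real)"
    proof (intro sum_mono)
      fix n vs
      have "(\<Sum>(u, v)\<in>{1..t} \<times> {1..t}. I n vs u v) = (\<Sum>p\<in>{1..t} \<times> {1..t}. if p = (vs ! 0, vs ! n) then of_bool (is_path xs vs) else 0)"
        by (intro sum.cong) (auto simp: I_def)
      also have "\<dots> \<le> of_bool (is_path xs vs)" by (subst sum.delta) auto
      finally show "(\<Sum>(u, v)\<in>{1..t} \<times> {1..t}. I n vs u v) \<le> of_bool (is_path xs vs)" .
    qed
    finally show ?thesis .
  qed
  then have "E (m * t) (\<lambda>xs. \<Sum>u\<in>{1..t}. \<Sum>v\<in>{1..t}. of_bool (mid t G K xs u v)) \<le> E (m * t) (\<lambda>xs. \<Sum>n\<le>2*K. \<Sum>vs\<in>P n. of_bool (is_path xs vs))"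
    by (intro E_mono)
  also have "\<dots> = (\<Sum>n\<le>2*K. E (m * t) (\<lambda>xs. \<Sum>vs\<in>P n. of_bool (is_path xs vs)))" by (rule E_sum)
  also have "\<dots> \<le> (\<Sum>n\<le>2*K. \<Sum>w\<in>{w. G \<le> real w} \<inter> {1..t}. path_sum t (\<lambda>_. G) n w)"
    unfolding P_def by (intro sum_mono E_paths)
  finally show ?thesis .
qed

text \<open>The two exponents of \<open>pk\<close> add up to -1, so above \<open>G\<close> every
  edge costs at most \<open>K0 / G\<close>; with at most \<open>t\<close> choices of the next vertex
  this is \<open>K0 / x\<close> per step.\<close>

lemma path_sum_const_le:
  assumes G: "G = real t * x" "x > 0" and t: "t \<ge> 1" and w: "w \<in> {w. G \<le> real w} \<inter> {1..t}"
  shows "path_sum t (\<lambda>_. G) n w \<le> (K0 / x) ^ n"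
  using w
proof (induction n arbitrary: w)
  case (Suc n)
  define Z where "Z = {z\<in>{1..t}. G \<le> real z}"
  have "path_sum t (\<lambda>_. G) (Suc n) w = (\<Sum>z\<in>Z. path_sum t (\<lambda>_. G) n z * pk z w)" by (simp add: Z_def)
  also have "\<dots> \<le> (\<Sum>z\<in>Z. (K0 / x) ^ n * (K0 / (real t * x)))"
  proof (intro sum_mono mult_mono Suc.IH pk_nonneg)
    fix z assume z: "z \<in> Z"
    then show "z \<in> {w. G \<le> real w} \<inter> {1..t}" by (auto simp: Z_def)
    have mz: "real (min z w) \<ge> real t * x" using z Suc.prems G by (auto simp: Z_def min_def)
    have p: "real t * x > 0" using t G by simp
    have mp: "real (min z w) > 0" using mz p by linarith
    have "real (max z w) powr (\<gamma> - 1) \<le> real (min z w) powr (\<gamma> - 1)"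
      using mp chi by (intro powr_mono2') auto
    then have "pk z w \<le> K0 * real (min z w) powr (- \<gamma>) * real (min z w) powr (\<gamma> - 1)"
      unfolding pk_def using K0_pos by (intro mult_left_mono) auto
    also have "\<dots> = K0 * (real (min z w) powr (- \<gamma>) * real (min z w) powr (\<gamma> - 1))" by simp
    also have "real (min z w) powr (- \<gamma>) * real (min z w) powr (\<gamma> - 1) = 1 / real (min z w)"
      using mp by (simp add: powr_add[symmetric])
    also have "K0 * (1 / real (min z w)) \<le> K0 * (1 / (real t * x))"
      using mz p mp K0_pos t G by (intro mult_left_mono divide_left_mono mult_pos_pos) auto
    finally show "pk z w \<le> K0 / (real t * x)" by simp
  qed (use K0_pos G in auto)
  also have "\<dots> = real (card Z) * ((K0 / x) ^ n * (K0 / (real t * x)))" by simp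
  also have "\<dots> \<le> real t * ((K0 / x) ^ n * (K0 / (real t * x)))"
  proof (intro mult_right_mono)
    have "card Z \<le> card {1..t}" by (intro card_mono) (auto simp: Z_def)
    then show "real (card Z) \<le> real t" by simp
  qed (use K0_pos G in auto)
  also have "\<dots> = (K0 / x) ^ Suc n" using t by simp
  finally show ?case .
qed simp

text \<open>Union bound over \<open>near_cases\<close>. Crossings contribute order
  \<open>t ^ 2\<close> with a constant that can be made small; paths above the barrier contribute
  only \<open>t\<close> times a factor that \<open>mid_term_limit\<close> shows to be negligible
  against \<open>t\<close>.\<close>

lemma near_bound:
  assumes t: "t \<ge> 1" and g: "g K = real t * x" "0 < x" "x \<le> 1" and anti: "\<And>i j. i \<le> j \<Longrightarrow> g j \<le> g i"
    and lv: "\<And>j. (\<Sum>w\<in>{w. real w < g j} \<inter> {1..t}. path_sum t g j w) \<le> real t * e j"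
  shows "E (m * t) (\<lambda>xs. \<Sum>u\<in>{1..t}. \<Sum>v\<in>{1..t}. of_bool (\<exists>n\<le>2 * K. graph_dist (pa_adj m xs) u v = enat n))
    \<le> 2 * (real t)\<^sup>2 * (\<Sum>j\<le>K. e j) + real t * (real (2 * K + 1) * (K0 / x) ^ (2 * K))"
proof -
  have "E (m * t) (\<lambda>xs. \<Sum>u\<in>{1..t}. \<Sum>v\<in>{1..t}. of_bool (\<exists>n\<le>2 * K. graph_dist (pa_adj m xs) u v = enat n))
    \<le> E (m * t) (\<lambda>xs. \<Sum>u\<in>{1..t}. \<Sum>v\<in>{1..t}. of_bool (leave t g K xs u) + of_bool (leave t g K xs v) + of_bool (mid t (g K) K xs u v))"
  proof (intro E_mono sum_mono)
    fix xs u v assume va: "valid (m * t) xs" and u: "u \<in> {1..t}"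
    show "of_bool (\<exists>n\<le>2 * K. graph_dist (pa_adj m xs) u v = enat n) \<le> (of_bool (leave t g K xs u) + of_bool (leave t g K xs v) + of_bool (mid t (g K) K xs u v) :: real)"
      using near_cases[where g = g and K = K, OF va u _ _ anti] by (auto simp: of_bool_def)
  qed
  also have "\<dots> = E (m * t) (\<lambda>xs. (2 * real t) * (\<Sum>u\<in>{1..t}. of_bool (leave t g K xs u)) + (\<Sum>u\<in>{1..t}. \<Sum>v\<in>{1..t}. of_bool (mid t (g K) K xs u v)))"
  proof (intro E_cong)
    fix xs
    have "(\<Sum>u\<in>{1..t}. \<Sum>v\<in>{1..t}. of_bool (leave t g K xs u) :: real) = real t * (\<Sum>u\<in>{1..t}. of_bool (leave t g K xs u))"
      unfolding sum_constant by (simp add: sum_distrib_left)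
    moreover have "(\<Sum>u\<in>{1..t}. \<Sum>v\<in>{1..t}. of_bool (leave t g K xs v) :: real) = real t * (\<Sum>u\<in>{1..t}. of_bool (leave t g K xs u))"
      unfolding sum_constant by simp
    ultimately show "(\<Sum>u\<in>{1..t}. \<Sum>v\<in>{1..t}. of_bool (leave t g K xs u) + of_bool (leave t g K xs v) + of_bool (mid t (g K) K xs u v))
       = (2 * real t) * (\<Sum>u\<in>{1..t}. of_bool (leave t g K xs u)) + (\<Sum>u\<in>{1..t}. \<Sum>v\<in>{1..t}. of_bool (mid t (g K) K xs u v) :: real)"
      unfolding sum.distrib by simp
  qed
  also have "\<dots> = (2 * real t) * E (m * t) (\<lambda>xs. \<Sum>u\<in>{1..t}. of_bool (leave t g K xs u))
      + E (m * t) (\<lambda>xs. \<Sum>u\<in>{1..t}. \<Sum>v\<in>{1..t}. of_bool (mid t (g K) K xs u v))"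
    unfolding E_add E_cmult ..
  also have "\<dots> \<le> (2 * real t) * (\<Sum>j\<le>K. real t * e j) + real t * (real (2 * K + 1) * (K0 / x) ^ (2 * K))"
  proof (intro add_mono mult_left_mono)
    show "E (m * t) (\<lambda>xs. \<Sum>u\<in>{1..t}. of_bool (leave t g K xs u)) \<le> (\<Sum>j\<le>K. real t * e j)"
      using lv by (intro order_trans[OF E_leave] sum_mono)
    have K1: "K0 / x \<ge> 1" using g by (simp add: K0_def)
    have "E (m * t) (\<lambda>xs. \<Sum>u\<in>{1..t}. \<Sum>v\<in>{1..t}. of_bool (mid t (g K) K xs u v))
       \<le> (\<Sum>n\<le>2 * K. \<Sum>w\<in>{w. g K \<le> real w} \<inter> {1..t}. path_sum t (\<lambda>_. g K) n w)" by (rule E_mid)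
    also have "\<dots> \<le> (\<Sum>n\<le>2 * K. \<Sum>w\<in>{w. g K \<le> real w} \<inter> {1..t}. (K0 / x) ^ (2 * K))"
    proof (intro sum_mono)
      fix n w assume n: "n \<in> {..2 * K}" and w: "w \<in> {w. g K \<le> real w} \<inter> {1..t}"
      have "path_sum t (\<lambda>_. g K) n w \<le> (K0 / x) ^ n" using g t w by (intro path_sum_const_le)
      also have "\<dots> \<le> (K0 / x) ^ (2 * K)" using n K1 by (intro power_increasing) auto
      finally show "path_sum t (\<lambda>_. g K) n w \<le> (K0 / x) ^ (2 * K)" .
    qed
    also have "\<dots> = real (2 * K + 1) * (real (card ({w. g K \<le> real w} \<inter> {1..t})) * (K0 / x) ^ (2 * K))" by simp
    also have "\<dots> \<le> real (2 * K + 1) * (real t * (K0 / x) ^ (2 * K))"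
    proof (intro mult_left_mono mult_right_mono)
      have "card ({w. g K \<le> real w} \<inter> {1..t}) \<le> card {1..t}" by (intro card_mono) auto
      then show "real (card ({w. g K \<le> real w} \<inter> {1..t})) \<le> real t" by simp
    qed (use K0_pos g in auto)
    finally show "E (m * t) (\<lambda>xs. \<Sum>u\<in>{1..t}. \<Sum>v\<in>{1..t}. of_bool (mid t (g K) K xs u v)) \<le> real t * (real (2 * K + 1) * (K0 / x) ^ (2 * K))"
      unfolding mult.left_commute[of "real t"] .
  qed auto
  finally show ?thesis by (simp add: sum_distrib_left power2_eq_square mult_ac)
qed

text \<open>With \<open>L = ln t\<close> and \<open>K \<le> c * ln L\<close> one has
  \<open>\<theta> ^ K \<le> L powr b\<close> for \<open>b = c * ln \<theta> < 1\<close>. The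
  logarithm of the power is then of order at most \<open>ln L * (1 + L powr b)\<close>, negligible
  against \<open>L\<close>.\<close>

lemma mid_term_limit:
  fixes c \<theta> M :: real
  assumes c: "c \<ge> 0" and th: "\<theta> > 1" "c * ln \<theta> < 1" and M: "M \<ge> 0"
  shows "(\<lambda>t. real (2 * nat \<lfloor>c * ln (ln (real t))\<rfloor> + 1) * (K0 / exp (- M * \<theta> ^ nat \<lfloor>c * ln (ln (real t))\<rfloor>)) ^ (2 * nat \<lfloor>c * ln (ln (real t))\<rfloor>) / real t)
     \<longlonglongrightarrow> 0"
proof -
  define b where "b = c * ln \<theta>"
  have b: "0 \<le> b" "b < 1" using assms by (auto simp: b_def)
  define h where "h L = (2 * (c * ln L) + 1) * exp (2 * (c * ln L) * (ln K0 + M * L powr b) - L)" for L :: real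
  have lim: "(h \<longlongrightarrow> 0) at_top"
  proof -
    have 1: "((\<lambda>L. (2 * (c * ln L) + 1) * exp (- L / 2)) \<longlongrightarrow> 0) at_top"
      by real_asymp
    have "((\<lambda>L. ln L * (ln K0 + M * L powr b) / L) \<longlongrightarrow> 0) at_top"
    proof -
      have "((\<lambda>L. ln L / L * ln K0 + M * (ln L * L powr (b - 1))) \<longlongrightarrow> 0 * ln K0 + M * 0) at_top"
      proof (intro tendsto_intros)
        show "((\<lambda>L::real. ln L / L) \<longlongrightarrow> 0) at_top" by real_asymp
        show "((\<lambda>L::real. ln L * L powr (b - 1)) \<longlongrightarrow> 0) at_top" using b by real_asymp
      qed
      moreover have "eventually (\<lambda>L. ln L / L * ln K0 + M * (ln L * L powr (b - 1)) = ln L * (ln K0 + M * L powr b) / L) at_top"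
        using eventually_gt_at_top[of 0] by eventually_elim (simp add: powr_diff field_simps)
      ultimately show ?thesis by (simp add: tendsto_cong)
    qed
    then have "((\<lambda>L. 2 * c * (ln L * (ln K0 + M * L powr b) / L)) \<longlongrightarrow> 2 * c * 0) at_top"
      by (intro tendsto_intros)
    then have ev: "eventually (\<lambda>L. 2 * c * (ln L * (ln K0 + M * L powr b) / L) < 1 / 2) at_top"
      by (intro order_tendstoD) auto
    show ?thesis
    proof (rule tendsto_sandwich[OF _ _ tendsto_const 1])
      show "eventually (\<lambda>L. 0 \<le> h L) at_top"
        using eventually_ge_at_top[of 1] by eventually_elim (use c in \<open>auto simp: h_def\<close>)
      show "eventually (\<lambda>L. h L \<le> (2 * (c * ln L) + 1) * exp (- L / 2)) at_top"
        using ev eventually_ge_at_top[of 1]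
      proof eventually_elim
        case (elim L)
        then have "2 * (c * ln L) * (ln K0 + M * L powr b) < L / 2" by (simp add: field_simps)
        then show ?case unfolding h_def using elim c by (intro mult_left_mono) auto
      qed
    qed
  qed
  have lt: "filterlim (\<lambda>t. ln (real t)) at_top sequentially" by real_asymp
  have lim': "((\<lambda>t. h (ln (real t))) \<longlonglongrightarrow> 0)" by (rule filterlim_compose[OF lim lt])
  show ?thesis
  proof (rule tendsto_sandwich[OF _ _ tendsto_const lim'])
    show "\<forall>\<^sub>F t in sequentially. 0 \<le> real (2 * nat \<lfloor>c * ln (ln (real t))\<rfloor> + 1) * (K0 / exp (- M * \<theta> ^ nat \<lfloor>c * ln (ln (real t))\<rfloor>)) ^ (2 * nat \<lfloor>c * ln (ln (real t))\<rfloor>) / real t"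
      using K0_pos by simp
    show "\<forall>\<^sub>F t in sequentially. real (2 * nat \<lfloor>c * ln (ln (real t))\<rfloor> + 1) * (K0 / exp (- M * \<theta> ^ nat \<lfloor>c * ln (ln (real t))\<rfloor>)) ^ (2 * nat \<lfloor>c * ln (ln (real t))\<rfloor>) / real t \<le> h (ln (real t))"
      using eventually_ge_at_top[of 16]
    proof eventually_elim
      case (elim t)
      define L where "L = ln (real t)"
      define K where "K = nat \<lfloor>c * ln L\<rfloor>"
      have t: "real t \<ge> 16" using elim by simp
      have "exp 1 \<le> (3::real)" using exp_le by simp
      then have "exp 1 \<le> real t" using t by linarith
      then have "ln (exp 1) \<le> L" unfolding L_def using t by (subst ln_le_cancel_iff) auto
      then have L: "L \<ge> 1" by simp
      have cl: "c * ln L \<ge> 0" using c L by simp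
      have K: "real K \<le> c * ln L" unfolding K_def using cl by simp
      have K01: "K0 \<ge> 1" by (simp add: K0_def)
      have "\<theta> ^ K = exp (ln \<theta> * real K)" using th by (simp add: exp_of_nat2_mult[symmetric] exp_of_nat_mult mult.commute)
      also have "\<dots> \<le> exp (ln \<theta> * (c * ln L))" using K th by simp
      also have "\<dots> = L powr b" using L by (simp add: powr_def b_def mult_ac)
      finally have thK: "\<theta> ^ K \<le> L powr b" .
      have e: "K0 / exp (- M * \<theta> ^ K) = exp (ln K0 + M * \<theta> ^ K)"
        using K0_pos by (simp add: exp_add exp_minus divide_inverse)
      have "(K0 / exp (- M * \<theta> ^ K)) ^ (2 * K) = exp (real (2 * K) * (ln K0 + M * \<theta> ^ K))"
        unfolding e by (rule exp_of_nat_mult[symmetric])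
      also have "\<dots> \<le> exp (2 * (c * ln L) * (ln K0 + M * L powr b))"
      proof -
        have "real (2 * K) * (ln K0 + M * \<theta> ^ K) \<le> 2 * (c * ln L) * (ln K0 + M * L powr b)"
          using K thK K01 M th cl by (intro mult_mono add_mono mult_left_mono add_nonneg_nonneg) auto
        then show ?thesis by simp
      qed
      finally have p: "(K0 / exp (- M * \<theta> ^ K)) ^ (2 * K) \<le> exp (2 * (c * ln L) * (ln K0 + M * L powr b))" .
      have "real (2 * K + 1) * (K0 / exp (- M * \<theta> ^ K)) ^ (2 * K) / real t
        \<le> (2 * (c * ln L) + 1) * exp (2 * (c * ln L) * (ln K0 + M * L powr b)) / real t"
        using p K cl K0_pos by (intro divide_right_mono mult_mono) auto
      also have "\<dots> = h L" using t by (simp add: h_def exp_diff L_def)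
      finally show ?case by (simp add: K_def L_def)
    qed
  qed
qed

lemma lower_bound:
  fixes \<epsilon> \<eta> :: real
  assumes eps: "\<epsilon> > 0" and eta: "\<eta> > 0"
  shows "\<forall>\<^sub>F t in sequentially.
    E (m * t) (\<lambda>xs. \<Sum>u\<in>{1..t}. \<Sum>v\<in>{1..t}. of_bool (\<exists>n. graph_dist (pa_adj m xs) u v = enat n \<and>
       real n < (4 / \<bar>ln \<rho>\<bar> - \<epsilon>) * ln (ln (real t)))) \<le> \<eta> * (real t)\<^sup>2"
proof -
  define l where "l = \<bar>ln \<rho>\<bar>"
  have l: "l > 0" "ln \<rho> = - l" using rho by (auto simp: l_def)
  \<comment> \<open>Here \<open>c * ln \<theta> = (1 - x) * (1 + k)\<close> unless
    \<open>c = 0\<close>: \<open>x\<close> is the relative shortfall of \<open>c\<close> against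
    \<open>2 / l\<close>, and \<open>k\<close> the excess of \<open>\<theta>\<close> over
    \<open>\<rho> powr (- 1/2)\<close>, kept at most \<open>x / 2\<close> to make the product less
    than 1. The cap \<open>k \<le> 1\<close> gives \<open>\<theta> \<le> 1 / \<rho>\<close>.\<close>
  define x where "x = \<epsilon> * l / 8"
  have x: "x > 0" using eps l by (simp add: x_def)
  define k where "k = min 1 (x / 2)"
  have k: "0 < k" "k \<le> 1" "k \<le> x / 2" using x by (auto simp: k_def)
  define \<theta> where "\<theta> = exp (l / 2 * (1 + k))"
  define c where "c = max 0 (2 / l - \<epsilon> / 4)"
  have rr: "1 / \<rho> = exp l" using l rho by (metis exp_ln exp_minus inverse_eq_divide inverse_inverse_eq)
  have th1: "1 < \<theta>" using l k by (simp add: \<theta>_def)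
  have th2: "\<theta> \<le> 1 / \<rho>" unfolding rr \<theta>_def using k l by (simp add: field_simps)
  have th3: "1 / \<rho> < \<theta>\<^sup>2" unfolding rr \<theta>_def using k l by (simp add: power2_eq_square exp_add[symmetric] field_simps)
  have cth: "c * ln \<theta> < 1"
  proof (cases "2 / l - \<epsilon> / 4 \<ge> 0")
    case True
    then have "c * ln \<theta> = (2 / l - \<epsilon> / 4) * (l / 2) * (1 + k)" by (simp add: c_def \<theta>_def)
    also have "(2 / l - \<epsilon> / 4) * (l / 2) = 1 - x" using l by (simp add: x_def field_simps)
    also have "(1 - x) * (1 + k) < 1"
    proof -
      have "(1 - x) * (1 + k) = 1 - x + k - x * k" by (simp add: algebra_simps)
      moreover have "x * k > 0" using x k by simp
      ultimately show ?thesis using k x by linarith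
    qed
    finally show ?thesis .
  qed (simp add: c_def)
  obtain s \<mu> B0 where s: "s > 0" "\<mu> > 0" and lv: "\<And>B t j. B \<ge> B0 \<Longrightarrow> t \<ge> 1 \<Longrightarrow>
    (\<Sum>w\<in>{w. real w < real t * exp (- \<mu> * (B * \<theta> ^ j))} \<inter> {1..t}. path_sum t (\<lambda>i. real t * exp (- \<mu> * (B * \<theta> ^ i))) j w)
      \<le> real t * ((1 / (1 - \<gamma>) + 1 / \<gamma>) * exp (- s * (B * \<theta> ^ j)))"
    using leave_bound[OF th3 th1 th2] by metis
  define C where "C = 1 / (1 - \<gamma>) + 1 / \<gamma>"
  have C: "C > 0" using chi by (simp add: C_def add_pos_pos)
  \<comment> \<open>\<open>B\<close> lowers the barrier until all crossings together weigh less than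
    \<open>\<eta> / 4\<close>, uniformly in \<open>t\<close> and in the number of steps.\<close>
  have "\<exists>B. B \<ge> max B0 1 \<and> 4 * C * (exp (- s * B) / (1 - exp (- s * (\<theta> - 1)))) < \<eta>"
  proof -
    have "((\<lambda>B. 4 * C * (exp (- s * B) / (1 - exp (- s * (\<theta> - 1))))) \<longlongrightarrow> 4 * C * (0 / (1 - exp (- s * (\<theta> - 1))))) at_top"
    proof (intro tendsto_intros)
      show "((\<lambda>B. exp (- s * B)) \<longlongrightarrow> 0) at_top" using s by real_asymp
      show "1 - exp (- s * (\<theta> - 1)) \<noteq> 0" using s th1 by simp
    qed
    then have "eventually (\<lambda>B. 4 * C * (exp (- s * B) / (1 - exp (- s * (\<theta> - 1)))) < \<eta>) at_top"
      using eta by (intro order_tendstoD) auto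
    then have "eventually (\<lambda>B. B \<ge> max B0 1 \<and> 4 * C * (exp (- s * B) / (1 - exp (- s * (\<theta> - 1)))) < \<eta>) at_top"
      using eventually_ge_at_top[of "max B0 1"] by eventually_elim auto
    then show ?thesis by (rule eventually_happens'[rotated]) simp
  qed
  then obtain B where B: "B \<ge> B0" "B \<ge> 1" and Bs: "4 * C * (exp (- s * B) / (1 - exp (- s * (\<theta> - 1)))) < \<eta>"
    by auto
  have sumB: "(\<Sum>j\<le>K. C * exp (- s * (B * \<theta> ^ j))) \<le> C * (exp (- s * B) / (1 - exp (- s * (\<theta> - 1))))" for K
  proof -
    define q where "q = exp (- s * (\<theta> - 1))"
    have q: "0 < q" "q < 1" using s th1 by (auto simp: q_def)
    have "exp (- s * (B * \<theta> ^ j)) \<le> exp (- s * B) * q ^ j" for j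
    proof -
      have "1 + real j * (\<theta> - 1) \<le> (1 + (\<theta> - 1)) ^ j" using th1 by (intro Bernoulli_inequality) auto
      then have "B * (1 + real j * (\<theta> - 1)) \<le> B * \<theta> ^ j" using B by (intro mult_left_mono) auto
      moreover have "B + real j * (\<theta> - 1) \<le> B * (1 + real j * (\<theta> - 1))"
      proof -
        have "1 * (real j * (\<theta> - 1)) \<le> B * (real j * (\<theta> - 1))" using B(2) th1 by (intro mult_right_mono) auto
        then show ?thesis by (simp add: distrib_left)
      qed
      ultimately have "s * (B + real j * (\<theta> - 1)) \<le> s * (B * \<theta> ^ j)" using s by (intro mult_left_mono) auto
      then have "exp (- s * (B * \<theta> ^ j)) \<le> exp (- s * B + real j * (- s * (\<theta> - 1)))" by (simp add: algebra_simps)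
      also have "\<dots> = exp (- s * B) * q ^ j" unfolding exp_add exp_of_nat_mult q_def ..
      finally show ?thesis .
    qed
    then have "(\<Sum>j\<le>K. C * exp (- s * (B * \<theta> ^ j))) \<le> (\<Sum>j\<le>K. C * (exp (- s * B) * q ^ j))"
      using C by (intro sum_mono mult_left_mono) auto
    also have "\<dots> = C * (exp (- s * B) * (\<Sum>j\<le>K. q ^ j))" by (simp add: sum_distrib_left)
    also have "(\<Sum>j\<le>K. q ^ j) \<le> 1 / (1 - q)"
    proof -
      have "(\<Sum>j<Suc K. q ^ j) = (1 - q ^ Suc K) / (1 - q)" using q by (subst sum_gp_strict) auto
      also have "\<dots> \<le> 1 / (1 - q)" using q by (intro divide_right_mono) auto
      finally show ?thesis by (simp add: lessThan_Suc_atMost)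
    qed
    finally show ?thesis using C by (simp add: q_def)
  qed
  define K where "K t = nat \<lfloor>c * ln (ln (real t))\<rfloor>" for t :: nat
  have "(\<lambda>t. real (2 * K t + 1) * (K0 / exp (- (\<mu> * B) * \<theta> ^ K t)) ^ (2 * K t) / real t) \<longlonglongrightarrow> 0"
    unfolding K_def using cth th1 s B by (intro mid_term_limit) (auto simp: c_def)
  then have ev: "\<forall>\<^sub>F t in sequentially. real (2 * K t + 1) * (K0 / exp (- (\<mu> * B) * \<theta> ^ K t)) ^ (2 * K t) / real t < \<eta> / 2"
    using eta by (intro order_tendstoD) auto
  have "filterlim (\<lambda>t. \<epsilon> / 2 * ln (ln (real t))) at_top sequentially" using eps by real_asymp
  then have ev2: "\<forall>\<^sub>F t in sequentially. \<epsilon> / 2 * ln (ln (real t)) \<ge> 2"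
    unfolding filterlim_at_top by blast
  show ?thesis using ev ev2 eventually_ge_at_top[of 1]
  proof eventually_elim
    case (elim t)
    define g where "g i = real t * exp (- \<mu> * (B * \<theta> ^ i))" for i
    define y where "y = exp (- \<mu> * (B * \<theta> ^ K t))"
    have lln: "ln (ln (real t)) > 0" using elim eps by (smt (verit) mult_nonneg_nonpos half_gt_zero)
    have "E (m * t) (\<lambda>xs. \<Sum>u\<in>{1..t}. \<Sum>v\<in>{1..t}. of_bool (\<exists>n. graph_dist (pa_adj m xs) u v = enat n \<and>
       real n < (4 / \<bar>ln \<rho>\<bar> - \<epsilon>) * ln (ln (real t))))
     \<le> E (m * t) (\<lambda>xs. \<Sum>u\<in>{1..t}. \<Sum>v\<in>{1..t}. of_bool (\<exists>n\<le>2 * K t. graph_dist (pa_adj m xs) u v = enat n))"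
    proof (intro E_mono sum_mono)
      fix xs u v
      have "n \<le> 2 * K t" if "real n < (4 / \<bar>ln \<rho>\<bar> - \<epsilon>) * ln (ln (real t))" for n
      proof -
        \<comment> \<open>Half of \<open>\<epsilon>\<close> has gone into \<open>c\<close>; the
          other half beats the rounding in \<open>K t\<close>.\<close>
        have "(4 / \<bar>ln \<rho>\<bar> - \<epsilon>) * ln (ln (real t)) = 2 * ((2 / l - \<epsilon> / 4) * ln (ln (real t))) - \<epsilon> / 2 * ln (ln (real t))"
          by (simp add: l_def algebra_simps)
        also have "\<dots> \<le> 2 * (c * ln (ln (real t))) - 2"
          using elim lln by (intro diff_mono mult_left_mono mult_right_mono) (auto simp: c_def)
        also have "\<dots> \<le> 2 * real (K t)"
          unfolding K_def by linarith
        finally have "real n < real (2 * K t)" using that by simp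
        then show ?thesis by simp
      qed
      then show "of_bool (\<exists>n. graph_dist (pa_adj m xs) u v = enat n \<and> real n < (4 / \<bar>ln \<rho>\<bar> - \<epsilon>) * ln (ln (real t)))
        \<le> (of_bool (\<exists>n\<le>2 * K t. graph_dist (pa_adj m xs) u v = enat n) :: real)"
        by (auto simp: of_bool_def)
    qed
    also have "\<dots> \<le> 2 * (real t)\<^sup>2 * (\<Sum>j\<le>K t. C * exp (- s * (B * \<theta> ^ j))) + real t * (real (2 * K t + 1) * (K0 / y) ^ (2 * K t))"
    proof (rule near_bound)
      show "1 \<le> t" by fact
      show "g (K t) = real t * y" by (simp add: g_def y_def)
      show "0 < y" by (simp add: y_def)
      show "y \<le> 1" using s B th1 by (simp add: y_def)
      show "g j \<le> g i" if "i \<le> j" for i j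
        unfolding g_def using that s B th1 by (auto intro!: mult_left_mono power_increasing)
      show "(\<Sum>w\<in>{w. real w < g j} \<inter> {1..t}. path_sum t g j w) \<le> real t * (C * exp (- s * (B * \<theta> ^ j)))" for j
        using lv[OF B(1) \<open>1 \<le> t\<close>, of j] by (simp add: g_def[abs_def] C_def)
    qed
    also have "\<dots> \<le> 2 * (real t)\<^sup>2 * (\<eta> / 4) + real t * (\<eta> / 2 * real t)"
    proof (intro add_mono mult_left_mono)
      show "(\<Sum>j\<le>K t. C * exp (- s * (B * \<theta> ^ j))) \<le> \<eta> / 4" using sumB[of "K t"] Bs by linarith
      have "real (2 * K t + 1) * (K0 / y) ^ (2 * K t) / real t < \<eta> / 2"
        using elim(1) by (simp add: y_def mult.assoc)
      then show "real (2 * K t + 1) * (K0 / y) ^ (2 * K t) \<le> \<eta> / 2 * real t"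
        using elim(3) pos_divide_less_eq[of "real t"] by (simp add: less_imp_le)
    qed auto
    also have "\<dots> = \<eta> * (real t)\<^sup>2" by (simp add: power2_eq_square)
    finally show ?case .
  qed
qed

section \<open>The upper bound\<close>

definition DD :: real where "DD = 2 * real m + \<delta>"

text \<open>At the completion of vertex \<open>s\<close> this equals \<open>s * DD\<close> exactly,
  so \<open>DD\<close> is the mean weight per vertex.\<close>

definition vol :: "nat list \<Rightarrow> nat \<Rightarrow> real" where "vol xs s = (\<Sum>v\<in>{1..s}. wt xs v)"

lemma DD: "DD > real m" "DD = real m * (1 + \<rho>)"
  using delta_gt m_pos by (auto simp: DD_def \<rho>_def field_simps)

lemma vol_init: "valid (m * s) xs \<Longrightarrow> vol xs s = real s * DD"
  using sum_deg[of "m * s" xs s] by (simp add: vol_def wt_def sum.distrib DD_def algebra_simps)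

lemma vol_snoc:
  assumes "m * s \<le> length xs"
  shows "vol (xs @ [v]) s = vol xs s + of_bool (v \<in> {1..s})"
proof -
  have "vol (xs @ [v]) s = (\<Sum>u\<in>{1..s}. wt xs u + (if v = u then 1 else 0))"
    unfolding vol_def
  proof (intro sum.cong refl wt_snoc_old)
    fix u assume "u \<in> {1..s}"
    then have "m * u \<le> m * s" by simp
    then show "m * u \<le> length xs" using assms by linarith
  qed
  then show ?thesis by (simp add: sum.distrib vol_def)
qed

lemma sum_q_vol:
  assumes "m * s \<le> length xs"
  shows "(\<Sum>v\<in>{1..s}. q xs v) = vol xs s / cc (length xs)"
  unfolding vol_def sum_divide_distrib
proof (intro sum.cong refl q_old)
  fix u assume u: "u \<in> {1..s}"
  have "s < src (length xs)" using assms src_gt_iff by simp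
  then show "u < src (length xs)" "1 \<le> u" using u by auto
qed

lemma wt_mono: "wt xs v \<le> wt (xs @ ys) v"
  using pa_deg_append_ge[of m xs v ys] by (simp add: wt_def)

lemma wt_take_le: "wt (take n xs) v \<le> wt xs v"
  using wt_mono[of "take n xs" v "drop n xs"] by simp

lemma vol_ge:
  assumes "valid n xs" "m * s \<le> n"
  shows "vol xs s \<ge> real s * DD"
proof -
  have "real s * DD = vol (take (m * s) xs) s" using vol_init[OF pa_valid_take[OF assms]] by simp
  also have "\<dots> \<le> vol xs s" unfolding vol_def by (intro sum_mono wt_take_le)
  finally show ?thesis .
qed

lemma sum_q_step:
  assumes va: "valid n xs" and s: "m * s \<le> n"
  shows "(\<Sum>v\<in>{1..src n}. q xs v * (if v \<in> {1..s} then a else b)) = b + vol xs s / cc n * (a - b)"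
proof -
  have l: "length xs = n" using va pa_valid_length by blast
  have sub: "{1..s} \<subseteq> {1..src n}" using s src_gt_iff[of s n] by auto
  have "(\<Sum>v\<in>{1..src n}. q xs v * (if v \<in> {1..s} then a else b))
     = (\<Sum>v\<in>{1..src n}. b * q xs v + (if v \<in> {1..s} then q xs v * (a - b) else 0))"
    by (intro sum.cong) (auto simp: algebra_simps)
  also have "\<dots> = b * (\<Sum>v\<in>{1..src n}. q xs v) + (\<Sum>v\<in>{1..src n} \<inter> {1..s}. q xs v * (a - b))"
    unfolding sum.distrib sum_distrib_left sum.inter_restrict[OF finite_atLeastAtMost] ..
  also have "{1..src n} \<inter> {1..s} = {1..s}" using sub by auto
  also have "(\<Sum>v\<in>{1..s}. q xs v * (a - b)) = vol xs s / cc n * (a - b)"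
    using sum_q_vol[of s xs] s l by (simp add: sum_distrib_right[symmetric])
  finally show ?thesis using sum_q[OF va] by simp
qed

lemma E_vol:
  assumes "m * s \<le> N"
  shows "E N (\<lambda>xs. vol xs s) = growth (m * s) N * (real s * DD)"
proof -
  have "E N (\<lambda>xs. vol xs s) = (\<Prod>k\<in>{m * s..<N}. 1 + 1 / cc k) * E (m * s) (\<lambda>xs. vol xs s)"
  proof (rule E_iter_eq[OF assms])
    fix k xs assume k: "m * s \<le> k" and va: "valid k xs"
    have l: "length xs = k" using va pa_valid_length by blast
    have "(\<Sum>v\<in>{1..src k}. q xs v * vol (xs @ [v]) s) = (\<Sum>v\<in>{1..src k}. q xs v * (if v \<in> {1..s} then vol xs s + 1 else vol xs s))"
      using k l by (intro sum.cong) (auto simp: vol_snoc)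
    also have "\<dots> = (1 + 1 / cc k) * vol xs s" unfolding sum_q_step[OF va k] by (simp add: algebra_simps)
    finally show "(\<Sum>v\<in>{1..src k}. q xs v * vol (xs @ [v]) s) = (1 + 1 / cc k) * vol xs s" .
  qed
  also have "E (m * s) (\<lambda>xs. vol xs s) = E (m * s) (\<lambda>xs. real s * DD)" by (intro E_cong vol_init)
  finally show ?thesis by (simp add: E_const growth_def)
qed

text \<open>From time \<open>n\<close> on, the weight of a complete vertex grows by the same mean
  factor whatever happened before, so anything decided by time \<open>n\<close> factors out.\<close>

lemma E_wt:
  assumes v: "1 \<le> v" "m * v \<le> n" and n: "n \<le> N"
  shows "E N (\<lambda>xs. wt xs v * A (take n xs)) = growth n N * E n (\<lambda>xs. wt xs v * A xs)"
proof -
  have "E N (\<lambda>xs. wt xs v * A (take n xs)) = (\<Prod>k\<in>{n..<N}. 1 + 1 / cc k) * E n (\<lambda>xs. wt xs v * A (take n xs))"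
  proof (rule E_iter_eq[OF n])
    fix k xs assume k: "n \<le> k" and va: "valid k xs"
    have l: "length xs = k" using va pa_valid_length by blast
    have vs: "v < src k" using src_gt_iff[of v k] v k by simp
    have "(\<Sum>u\<in>{1..src k}. q xs u * (wt (xs @ [u]) v * A (take n (xs @ [u]))))
       = (\<Sum>u\<in>{1..src k}. q xs u * (wt xs v * A (take n xs)) + (if u = v then q xs v * A (take n xs) else 0))"
      using k l v by (intro sum.cong) (auto simp: wt_snoc_old algebra_simps)
    also have "\<dots> = wt xs v * A (take n xs) + q xs v * A (take n xs)"
      using sum_q[OF va] v vs by (simp add: sum.distrib sum_distrib_right[symmetric])
    also have "q xs v = wt xs v / cc k" using q_old[of v xs] v vs l by simp
    finally show "(\<Sum>u\<in>{1..src k}. q xs u * (wt (xs @ [u]) v * A (take n (xs @ [u])))) = (1 + 1 / cc k) * (wt xs v * A (take n xs))"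
      by (simp add: algebra_simps)
  qed
  also have "E n (\<lambda>xs. wt xs v * A (take n xs)) = E n (\<lambda>xs. wt xs v * A xs)"
    by (intro E_cong) (auto dest: pa_valid_length)
  finally show ?thesis by (simp add: growth_def)
qed

text \<open>Since \<open>vol\<close> increases by one with probability \<open>vol / c\<close>, the quantity \<open>1 / (vol - 1)\<close> is an exact
  martingale after normalisation; Markov's inequality then gives the lower tail of \<open>vol\<close>.\<close>

lemma E_inv_vol:
  assumes s: "s \<ge> 1" "m * s \<le> N"
  shows "E N (\<lambda>xs. 1 / (vol xs s - 1)) = (\<Prod>k\<in>{m * s..<N}. 1 - 1 / cc k) * (1 / (real s * DD - 1))"
proof -
  have sD: "real s * DD > 1"
  proof -
    have "real s * DD \<ge> 1 * DD" using s DD by (intro mult_right_mono) auto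
    moreover have "DD > 1" using DD(1) m2 by simp
    ultimately show ?thesis by linarith
  qed
  have "E N (\<lambda>xs. 1 / (vol xs s - 1)) = (\<Prod>k\<in>{m * s..<N}. 1 - 1 / cc k) * E (m * s) (\<lambda>xs. 1 / (vol xs s - 1))"
  proof (rule E_iter_eq[OF s(2)])
    fix k xs assume k: "m * s \<le> k" and va: "valid k xs"
    have l: "length xs = k" using va pa_valid_length by blast
    have V: "vol xs s > 1" using vol_ge[OF va k] sD by linarith
    have "(\<Sum>v\<in>{1..src k}. q xs v * (1 / (vol (xs @ [v]) s - 1))) = (\<Sum>v\<in>{1..src k}. q xs v * (if v \<in> {1..s} then 1 / vol xs s else 1 / (vol xs s - 1)))"
      using k l by (intro sum.cong) (auto simp: vol_snoc)
    also have "\<dots> = 1 / (vol xs s - 1) + vol xs s / cc k * (1 / vol xs s - 1 / (vol xs s - 1))"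
      by (rule sum_q_step[OF va k])
    also have "vol xs s / cc k * (1 / vol xs s - 1 / (vol xs s - 1)) = - (1 / cc k * (1 / (vol xs s - 1)))"
      using V cc_pos[of k] by (simp add: field_simps)
    finally show "(\<Sum>v\<in>{1..src k}. q xs v * (1 / (vol (xs @ [v]) s - 1))) = (1 - 1 / cc k) * (1 / (vol xs s - 1))"
      by (simp only: left_diff_distrib mult_1_left add_uminus_conv_diff)
  qed
  also have "E (m * s) (\<lambda>xs. 1 / (vol xs s - 1)) = E (m * s) (\<lambda>xs. 1 / (real s * DD - 1))"
    by (intro E_cong) (simp add: vol_init)
  finally show ?thesis by (simp add: E_const)
qed

lemma vol_lower:
  assumes s: "s \<ge> 1" "m * s \<le> N" and y: "y \<ge> 0"
  shows "E N (\<lambda>xs. of_bool (vol xs s \<le> y)) \<le> 2 * y / real s * (real (m * s) / real N) powr \<gamma>"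
proof -
  \<comment> \<open>Since \<open>DD > m \<ge> 2\<close>, at least \<open>s\<close> remains after the
    subtraction of 1 in \<open>1 / (vol xs s - 1)\<close>.\<close>
  have sD: "real s * DD \<ge> real s + 1"
  proof -
    have "real s * DD \<ge> real s * 2" using m2 DD(1) by (intro mult_left_mono) auto
    then show ?thesis using s by linarith
  qed
  have "E N (\<lambda>xs. of_bool (vol xs s \<le> y)) \<le> E N (\<lambda>xs. y * (1 / (vol xs s - 1)))"
  proof (intro E_mono)
    fix xs assume va: "valid N xs"
    have "vol xs s > 1" using vol_ge[OF va s(2)] sD s by linarith
    then show "of_bool (vol xs s \<le> y) \<le> y * (1 / (vol xs s - 1))"
      using y by (auto simp: of_bool_def field_simps)
  qed
  also have "\<dots> = y * ((\<Prod>k\<in>{m * s..<N}. 1 - 1 / cc k) * (1 / (real s * DD - 1)))"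
    unfolding E_cmult E_inv_vol[OF s] ..
  also have "\<dots> \<le> y * (2 * (real (m * s) / real N) powr \<gamma> * (1 / real s))"
  proof (intro mult_left_mono mult_mono)
    show "(\<Prod>k\<in>{m * s..<N}. 1 - 1 / cc k) \<le> 2 * (real (m * s) / real N) powr \<gamma>"
      using s m_pos by (intro decay_le) auto
    show "1 / (real s * DD - 1) \<le> 1 / real s" using sD s by (intro divide_left_mono) auto
  qed (use sD y in auto)
  also have "\<dots> = 2 * y / real s * (real (m * s) / real N) powr \<gamma>" by simp
  finally show ?thesis .
qed

section \<open>Vertices without first-edge ancestors of large degree\<close>

definition par :: "nat list \<Rightarrow> nat \<Rightarrow> nat" where "par xs r = xs ! (m * (r - 1))"

text \<open>No degree reaches \<open>G\<close> on the line of \<open>v\<close> and its first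
  \<open>j\<close> iterated parents. If the first edge is a self-loop, the line stays where it
  is.\<close>

fun bad :: "nat \<Rightarrow> nat \<Rightarrow> nat list \<Rightarrow> nat \<Rightarrow> bool" where
  "bad G 0 xs v = (dg xs v < G)"
| "bad G (Suc j) xs v = (dg xs v < G \<and> bad G j xs (par xs v))"

lemma bad_deg: "bad G j xs v \<Longrightarrow> dg xs v < G" by (cases j) auto

lemma deg_take_le: "dg (take n xs) v \<le> dg xs v"
  using pa_deg_append_ge[of m "take n xs" v "drop n xs"] by simp

lemma src_block: "k \<in> {m * (r - 1)..<m * r} \<Longrightarrow> r \<ge> 1 \<Longrightarrow> src k = r"
  by (cases r) (auto simp: pa_src_def div_m_iff)

lemma par_valid:
  assumes "valid n xs" "1 \<le> v" "m * v \<le> n"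
  shows "par xs v \<in> {1..v}"
proof -
  have "m * (v - 1) < m * v" using assms m_pos by simp
  then have "m * (v - 1) < n" "src (m * (v - 1)) = v"
    using assms(2) src_block[of "m * (v - 1)" v] less_le_trans[OF _ assms(3)] by auto
  then show ?thesis using assms(1) unfolding par_def pa_valid_def by metis
qed

text \<open>Degrees only grow, and the parents of \<open>v \<le> p\<close> are settled at time
  \<open>m * p\<close>; badness therefore passes to earlier histories.\<close>

lemma bad_take:
  assumes "valid n xs" "m * p \<le> n" "1 \<le> v" "v \<le> p" "bad G j xs v"
  shows "bad G j (take (m * p) xs) v"
  using assms(3-5)
proof (induction j arbitrary: v)
  case 0
  then show ?case using deg_take_le[of "m * p" xs v] by simp
next
  case (Suc j)
  have mv: "m * v \<le> n" using Suc.prems assms(2) by (meson le_trans mult_le_mono2)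
  have p: "par xs v \<in> {1..v}" using assms(1) Suc.prems mv by (intro par_valid) auto
  have "m * (v - 1) < m * v" using Suc.prems m_pos by simp
  also have "\<dots> \<le> m * p" using Suc.prems by simp
  finally have pe: "par (take (m * p) xs) v = par xs v" by (simp add: par_def)
  show ?case using Suc.IH[of "par xs v"] Suc.prems p deg_take_le[of "m * p" xs v] by (auto simp: pe)
qed

text \<open>Bad vertices are weighted rather than counted, because a new first edge hits them with
  probability proportional to their weight.\<close>

definition bad_wt :: "nat \<Rightarrow> nat \<Rightarrow> nat \<Rightarrow> real" where
  "bad_wt G j n = E (m * n) (\<lambda>xs. \<Sum>v\<in>{1..n}. wt xs v * of_bool (bad G j xs v))"

definition loops :: "nat list \<Rightarrow> nat \<Rightarrow> real" where
  "loops ys r = (\<Sum>k\<in>{m * (r - 1)..<m * r}. of_bool (ys ! k = r))"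

lemma deg_at_birth:
  assumes "valid (m * r) ys" "r \<ge> 1"
  shows "real (dg ys r) = real m + loops ys r"
proof -
  have l: "length ys = m * r" using assms pa_valid_length by blast
  have "card {k. k < m * r \<and> src k = r} = m"
    using src_gt_iff[of r "m * r"] assms by (simp add: card_src)
  moreover have "{k. k < m * r \<and> ys ! k = r} = {k\<in>{m * (r - 1)..<m * r}. ys ! k = r}"
  proof -
    have "m * (r - 1) \<le> k" if "k < m * r" "ys ! k = r" for k
    proof -
      have "r \<le> src k" using assms(1) that by (auto simp: pa_valid_def)
      then have "r - 1 < src k" using assms by simp
      then show ?thesis using src_gt_iff by simp
    qed
    then show ?thesis by auto
  qed
  moreover have "real (card {k\<in>{m * (r - 1)..<m * r}. ys ! k = r}) = loops ys r"
    by (simp add: loops_def sum.inter_filter[symmetric] of_bool_def if_distrib cong: if_cong)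
  ultimately show ?thesis by (simp add: pa_deg_def length_filter_conv_card l)
qed

text \<open>The source has bounded weight (\<open>deg_birth\<close>) against a total of order
  \<open>m * r\<close>. Self-loops therefore enter only as an error term.\<close>

lemma E_loops:
  assumes r: "r \<ge> 2"
  shows "E (m * r) (\<lambda>ys. loops ys r) \<le> K0 / real r"
proof -
  have "E (m * r) (\<lambda>ys. of_bool (ys ! k = r)) \<le> K0 / (real m * real r)" if k: "k \<in> {m * (r - 1)..<m * r}" for k
  proof -
    have sk: "src k = r" using src_block[OF k] r by simp
    have "E (m * r) (\<lambda>ys. of_bool (ys ! k = r)) = E (m * r) (\<lambda>ys. (\<lambda>zs. of_bool (zs ! k = r)) (take (Suc k) ys))"
      by (intro E_cong) simp
    also have "\<dots> = E (Suc k) (\<lambda>zs. of_bool (zs ! k = r))" using k by (intro E_take) auto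
    also have "\<dots> = E k (\<lambda>xs. \<Sum>v\<in>{1..src k}. q xs v * of_bool ((xs @ [v]) ! k = r))" by (rule E_Suc)
    also have "\<dots> \<le> E k (\<lambda>xs. K0 / (real m * real r))"
    proof (intro E_mono)
      fix xs assume va: "valid k xs"
      have l: "length xs = k" using va pa_valid_length by blast
      have "(\<Sum>v\<in>{1..src k}. q xs v * of_bool ((xs @ [v]) ! k = r)) = (\<Sum>v\<in>{1..src k}. if v = r then q xs r else 0)"
        using l by (intro sum.cong) (auto simp: nth_append)
      also have "\<dots> = q xs r" using r sk by simp
      also have "\<dots> = (real (dg xs r) + 1 + real (k mod m + 1) * \<delta> / real m) / cc k"
        using sk by (simp add: q_def l pa_weight_def Let_def)
      also have "\<dots> \<le> real (2 * m + 1) / (real m * real r / 2)"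
      proof (intro frac_le)
        have "dg xs r \<le> 2 * m" using va k r by (intro deg_birth) auto
        moreover have "real (k mod m + 1) * \<delta> / real m \<le> 0"
          using delta_neg m_pos by (simp add: divide_nonpos_pos mult_nonneg_nonpos)
        ultimately show "real (dg xs r) + 1 + real (k mod m + 1) * \<delta> / real m \<le> real (2 * m + 1)" by simp
        have "real r * 1 \<le> 2 * (real r - 1)" using r by simp
        then have "real m * (real r * 1) \<le> real m * (2 * (real r - 1))" by (intro mult_left_mono) auto
        then have "real m * real r / 2 \<le> real m * (real r - 1)" by linarith
        also have "\<dots> = real (m * (r - 1))" using r by (simp add: of_nat_diff)
        also have "\<dots> \<le> real k" using k by (intro of_nat_mono) auto
        also have "\<dots> \<le> real k * (1 + \<rho>)" using rho by (simp add: mult_le_cancel_left1)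
        also have "\<dots> \<le> cc k" using rho by (simp add: cc_eq)
        finally show "real m * real r / 2 \<le> cc k" .
      qed (use r m_pos in auto)
      also have "\<dots> = K0 / (real m * real r)" by (simp add: K0_def)
      finally show "(\<Sum>v\<in>{1..src k}. q xs v * of_bool ((xs @ [v]) ! k = r)) \<le> K0 / (real m * real r)" .
    qed
    finally show ?thesis by (simp add: E_const)
  qed
  then have "(\<Sum>k\<in>{m * (r - 1)..<m * r}. E (m * r) (\<lambda>ys. of_bool (ys ! k = r))) \<le> (\<Sum>k\<in>{m * (r - 1)..<m * r}. K0 / (real m * real r))"
    by (intro sum_mono)
  also have "\<dots> = real (m * r - m * (r - 1)) * (K0 / (real m * real r))" by simp
  also have "m * r - m * (r - 1) = m" using r by (cases r) auto
  also have "real m * (K0 / (real m * real r)) = K0 / real r" using m_pos by simp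
  finally show ?thesis unfolding loops_def E_sum .
qed

text \<open>When the first edge of \<open>r\<close> is drawn, all older vertices are complete, so
  each is hit with probability \<open>wt / cc\<close>.\<close>

lemma E_par_bad:
  assumes r: "r \<ge> 2"
  shows "E (m * r) (\<lambda>ys. of_bool (par ys r < r \<and> bad G j (take (m * (r - 1)) ys) (par ys r))) = bad_wt G j (r - 1) / cc (m * (r - 1))"
proof -
  define n where "n = m * (r - 1)"
  have n: "n < m * r" using r m_pos by (simp add: n_def)
  have sn: "src n = r" using src_block[of n r] r n by (simp add: n_def)
  define f where "f zs = (of_bool (par zs r < r \<and> bad G j (take n zs) (par zs r)) :: real)" for zs
  have "E (m * r) f = E (m * r) (\<lambda>ys. f (take (Suc n) ys))"
    by (intro E_cong) (simp add: f_def par_def n_def min_def)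
  also have "\<dots> = E (Suc n) f" using n by (intro E_take) auto
  also have "\<dots> = E n (\<lambda>xs. \<Sum>v\<in>{1..src n}. q xs v * f (xs @ [v]))" by (rule E_Suc)
  also have "\<dots> = E n (\<lambda>xs. 1 / cc n * (\<Sum>v\<in>{1..r - 1}. wt xs v * of_bool (bad G j xs v)))"
  proof (intro E_cong)
    fix xs assume va: "valid n xs"
    have l: "length xs = n" using va pa_valid_length by blast
    have f: "f (xs @ [v]) = of_bool (v < r \<and> bad G j xs v)" for v
      using l unfolding f_def par_def n_def[symmetric] by (simp add: nth_append)
    have "{1..src n} = insert r {1..r - 1}" using sn r by auto
    then have "(\<Sum>v\<in>{1..src n}. q xs v * f (xs @ [v])) = (\<Sum>v\<in>{1..r - 1}. q xs v * f (xs @ [v]))"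
      using r by (simp add: f)
    also have "\<dots> = (\<Sum>v\<in>{1..r - 1}. 1 / cc n * (wt xs v * of_bool (bad G j xs v)))"
    proof (intro sum.cong refl)
      fix v assume v: "v \<in> {1..r - 1}"
      then have "v < r" using r by auto
      then show "q xs v * f (xs @ [v]) = 1 / cc n * (wt xs v * of_bool (bad G j xs v))"
        using v l sn by (simp add: f q_old)
    qed
    finally show "(\<Sum>v\<in>{1..src n}. q xs v * f (xs @ [v])) = 1 / cc n * (\<Sum>v\<in>{1..r - 1}. wt xs v * of_bool (bad G j xs v))"
      unfolding sum_distrib_left .
  qed
  finally show ?thesis unfolding E_cmult f_def[abs_def] bad_wt_def n_def by simp
qed

text \<open>If \<open>r\<close> is bad at time \<open>n\<close>, its first edge went to a vertex
  already bad at that time or to \<open>r\<close> itself. This is settled at time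
  \<open>m * r\<close>, so \<open>E_wt\<close> splits off the later growth; at completion the weight
  is \<open>m + \<delta>\<close> plus the number of self-loops.\<close>

lemma bad_vertex_bound:
  assumes r: "r \<ge> 2" "r \<le> n" and b: "bad_wt G j (r - 1) \<le> b * (real (r - 1) * DD)" "b \<ge> 0"
  shows "E (m * n) (\<lambda>xs. wt xs r * of_bool (bad G (Suc j) xs r))
    \<le> growth (m * r) (m * n) * ((real m + \<delta>) * b + 2 * real m * (K0 / real r))"
proof -
  define A where "A ys = (of_bool (par ys r = r \<or> (par ys r < r \<and> bad G j (take (m * (r - 1)) ys) (par ys r))) :: real)" for ys
  have mr: "m * r \<le> m * n" using r by simp
  have "E (m * n) (\<lambda>xs. wt xs r * of_bool (bad G (Suc j) xs r)) \<le> E (m * n) (\<lambda>xs. wt xs r * A (take (m * r) xs))"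
  proof (intro E_mono mult_left_mono)
    fix xs assume va: "valid (m * n) xs"
    have l: "length xs = m * n" using va pa_valid_length by blast
    show "wt xs r \<ge> 0" using wt_pos[of r xs] src_gt_iff[of r "m * n"] r mr l by simp
    show "of_bool (bad G (Suc j) xs r) \<le> A (take (m * r) xs)"
    proof (cases "bad G (Suc j) xs r")
      case True
      then have bj: "bad G j xs (par xs r)" by simp
      have p: "par xs r \<in> {1..r}" using va r mr by (intro par_valid) auto
      have m1: "m * (r - 1) < m * r" using r m_pos by simp
      have pe: "par (take (m * r) xs) r = par xs r" using m1 by (simp add: par_def)
      have "bad G j (take (m * (r - 1)) xs) (par xs r)" if "par xs r < r"
        using va that p bj m1 mr by (intro bad_take[of "m * n"]) auto
      then have "A (take (m * r) xs) = 1" using p m1 unfolding A_def pe by (auto simp: min_def of_bool_def)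
      then show ?thesis by simp
    qed (simp add: A_def)
  qed
  also have "\<dots> = growth (m * r) (m * n) * E (m * r) (\<lambda>xs. wt xs r * A xs)"
    using r by (intro E_wt) auto
  also have "\<dots> \<le> growth (m * r) (m * n) * ((real m + \<delta>) * b + 2 * real m * (K0 / real r))"
  proof (intro mult_left_mono)
    define P where "P ys = (of_bool (par ys r < r \<and> bad G j (take (m * (r - 1)) ys) (par ys r)) :: real)" for ys
    have "E (m * r) (\<lambda>ys. wt ys r * A ys) \<le> E (m * r) (\<lambda>ys. (real m + \<delta>) * P ys + 2 * real m * loops ys r)"
    proof (intro E_mono)
      fix ys assume va: "valid (m * r) ys"
      have d: "real (dg ys r) = real m + loops ys r" using va r by (intro deg_at_birth) auto
      have s0: "loops ys r \<ge> 0" by (auto simp: loops_def intro!: sum_nonneg)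
      have "dg ys r \<le> 2 * m" using va r by (intro deg_birth) auto
      then have d2: "wt ys r \<le> 2 * real m" using delta_neg by (simp add: wt_def)
      show "wt ys r * A ys \<le> (real m + \<delta>) * P ys + 2 * real m * loops ys r"
      \<comment> \<open>If the first edge is a self-loop, the crude weight bound
        \<open>2 * m\<close> is paid by \<open>loops\<close>; otherwise \<open>A\<close> and
        \<open>P\<close> coincide.\<close>
      proof (cases "par ys r = r")
        case True
        have "m * (r - 1) < m * r" using r m_pos by simp
        then have "of_bool (ys ! (m * (r - 1)) = r) \<le> loops ys r"
          unfolding loops_def by (intro member_le_sum[of _ _ "\<lambda>k. of_bool (ys ! k = r)"]) auto
        then have "1 \<le> loops ys r" using True by (simp add: par_def)
        then have "2 * real m * 1 \<le> 2 * real m * loops ys r" by (intro mult_left_mono) auto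
        moreover have "A ys = 1" "P ys = 0" using True by (auto simp: A_def P_def)
        ultimately show ?thesis using d2 by simp
      next
        case False
        then have "A ys = P ys" by (simp add: A_def P_def)
        moreover have "P ys = 0 \<or> P ys = 1" by (simp add: P_def)
        moreover have "1 * loops ys r \<le> 2 * real m * loops ys r" using m2 s0 by (intro mult_right_mono) auto
        ultimately show ?thesis using d s0 by (auto simp: wt_def)
      qed
    qed
    also have "\<dots> = (real m + \<delta>) * E (m * r) P + 2 * real m * E (m * r) (\<lambda>ys. loops ys r)"
      unfolding E_add E_cmult ..
    also have "\<dots> \<le> (real m + \<delta>) * b + 2 * real m * (K0 / real r)"
    proof (intro add_mono mult_left_mono)
      have "E (m * r) P = bad_wt G j (r - 1) / cc (m * (r - 1))" unfolding P_def by (rule E_par_bad[OF r(1)])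
      also have "\<dots> \<le> b * (real (r - 1) * DD) / cc (m * (r - 1))"
        using b cc_pos[of "m * (r - 1)"] by (intro divide_right_mono) auto
      also have "\<dots> \<le> b * cc (m * (r - 1)) / cc (m * (r - 1))"
      proof (intro divide_right_mono mult_left_mono)
        show "real (r - 1) * DD \<le> cc (m * (r - 1))"
          unfolding cc_eq DD(2) of_nat_mult using rho by (simp add: mult_ac)
      qed (use b cc_pos[of "m * (r - 1)"] in auto)
      also have "\<dots> = b" using cc_pos[of "m * (r - 1)"] by simp
      finally show "E (m * r) P \<le> b" .
      show "E (m * r) (\<lambda>ys. loops ys r) \<le> K0 / real r" using r by (intro E_loops)
    qed (use delta_gt in auto)
    finally show "E (m * r) (\<lambda>xs. wt xs r * A xs) \<le> (real m + \<delta>) * b + 2 * real m * (K0 / real r)" .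
  qed (use growth_pos[of "m * r" "m * n"] in auto)
  finally show ?thesis .
qed

text \<open>The bad vertices up to \<open>s\<close> have total weight at most \<open>G * s\<close>. A later vertex is bad only if its first
  edge hits a bad vertex (or itself), which has probability at most \<open>b\<close>; this gains the factor by which
  the total weight of the vertices after \<open>s\<close> falls short of the weight of the whole graph.\<close>

lemma bad_wt_step:
  assumes s: "1 \<le> s" "s \<le> n" and b: "b \<ge> 0" "\<And>r. s \<le> r \<Longrightarrow> r < n \<Longrightarrow> bad_wt G j r \<le> b * (real r * DD)"
  shows "bad_wt G (Suc j) n \<le> real G * real s + b * (real n * DD - growth (m * s) (m * n) * (real s * DD))
     + 2 * real m * K0 * (real n / real s)\<^sup>2"
proof -
  have split: "{1..n} = {1..s} \<union> {s + 1..n}" "{1..s} \<inter> {s + 1..n} = {}" using s by auto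
  have "bad_wt G (Suc j) n = (\<Sum>v\<in>{1..n}. E (m * n) (\<lambda>xs. wt xs v * of_bool (bad G (Suc j) xs v)))"
    unfolding bad_wt_def E_sum ..
  also have "\<dots> = (\<Sum>v\<in>{1..s}. E (m * n) (\<lambda>xs. wt xs v * of_bool (bad G (Suc j) xs v)))
      + (\<Sum>v\<in>{s + 1..n}. E (m * n) (\<lambda>xs. wt xs v * of_bool (bad G (Suc j) xs v)))"
    unfolding split(1) using split(2) by (subst sum.union_disjoint) auto
  also have "\<dots> \<le> (\<Sum>v\<in>{1..s}. real G) + (\<Sum>r\<in>{s + 1..n}. b * E (m * n) (\<lambda>xs. wt xs r) + 2 * real m * K0 * (real n / (real s)\<^sup>2))"
  proof (intro add_mono sum_mono)
    fix v
    have "E (m * n) (\<lambda>xs. wt xs v * of_bool (bad G (Suc j) xs v)) \<le> E (m * n) (\<lambda>_. real G)"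
    proof (intro E_mono)
      fix xs
      show "wt xs v * of_bool (bad G (Suc j) xs v) \<le> real G"
        using bad_deg[of G "Suc j" xs v] delta_neg by (auto simp: wt_def of_bool_def)
    qed
    then show "E (m * n) (\<lambda>xs. wt xs v * of_bool (bad G (Suc j) xs v)) \<le> real G" by (simp add: E_const)
  next
    fix r assume r: "r \<in> {s + 1..n}"
    then have r2: "r \<ge> 2" "r \<le> n" using s by auto
    define g where "g = growth (m * r) (m * n)"
    have g0: "g > 0" by (simp add: g_def growth_pos)
    have "E (m * n) (\<lambda>xs. wt xs r * of_bool (bad G (Suc j) xs r)) \<le> g * ((real m + \<delta>) * b + 2 * real m * (K0 / real r))"
      unfolding g_def using r r2 by (intro bad_vertex_bound b) auto
    also have "\<dots> = b * (g * (real m + \<delta>)) + 2 * real m * K0 * (g * (1 / real r))" by (simp add: algebra_simps)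
    also have "\<dots> \<le> b * E (m * n) (\<lambda>xs. wt xs r) + 2 * real m * K0 * (real n / (real s)\<^sup>2)"
    proof (intro add_mono mult_left_mono)
      have "E (m * n) (\<lambda>xs. wt xs r) = g * E (m * r) (\<lambda>xs. wt xs r)"
        using E_wt[of r "m * r" "m * n" "\<lambda>_. 1"] r2 by (simp add: g_def)
      moreover have "E (m * r) (\<lambda>xs. wt xs r) \<ge> E (m * r) (\<lambda>xs. real m + \<delta>)"
      proof (intro E_mono wt_ge)
        fix xs assume "valid (m * r) xs"
        then have "length xs = m * r" using pa_valid_length by blast
        then show "r < src (length xs)" using src_gt_iff[of r "m * r"] by simp
      qed (use r2 in auto)
      ultimately show "g * (real m + \<delta>) \<le> E (m * n) (\<lambda>xs. wt xs r)"
        using g0 by (simp add: E_const)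
      have rs: "real s \<le> real r" "real s \<ge> 1" "real r \<le> real n" using r s by auto
      \<comment> \<open>The self-loop error of each vertex is of order \<open>n / s ^ 2\<close>, so
        at most \<open>n\<close> of them add up to a constant when \<open>s\<close> is a fixed
        fraction of \<open>n\<close>.\<close>
      have "g \<le> (real (m * n) / real (m * r)) powr \<gamma>"
        unfolding g_def using r2 m_pos by (intro growth_le) auto
      also have "\<dots> = (real n / real r) powr \<gamma>" using m_pos by simp
      also have "\<dots> \<le> (real n / real r) powr 1" using rs chi by (intro powr_mono) auto
      also have "\<dots> = real n / real r" using rs by simp
      also have "\<dots> \<le> real n / real s" using rs by (intro divide_left_mono) auto
      finally have "g \<le> real n / real s" .
      then have "g * (1 / real r) \<le> real n / real s * (1 / real s)"
        using rs g0 by (intro mult_mono divide_left_mono) auto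
      then show "g * (1 / real r) \<le> real n / (real s)\<^sup>2" by (simp add: power2_eq_square)
    qed (use b K0_pos in auto)
    finally show "E (m * n) (\<lambda>xs. wt xs r * of_bool (bad G (Suc j) xs r)) \<le> b * E (m * n) (\<lambda>xs. wt xs r) + 2 * real m * K0 * (real n / (real s)\<^sup>2)" .
  qed
  also have "\<dots> = real G * real s + b * (\<Sum>r\<in>{s + 1..n}. E (m * n) (\<lambda>xs. wt xs r)) + real (n - s) * (2 * real m * K0 * (real n / (real s)\<^sup>2))"
    by (simp add: sum.distrib sum_distrib_left)
  also have "(\<Sum>r\<in>{s + 1..n}. E (m * n) (\<lambda>xs. wt xs r)) = real n * DD - growth (m * s) (m * n) * (real s * DD)"
  proof -
    have "(\<Sum>r\<in>{1..n}. E (m * n) (\<lambda>xs. wt xs r)) = real n * DD"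
      using E_vol[of n "m * n"] by (simp add: vol_def[abs_def] E_sum growth_def)
    moreover have "(\<Sum>r\<in>{1..s}. E (m * n) (\<lambda>xs. wt xs r)) = growth (m * s) (m * n) * (real s * DD)"
      using E_vol[of s "m * n"] s by (simp add: vol_def[abs_def] E_sum)
    moreover have "(\<Sum>r\<in>{1..n}. E (m * n) (\<lambda>xs. wt xs r)) = (\<Sum>r\<in>{1..s}. E (m * n) (\<lambda>xs. wt xs r)) + (\<Sum>r\<in>{s + 1..n}. E (m * n) (\<lambda>xs. wt xs r))"
      unfolding split(1) using split(2) by (subst sum.union_disjoint) auto
    ultimately show ?thesis by simp
  qed
  also have "real (n - s) * (2 * real m * K0 * (real n / (real s)\<^sup>2)) \<le> real n * (2 * real m * K0 * (real n / (real s)\<^sup>2))"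
    using K0_pos by (intro mult_right_mono) auto
  also have "real n * (2 * real m * K0 * (real n / (real s)\<^sup>2)) = 2 * real m * K0 * (real n / real s)\<^sup>2"
    by (simp add: power2_eq_square)
  finally show ?thesis by simp
qed

lemma bad_wt_0_le: "bad_wt G 0 n \<le> real n * DD"
proof -
  have "bad_wt G 0 n \<le> E (m * n) (\<lambda>xs. vol xs n)"
    unfolding bad_wt_def vol_def
  proof (intro E_mono sum_mono)
    fix xs v assume va: "valid (m * n) xs" and v: "v \<in> {1..n}"
    have "length xs = m * n" using va pa_valid_length by blast
    moreover have "v < src (m * n)" using src_gt_iff[of v "m * n"] v by simp
    ultimately have "wt xs v > 0" using v by (intro wt_pos) auto
    then show "wt xs v * of_bool (bad G 0 xs v) \<le> wt xs v" by (simp add: of_bool_def)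
  qed
  then show ?thesis using E_vol[of n "m * n"] by (simp add: growth_def)
qed

text \<open>With \<open>s = n div L\<close>, \<open>bad_wt_step\<close> becomes the contraction
  \<open>b -> (1 - p) * b + p * \<Phi>\<close>. The oldest \<open>n / L\<close> vertices carry at
  least the share \<open>p\<close>, of order \<open>L powr (\<gamma> - 1)\<close>, of the total
  weight and cost order \<open>G / L\<close>. The fixed point \<open>\<Phi>\<close> is thus of order
  \<open>L powr (- \<gamma>)\<close>, small for large \<open>L\<close>, and finitely many iterations
  come close to it.\<close>

lemma few_bad_vertices:
  fixes \<epsilon> :: real
  assumes G: "G \<ge> 1" and eps: "\<epsilon> > 0"
  shows "\<exists>J n0. \<forall>n\<ge>n0. E (m * n) (\<lambda>xs. \<Sum>v\<in>{1..n}. of_bool (bad G J xs v)) \<le> \<epsilon> * real n"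
proof -
  have DD0: "DD > 0" using DD m_pos by (simp add: less_trans[of 0 "real m"])
  define e where "e = \<epsilon> * (real m + \<delta>) / DD"
  have e: "e > 0" using eps delta_gt DD0 by (simp add: e_def)
  have "((\<lambda>L. 2 * real G / (real L * DD) / ((2 * real L) powr (\<gamma> - 1) / 2)) \<longlonglongrightarrow> 0)"
  proof -
    have "((\<lambda>L. 4 * real G / DD * (2 powr (1 - \<gamma>) * real L powr (- \<gamma>))) \<longlonglongrightarrow> 4 * real G / DD * (2 powr (1 - \<gamma>) * 0))"
    proof (intro tendsto_intros)
      show "(\<lambda>L. real L powr (- \<gamma>)) \<longlonglongrightarrow> 0" using chi by real_asymp
    qed
    moreover have "eventually (\<lambda>L. 4 * real G / DD * (2 powr (1 - \<gamma>) * real L powr (- \<gamma>)) = 2 * real G / (real L * DD) / ((2 * real L) powr (\<gamma> - 1) / 2)) sequentially"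
      using eventually_gt_at_top[of 0]
    proof eventually_elim
      case (elim L)
      have "real L powr (- \<gamma>) = 1 / (real L * real L powr (\<gamma> - 1))"
        using elim by (simp add: powr_minus_divide powr_diff)
      moreover have "2 powr (1 - \<gamma>) = 1 / 2 powr (\<gamma> - 1)" by (metis minus_diff_eq powr_minus_divide)
      ultimately show ?case using elim DD0 by (simp add: powr_mult field_simps)
    qed
    ultimately show ?thesis by (simp add: tendsto_cong)
  qed
  then have "eventually (\<lambda>L. 2 * real G / (real L * DD) / ((2 * real L) powr (\<gamma> - 1) / 2) < e / 2) sequentially"
    using e by (intro order_tendstoD) auto
  then have "eventually (\<lambda>L. L \<ge> 1 \<and> 2 * real G / (real L * DD) / ((2 * real L) powr (\<gamma> - 1) / 2) < e / 2) sequentially"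
    using eventually_ge_at_top[of 1] by eventually_elim auto
  then obtain L where L: "L \<ge> 1" and Le: "2 * real G / (real L * DD) / ((2 * real L) powr (\<gamma> - 1) / 2) < e / 2"
    using eventually_happens'[OF sequentially_bot] by blast
  \<comment> \<open>The 2 inside the power allows for rounding in \<open>n / s \<le> 2 * L\<close>;
    the division by 2 comes from \<open>growth_ge\<close>.\<close>
  define p where "p = (2 * real L) powr (\<gamma> - 1) / 2"
  have p: "0 < p" "p \<le> 1 / 2"
  proof -
    show "0 < p" using L by (simp add: p_def)
    have "(2 * real L) powr (\<gamma> - 1) \<le> (2 * real L) powr 0" using L chi by (intro powr_mono) auto
    then show "p \<le> 1 / 2" using L by (simp add: p_def)
  qed
  define \<Phi> where "\<Phi> = 2 * real G / (real L * DD) / p"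
  have Phi: "\<Phi> < e / 2" "\<Phi> \<ge> 0" "\<Phi> * p = 2 * real G / (real L * DD)"
    using Le p DD0 by (auto simp: \<Phi>_def p_def)
  have claim: "\<exists>n0. \<forall>n\<ge>n0. bad_wt G j n \<le> ((1 - p) ^ j + \<Phi>) * (real n * DD)" for j
  proof (induction j)
    case 0
    have "bad_wt G 0 n \<le> ((1 - p) ^ 0 + \<Phi>) * (real n * DD)" for n
    proof -
      have "1 * (real n * DD) \<le> (1 + \<Phi>) * (real n * DD)" using Phi DD0 by (intro mult_right_mono) auto
      then show ?thesis using bad_wt_0_le[of G n] by simp
    qed
    then show ?case by blast
  next
    case (Suc j)
    then obtain n0 where n0: "\<And>n. n \<ge> n0 \<Longrightarrow> bad_wt G j n \<le> ((1 - p) ^ j + \<Phi>) * (real n * DD)" by blast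
    define b where "b = (1 - p) ^ j + \<Phi>"
    have b: "b \<ge> 0" using p Phi by (simp add: b_def)
    define C where "C = 2 * real m * K0 * (2 * real L)\<^sup>2"
    \<comment> \<open>Beyond \<open>n1\<close> the constant self-loop error is at most a second copy
      of \<open>G * n / L\<close>; hence the 2 in \<open>\<Phi>\<close>.\<close>
    obtain n1 :: nat where n1: "real n1 \<ge> C * real L / real G" using real_arch_simple by blast
    show ?case
    proof (intro exI[of _ "max (max (L * n0) (2 * L)) n1"] allI impI)
      fix n assume n: "n \<ge> max (max (L * n0) (2 * L)) n1"
      define s where "s = n div L"
      have L0: "L > 0" using L by simp
      have s0: "s \<ge> n0" "s \<ge> 2"
        using n L0 by (auto simp: s_def less_eq_div_iff_mult_less_eq mult.commute)
      have sL: "real s * real L \<le> real n" 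
        by (metis div_times_less_eq_dividend of_nat_le_iff of_nat_mult s_def)
      have "n < (s + 1) * L" using L0 dividend_less_div_times[of L n] by (simp add: s_def)
      also have "\<dots> \<le> (2 * s) * L" using s0 by (intro mult_right_mono) auto
      finally have "real n < real ((2 * s) * L)" by (simp only: of_nat_less_iff)
      then have sn: "real n \<le> 2 * real L * real s" by (simp add: mult_ac)
      have sn1: "s \<le> n" by (simp add: s_def)
      have s1: "real s \<ge> 1" using s0 by simp
      have nr: "real n > 0" using s1 sn1 by linarith
      have n_s: "real n / real s \<le> 2 * real L" using sn s1 by (simp add: field_simps)
      have "bad_wt G (Suc j) n \<le> real G * real s + b * (real n * DD - growth (m * s) (m * n) * (real s * DD))
         + 2 * real m * K0 * (real n / real s)\<^sup>2"
        using s0 sn1 b n0 by (intro bad_wt_step) (auto simp: b_def)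
      also have "\<dots> \<le> real G * (real n / real L) + b * ((1 - p) * (real n * DD)) + C"
      proof (intro add_mono mult_left_mono)
        show "real s \<le> real n / real L" using sL L by (simp add: field_simps)
        show "real n * DD - growth (m * s) (m * n) * (real s * DD) \<le> (1 - p) * (real n * DD)"
        proof -
          have "growth (m * s) (m * n) \<ge> (real (m * n) / real (m * s)) powr \<gamma> / 2"
            using s0 sn1 m_pos by (intro growth_ge) auto
          then have g: "growth (m * s) (m * n) \<ge> (real n / real s) powr \<gamma> / 2" using m_pos by simp
          have "p * real n \<le> (real n / real s) powr (\<gamma> - 1) / 2 * real n"
            unfolding p_def using n_s s1 nr chi by (intro mult_right_mono divide_right_mono powr_mono2') auto
          also have "(real n / real s) powr (\<gamma> - 1) * real n = (real n / real s) powr \<gamma> * real s"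
            using nr s1 by (simp add: powr_diff)
          then have "(real n / real s) powr (\<gamma> - 1) / 2 * real n = (real n / real s) powr \<gamma> / 2 * real s" by simp
          also have "\<dots> \<le> growth (m * s) (m * n) * real s" using g by (intro mult_right_mono) auto
          finally have "p * real n * DD \<le> growth (m * s) (m * n) * real s * DD" using DD0 by (intro mult_right_mono) auto
          then show ?thesis by (simp add: algebra_simps)
        qed
        show "2 * real m * K0 * (real n / real s)\<^sup>2 \<le> C"
          unfolding C_def using n_s K0_pos s1 nr by (intro mult_left_mono power_mono) auto
      qed (use b in auto)
      also have "C \<le> real G * (real n / real L)"
      proof -
        have "real n \<ge> C * real L / real G" using n n1 by (meson max.bounded_iff of_nat_le_iff order_trans)
        then show ?thesis using G L by (simp add: field_simps)
      qed
      also have "real G * (real n / real L) + b * ((1 - p) * (real n * DD)) + real G * (real n / real L)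
         = (2 * real G / (real L * DD) + b * (1 - p)) * (real n * DD)"
        using DD0 L by (simp add: field_simps)
      also have "2 * real G / (real L * DD) + b * (1 - p) = (1 - p) ^ Suc j + \<Phi>"
        unfolding Phi(3)[symmetric] b_def by (simp add: algebra_simps)
      finally show "bad_wt G (Suc j) n \<le> ((1 - p) ^ Suc j + \<Phi>) * (real n * DD)" by simp
    qed
  qed
  obtain J where J: "(1 - p) ^ J < e / 2"
    using real_arch_pow_inv[of "e / 2" "1 - p"] e p by auto
  obtain n0 where n0: "\<And>n. n \<ge> n0 \<Longrightarrow> bad_wt G J n \<le> ((1 - p) ^ J + \<Phi>) * (real n * DD)" using claim by blast
  have "E (m * n) (\<lambda>xs. \<Sum>v\<in>{1..n}. of_bool (bad G J xs v)) \<le> \<epsilon> * real n" if "n \<ge> n0" for n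
  proof -
    have md: "real m + \<delta> > 0" using delta_gt by simp
    \<comment> \<open>Each vertex weighs at least \<open>m + \<delta>\<close>, so little bad weight
      means few bad vertices.\<close>
    have "(real m + \<delta>) * E (m * n) (\<lambda>xs. \<Sum>v\<in>{1..n}. of_bool (bad G J xs v)) \<le> bad_wt G J n"
      unfolding bad_wt_def E_cmult[symmetric] sum_distrib_left
    proof (intro E_mono sum_mono mult_right_mono wt_ge)
      fix xs v assume va: "valid (m * n) xs" and v: "v \<in> {1..n}"
      have "length xs = m * n" using va pa_valid_length by blast
      then show "v < src (length xs)" "1 \<le> v" using src_gt_iff[of v "m * n"] v by auto
    qed auto
    also have "\<dots> \<le> ((1 - p) ^ J + \<Phi>) * (real n * DD)" using that by (rule n0)
    also have "\<dots> \<le> e * (real n * DD)" using J Phi DD0 by (intro mult_right_mono) auto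
    also have "\<dots> = (real m + \<delta>) * (\<epsilon> * real n)" using DD0 by (simp add: e_def)
    finally show ?thesis using md by simp
  qed
  then show ?thesis by blast
qed

end

section \<open>Walks and the steps of the climb\<close>

lemma walk_mono:
  assumes "walk_of_len adj u v k" "\<And>a b. adj a b \<Longrightarrow> adj' a b"
  shows "walk_of_len adj' u v k"
  using assms unfolding walk_of_len_def by blast

lemma walk_append:
  assumes "walk_of_len adj u v k" "walk_of_len adj v w l"
  shows "walk_of_len adj u w (k + l)"
proof -
  obtain f where f: "f 0 = u" "f k = v" "\<forall>i<k. adj (f i) (f (Suc i))"
    using assms(1) by (auto simp: walk_of_len_def)
  obtain g where g: "g 0 = v" "g l = w" "\<forall>i<l. adj (g i) (g (Suc i))"
    using assms(2) by (auto simp: walk_of_len_def)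
  define h where "h i = (if i \<le> k then f i else g (i - k))" for i
  have "adj (h i) (h (Suc i))" if i: "i < k + l" for i
  proof -
    consider "i < k" | "i = k" | "i > k" by linarith
    then show ?thesis
    proof cases
      case 1
      then show ?thesis using f by (simp add: h_def)
    next
      case 2
      then have e: "h i = g 0" "h (Suc i) = g (Suc 0)" using f g by (auto simp: h_def)
      have "0 < l" using i 2 by simp
      then have "adj (g 0) (g (Suc 0))" using g(3) by blast
      then show ?thesis by (simp only: e)
    next
      case 3
      then have "h i = g (i - k)" "h (Suc i) = g (Suc (i - k))" by (auto simp: h_def Suc_diff_le)
      then show ?thesis using g i 3 by simp
    qed
  qed
  moreover have "h 0 = u" using f by (simp add: h_def)
  moreover have "h (k + l) = w" using f g by (cases "l = 0") (auto simp: h_def)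
  ultimately show ?thesis unfolding walk_of_len_def by blast
qed

lemma walk_edge: "adj u v \<Longrightarrow> walk_of_len adj u v 1"
  unfolding walk_of_len_def by (intro exI[of _ "\<lambda>i. if i = 0 then u else v"]) auto

lemma walk_refl: "walk_of_len adj u u 0"
  unfolding walk_of_len_def by auto

lemma walk_rev:
  assumes "walk_of_len adj u v k" "\<And>a b. adj a b \<Longrightarrow> adj b a"
  shows "walk_of_len adj v u k"
proof -
  obtain f where f: "f 0 = u" "f k = v" "\<forall>i<k. adj (f i) (f (Suc i))"
    using assms(1) by (auto simp: walk_of_len_def)
  have "adj (f (k - i)) (f (k - Suc i))" if "i < k" for i
  proof -
    have "adj (f (k - Suc i)) (f (Suc (k - Suc i)))" using f that by simp
    moreover have "Suc (k - Suc i) = k - i" using that by simp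
    ultimately show ?thesis using assms(2) by simp
  qed
  then show ?thesis using f unfolding walk_of_len_def by (intro exI[of _ "\<lambda>i. f (k - i)"]) auto
qed

context pref_att
begin

definition near :: "nat list \<Rightarrow> nat \<Rightarrow> nat \<Rightarrow> nat \<Rightarrow> bool" where
  "near xs u w d \<longleftrightarrow> (\<exists>k\<le>d. walk_of_len (pa_adj m xs) u w k)"

lemma near_append: "near xs u w d \<Longrightarrow> near (xs @ ys) u w d"
  unfolding near_def by (meson pa_adj_append walk_mono)

lemma near_take: "near (take n xs) u w d \<Longrightarrow> near xs u w d"
  using near_append[of "take n xs" u w d "drop n xs"] by simp

lemma near_trans: "near xs u v d \<Longrightarrow> near xs v w e \<Longrightarrow> near xs u w (d + e)"
  unfolding near_def by (meson add_mono walk_append)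

lemma near_edge: "pa_adj m xs u v \<Longrightarrow> near xs u v 1"
  unfolding near_def using walk_edge[of "pa_adj m xs" u v] by (intro exI[of _ 1]) simp

lemma near_sym: "near xs u v d \<Longrightarrow> near xs v u d"
  unfolding near_def using walk_rev[of "pa_adj m xs" u v] pa_adj_sym[of xs] by blast

lemma adj_of_entry: "k < length xs \<Longrightarrow> pa_adj m xs (src k) (xs ! k)"
  unfolding pa_adj_def by blast

lemma not_bad_near:
  assumes va: "valid (m * n) xs" and v: "v \<in> {1..n}" and nb: "\<not> bad G J xs v"
  shows "\<exists>w\<in>{1..n}. near xs v w J \<and> G \<le> dg xs w"
  using v nb
proof (induction J arbitrary: v)
  case 0
  then show ?case using walk_refl unfolding near_def by (intro bexI[of _ v]) auto
next
  case (Suc j)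
  show ?case
  proof (cases "G \<le> dg xs v")
    case True
    then show ?thesis using walk_refl[of "pa_adj m xs" v] Suc.prems unfolding near_def by (intro bexI[of _ v]) (auto intro!: exI[of _ 0])
  next
    case False
    then have nb: "\<not> bad G j xs (par xs v)" using Suc.prems by simp
    have p: "par xs v \<in> {1..v}" using va Suc.prems by (intro par_valid) auto
    then have pn: "par xs v \<in> {1..n}" using Suc.prems by auto
    obtain w where w: "w \<in> {1..n}" "near xs (par xs v) w j" "G \<le> dg xs w" using Suc.IH[OF pn nb] by blast
    have l: "length xs = m * n" using va pa_valid_length by blast
    have k: "m * (v - 1) < m * v" using Suc.prems m_pos by simp
    have "m * v \<le> m * n" using Suc.prems by simp
    then have "pa_adj m xs (src (m * (v - 1))) (xs ! (m * (v - 1)))" using k l by (intro adj_of_entry) linarith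
    moreover have "src (m * (v - 1)) = v" using src_block[of "m * (v - 1)" v] k Suc.prems by auto
    ultimately have "pa_adj m xs v (par xs v)" by (simp add: par_def)
    then have "near xs v w (1 + j)" using near_trans[OF near_edge w(2)] by blast
    then show ?thesis using w by auto
  qed
qed

text \<open>The bound \<open>S\<close> forces the vertex reached to be old; for \<open>S = 1\<close>
  it is vertex 1.\<close>

definition climbed :: "nat list \<Rightarrow> nat \<Rightarrow> nat \<Rightarrow> real \<Rightarrow> nat \<Rightarrow> bool" where
  "climbed xs v d h S \<longleftrightarrow> (\<exists>w\<in>{1..S}. near xs v w d \<and> h \<le> real (dg xs w))"

text \<open>The young vertex \<open>c + 1\<close> tries to send its first edge to \<open>w\<close>
  and its second into \<open>T\<close>. Both normalisations are replaced by the final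
  \<open>cc (m * t)\<close>, which makes the bound the same for every vertex of a window.\<close>

lemma connect_prob:
  assumes va: "valid n xs" and n: "n = m * c" and w: "w \<in> {1..c}" and T: "T \<subseteq> {1..c}" and ct: "Suc c \<le> t"
    and x: "x \<le> wt xs w" "0 \<le> x" and Y: "Y \<le> (\<Sum>v\<in>T. wt xs v)" "0 \<le> Y"
  shows "(\<Sum>v\<in>{1..src n}. q xs v * (\<Sum>v'\<in>{1..src (Suc n)}. q (xs @ [v]) v' * of_bool (\<not> (v = w \<and> v' \<in> T))))
    \<le> exp (- (x * Y / (cc (m * t))\<^sup>2))"
proof -
  have l: "length xs = n" using va pa_valid_length by blast
  have s1: "src n = Suc c" using n m_pos by (simp add: pa_src_def)
  have s2: "src (Suc n) = Suc c" using n m2 by (simp add: pa_src_def div_m_iff)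
  have nt: "Suc n \<le> m * t"
  proof -
    have "Suc n \<le> m * Suc c" using n m_pos by simp
    also have "\<dots> \<le> m * t" using ct by (intro mult_le_mono2)
    finally show ?thesis .
  qed
  define z where "z = xs @ [w]"
  define p2 where "p2 = (\<Sum>v'\<in>T. q z v')"
  have wr: "w \<in> {1..src n}" using w s1 by auto
  have vz: "valid (Suc n) z" using va wr by (simp add: z_def)
  have finT: "finite T" using T finite_subset by blast
  have inner: "(\<Sum>v'\<in>{1..src (Suc n)}. q (xs @ [v]) v' * of_bool (\<not> (v = w \<and> v' \<in> T))) = (if v = w then 1 - p2 else 1)"
    if v: "v \<in> {1..src n}" for v
  proof (cases "v = w")
    case False
    have "valid (Suc n) (xs @ [v])" using va v by simp
    then show ?thesis using False sum_q[of "Suc n" "xs @ [v]"] by simp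
  next
    case True
    have T2: "{1..src (Suc n)} \<inter> T = T" using T s2 by auto
    have "(\<Sum>v'\<in>{1..src (Suc n)}. q z v' * of_bool (v' \<notin> T)) = (\<Sum>v'\<in>{1..src (Suc n)}. q z v' - (if v' \<in> T then q z v' else 0))"
      by (intro sum.cong) auto
    also have "\<dots> = 1 - (\<Sum>v'\<in>{1..src (Suc n)}. if v' \<in> T then q z v' else 0)"
      using sum_q[OF vz] by (simp add: sum_subtractf)
    also have "(\<Sum>v'\<in>{1..src (Suc n)}. if v' \<in> T then q z v' else 0) = p2"
      unfolding p2_def using sum.inter_restrict[of "{1..src (Suc n)}" "q z" T] T2 by simp
    finally show ?thesis using True by (simp add: z_def)
  qed
  have "(\<Sum>v\<in>{1..src n}. q xs v * (\<Sum>v'\<in>{1..src (Suc n)}. q (xs @ [v]) v' * of_bool (\<not> (v = w \<and> v' \<in> T))))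
     = (\<Sum>v\<in>{1..src n}. q xs v - (if v = w then q xs w * p2 else 0))"
  proof (intro sum.cong refl)
    fix v assume v: "v \<in> {1..src n}"
    show "q xs v * (\<Sum>v'\<in>{1..src (Suc n)}. q (xs @ [v]) v' * of_bool (\<not> (v = w \<and> v' \<in> T))) = q xs v - (if v = w then q xs w * p2 else 0)"
      unfolding inner[OF v] by (simp add: algebra_simps)
  qed
  also have "\<dots> = 1 - q xs w * p2" using sum_q[OF va] wr by (simp add: sum_subtractf)
  also have "\<dots> \<le> 1 - (x / cc (m * t)) * (Y / cc (m * t))"
  proof -
    have q1: "q xs w = wt xs w / cc n" using q_old[of w xs] w s1 l by simp
    have a: "x / cc (m * t) \<le> q xs w"
      unfolding q1 using x cc_pos mono_cc[of n "m * t"] nt by (intro frac_le) auto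
    have "p2 = (\<Sum>v'\<in>T. wt z v' / cc (Suc n))"
      unfolding p2_def
    proof (intro sum.cong refl)
      fix v' assume "v' \<in> T"
      then show "q z v' = wt z v' / cc (Suc n)" using T s2 l q_old[of v' z] by (auto simp: z_def)
    qed
    then have p2: "p2 = (\<Sum>v'\<in>T. wt z v') / cc (Suc n)" by (simp add: sum_divide_distrib)
    have "Y \<le> (\<Sum>v'\<in>T. wt z v')" using Y sum_mono[of T "wt xs" "wt z"] wt_mono by (fastforce simp: z_def)
    then have b: "Y / cc (m * t) \<le> p2"
      unfolding p2 using Y cc_pos mono_cc[of "Suc n" "m * t"] nt by (intro frac_le) auto
    have "x / cc (m * t) * (Y / cc (m * t)) \<le> q xs w * p2"
      using a b x Y cc_pos[of "m * t"] q_nonneg[of xs w] by (intro mult_mono) auto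
    then show ?thesis by simp
  qed
  also have "\<dots> = 1 + - (x * Y / (cc (m * t))\<^sup>2)" by (simp add: power2_eq_square)
  also have "\<dots> \<le> exp (- (x * Y / (cc (m * t))\<^sup>2))" by (rule exp_ge_add_one_self)
  finally show ?thesis .
qed

text \<open>The source \<open>wsel\<close> is fixed at time \<open>a\<close> and the target set
  \<open>T\<close> at time \<open>t0\<close>, both before the window begins. Given them, each of the
  \<open>M\<close> vertices of the window fails to connect with conditional probability at most
  \<open>exp (- p)\<close>.\<close>

lemma climb_step:
  assumes a: "S \<le> a" "S' \<le> t0" "t0 \<le> a" "a + M \<le> t" and h: "0 \<le> h + \<delta>" "0 \<le> h'"
    and V: "\<And>zs. valid (m * t0) zs \<Longrightarrow> V zs \<Longrightarrow> vol zs S' \<ge> 2 * (real S' * h')"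
  shows "E (m * (a + M)) (\<lambda>xs. of_bool (V (take (m * t0) xs) \<and> climbed (take (m * a) xs) v0 d h S \<and> \<not> climbed xs v0 (d + 2) h' S'))
    \<le> exp (- (real M * ((h + \<delta>) * (real S' * h') / (cc (m * t))\<^sup>2)))"
proof -
  define p where "p = (h + \<delta>) * (real S' * h') / (cc (m * t))\<^sup>2"
  define wsel where "wsel ys = (SOME w. w \<in> {1..S} \<and> near ys v0 w d \<and> h \<le> real (dg ys w))" for ys
  define T where "T ys = {v\<in>{1..S'}. h' \<le> real (dg (take (m * t0) ys) v)}" for ys
  define A where "A ys = (of_bool (V (take (m * t0) ys) \<and> climbed ys v0 d h S) :: real)" for ys
  define conn where "conn i xs \<longleftrightarrow> (\<exists>s\<in>{a..<a + i}. xs ! (m * s) = wsel (take (m * a) xs) \<and> xs ! Suc (m * s) \<in> T (take (m * a) xs))" for i xs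
  have wsel: "wsel ys \<in> {1..S} \<and> near ys v0 (wsel ys) d \<and> h \<le> real (dg ys (wsel ys))" if "climbed ys v0 d h S" for ys
    using someI_ex[of "\<lambda>w. w \<in> {1..S} \<and> near ys v0 w d \<and> h \<le> real (dg ys w)"] that
    unfolding wsel_def climbed_def by blast
  have H: "E (m * (a + i)) (\<lambda>xs. A (take (m * a) xs) * of_bool (\<not> conn i xs)) \<le> exp (- (real i * p))" if "i \<le> M" for i
    using that
  proof (induction i)
    case 0
    have "E (m * (a + 0)) (\<lambda>xs. A (take (m * a) xs) * of_bool (\<not> conn 0 xs)) \<le> E (m * (a + 0)) (\<lambda>_. 1)"
      by (intro E_mono) (auto simp: A_def)
    then show ?case by (simp add: E_const)
  next
    case (Suc i)
    define n where "n = m * (a + i)"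
    define f where "f xs = A (take (m * a) xs) * of_bool (\<not> conn (Suc i) xs)" for xs
    have n2: "Suc (Suc n) \<le> m * (a + Suc i)" using m2 by (simp add: n_def)
    have man: "m * a \<le> n" by (simp add: n_def)
    have f_take: "f (take (Suc (Suc n)) xs) = f xs" for xs
    proof -
      have "take (m * a) (take (Suc (Suc n)) xs) = take (m * a) xs" using man by (simp add: min_def)
      moreover have "take (Suc (Suc n)) xs ! (m * s) = xs ! (m * s) \<and> take (Suc (Suc n)) xs ! Suc (m * s) = xs ! Suc (m * s)"
        if "s \<in> {a..<a + Suc i}" for s
      proof -
        have "m * s \<le> n" using that unfolding n_def by (intro mult_le_mono2) auto
        then show ?thesis by simp
      qed
      ultimately have "conn (Suc i) (take (Suc (Suc n)) xs) = conn (Suc i) xs"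
        unfolding conn_def by (intro bex_cong refl) simp
      then show ?thesis using man by (simp add: f_def min_def)
    qed
    have "E (m * (a + Suc i)) f = E (m * (a + Suc i)) (\<lambda>xs. f (take (Suc (Suc n)) xs))"
      by (simp add: f_take)
    also have "\<dots> = E (Suc (Suc n)) f" using n2 by (rule E_take)
    also have "\<dots> = E n (\<lambda>xs. \<Sum>v\<in>{1..src n}. q xs v * (\<Sum>v'\<in>{1..src (Suc n)}. q (xs @ [v]) v' * f ((xs @ [v]) @ [v'])))"
      unfolding E_Suc ..
    also have "\<dots> \<le> E n (\<lambda>xs. exp (- p) * (A (take (m * a) xs) * of_bool (\<not> conn i xs)))"
    proof (intro E_mono)
      fix xs assume va: "valid n xs"
      have l: "length xs = n" using va pa_valid_length by blast
      define ys where "ys = take (m * a) xs"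
      define c where "c = A ys * of_bool (\<not> conn i xs)"
      have fe: "f ((xs @ [v]) @ [v']) = c * of_bool (\<not> (v = wsel ys \<and> v' \<in> T ys))" for v v'
      proof -
        define us where "us = (xs @ [v]) @ [v']"
        have t1: "take (m * a) us = ys" using man l by (simp add: us_def ys_def)
        have "conn (Suc i) us \<longleftrightarrow> conn i xs \<or> (v = wsel ys \<and> v' \<in> T ys)"
        proof -
          have e1: "{a..<a + Suc i} = insert (a + i) {a..<a + i}" by auto
          have e2: "us ! (m * (a + i)) = v" "us ! Suc (m * (a + i)) = v'"
            unfolding n_def[symmetric] using l by (auto simp: us_def nth_append)
          have e3: "us ! (m * s) = xs ! (m * s) \<and> us ! Suc (m * s) = xs ! Suc (m * s)" if "s \<in> {a..<a + i}" for s
          proof -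
            have "m * Suc s \<le> n" using that unfolding n_def by (intro mult_le_mono2) auto
            then have "Suc (m * s) < n" unfolding mult_Suc_right using m2 by linarith
            then show ?thesis using l by (simp add: us_def nth_append)
          qed
          show ?thesis unfolding conn_def t1 e1 using e2 e3 by (auto simp: ys_def)
        qed
        then show ?thesis unfolding f_def us_def[symmetric] t1 c_def by auto
      qed
      have "(\<Sum>v\<in>{1..src n}. q xs v * (\<Sum>v'\<in>{1..src (Suc n)}. q (xs @ [v]) v' * f ((xs @ [v]) @ [v'])))
        = c * (\<Sum>v\<in>{1..src n}. q xs v * (\<Sum>v'\<in>{1..src (Suc n)}. q (xs @ [v]) v' * of_bool (\<not> (v = wsel ys \<and> v' \<in> T ys))))"
        unfolding fe sum_distrib_left by (intro sum.cong refl) (simp add: mult_ac)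
      also have "\<dots> \<le> c * exp (- p)"
      proof (cases "c = 0")
        case False
        then have Ay: "V (take (m * t0) ys)" "climbed ys v0 d h S" by (auto simp: c_def A_def)
        have vy: "valid (m * a) ys" unfolding ys_def using va man by (rule pa_valid_take)
        have t0a: "m * t0 \<le> m * a" using a by simp
        have vz: "valid (m * t0) (take (m * t0) ys)" using vy t0a by (rule pa_valid_take)
        define zs where "zs = take (m * t0) ys"
        have "(\<Sum>v\<in>{1..src n}. q xs v * (\<Sum>v'\<in>{1..src (Suc n)}. q (xs @ [v]) v' * of_bool (\<not> (v = wsel ys \<and> v' \<in> T ys))))
          \<le> exp (- p)"
          unfolding p_def
        proof (rule connect_prob[OF va])
          show "n = m * (a + i)" by (simp add: n_def)
          show "wsel ys \<in> {1..a + i}" using wsel[OF Ay(2)] a by auto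
          show "T ys \<subseteq> {1..a + i}" using a by (auto simp: T_def)
          show "Suc (a + i) \<le> t" using a Suc.prems by simp
          have "wt ys (wsel ys) \<le> wt xs (wsel ys)" unfolding ys_def by (rule wt_take_le)
          then show "h + \<delta> \<le> wt xs (wsel ys)" using wsel[OF Ay(2)] by (simp add: wt_def)
          have zx: "wt zs v \<le> wt xs v" for v
            using wt_take_le[of "m * t0" ys v] wt_take_le[of "m * a" xs v] by (simp add: zs_def ys_def)
          have "2 * (real S' * h') \<le> vol zs S'" using V vz Ay by (simp add: zs_def)
          also have "\<dots> = (\<Sum>v\<in>{1..S'}. wt zs v)" by (simp add: vol_def)
          \<comment> \<open>Vertices of degree below \<open>h'\<close> account for at most
            \<open>S' * h'\<close>, half of the guaranteed volume; the other half must lie in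
            \<open>T\<close>.\<close>
          also have "\<dots> \<le> (\<Sum>v\<in>{1..S'}. h' + (if v \<in> T ys then wt zs v else 0))"
            using h delta_neg by (intro sum_mono) (auto simp: T_def zs_def[symmetric] wt_def)
          also have "\<dots> = real S' * h' + (\<Sum>v\<in>{1..S'} \<inter> T ys. wt zs v)"
            by (simp add: sum.distrib sum.inter_restrict)
          also have "{1..S'} \<inter> T ys = T ys" by (auto simp: T_def)
          also have "(\<Sum>v\<in>T ys. wt zs v) \<le> (\<Sum>v\<in>T ys. wt xs v)" using zx by (intro sum_mono)
          finally show "real S' * h' \<le> (\<Sum>v\<in>T ys. wt xs v)" by (simp add: mult.commute)
        qed (use h in auto)
        then show ?thesis by (intro mult_left_mono) (auto simp: c_def A_def)
      qed simp
      finally show "(\<Sum>v\<in>{1..src n}. q xs v * (\<Sum>v'\<in>{1..src (Suc n)}. q (xs @ [v]) v' * f ((xs @ [v]) @ [v'])))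
        \<le> exp (- p) * (A (take (m * a) xs) * of_bool (\<not> conn i xs))"
        by (simp add: c_def ys_def mult.commute)
    qed
    also have "\<dots> = exp (- p) * E n (\<lambda>xs. A (take (m * a) xs) * of_bool (\<not> conn i xs))" by (rule E_cmult)
    also have "\<dots> \<le> exp (- p) * exp (- (real i * p))"
      unfolding n_def using Suc by (intro mult_left_mono) auto
    also have "\<dots> = exp (- (real (Suc i) * p))" by (simp add: exp_add[symmetric] algebra_simps)
    finally show ?case by (simp add: f_def[abs_def])
  qed
  have "E (m * (a + M)) (\<lambda>xs. of_bool (V (take (m * t0) xs) \<and> climbed (take (m * a) xs) v0 d h S \<and> \<not> climbed xs v0 (d + 2) h' S'))
    \<le> E (m * (a + M)) (\<lambda>xs. A (take (m * a) xs) * of_bool (\<not> conn M xs))"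
  proof (intro E_mono)
    fix xs assume va: "valid (m * (a + M)) xs"
    have l: "length xs = m * (a + M)" using va pa_valid_length by blast
    define ys where "ys = take (m * a) xs"
    have zy: "take (m * t0) ys = take (m * t0) xs" using a by (simp add: ys_def min_def)
    have "climbed xs v0 (d + 2) h' S'" if cl: "climbed ys v0 d h S" and co: "conn M xs"
    proof -
      obtain s where s: "s \<in> {a..<a + M}" "xs ! (m * s) = wsel ys" "xs ! Suc (m * s) \<in> T ys"
        using co unfolding conn_def ys_def by blast
      define v' where "v' = xs ! Suc (m * s)"
      have "m * Suc s \<le> m * (a + M)"
        using s(1) by (intro mult_le_mono2) auto
      then have k: "m * s < length xs" "Suc (m * s) < length xs" unfolding l mult_Suc_right using m2 by linarith+
      have sr: "src (m * s) = Suc s" "src (Suc (m * s)) = Suc s" using m2 by (auto simp: pa_src_def div_m_iff)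
      have "near xs v0 (wsel ys) d" using wsel[OF cl] near_take unfolding ys_def by blast
      moreover have "near xs (wsel ys) (Suc s) 1"
        using near_edge[OF adj_of_entry[OF k(1)]] near_sym s(2) sr by simp
      moreover have "near xs (Suc s) v' 1"
        using near_edge[OF adj_of_entry[OF k(2)]] sr by (simp add: v'_def)
      ultimately have "near xs v0 v' (d + 1 + 1)" by (blast intro: near_trans)
      moreover have "v' \<in> {1..S'}" "h' \<le> real (dg (take (m * t0) ys) v')" using s(3) by (auto simp: T_def v'_def)
      moreover have "dg (take (m * t0) ys) v' \<le> dg xs v'" unfolding zy by (rule deg_take_le)
      ultimately show ?thesis unfolding climbed_def by (intro bexI[of _ v']) auto
    qed
    then show "of_bool (V (take (m * t0) xs) \<and> climbed (take (m * a) xs) v0 d h S \<and> \<not> climbed xs v0 (d + 2) h' S')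
      \<le> A (take (m * a) xs) * of_bool (\<not> conn M xs)"
      unfolding A_def ys_def[symmetric] zy by (auto simp: of_bool_def)
  qed
  also have "\<dots> \<le> exp (- (real M * p))" by (rule H) simp
  finally show ?thesis by (simp add: p_def)
qed

text \<open>The windows follow one another from \<open>t0\<close> on. \<open>V\<close> stays inside
  the events instead of being conditioned on, so its failure is paid for only once, by the
  caller.\<close>

lemma climb:
  fixes M S :: "nat \<Rightarrow> nat" and h :: "nat \<Rightarrow> real"
  assumes S: "\<And>k. k \<le> K \<Longrightarrow> S k \<le> t0" and t: "t0 + (\<Sum>i<K. M i) \<le> t"
    and h: "\<And>k. k < K \<Longrightarrow> 0 \<le> h k + \<delta>" "\<And>k. k \<le> K \<Longrightarrow> 0 \<le> h k"
    and V: "\<And>zs k. valid (m * t0) zs \<Longrightarrow> V zs \<Longrightarrow> 1 \<le> k \<Longrightarrow> k \<le> K \<Longrightarrow> vol zs (S k) \<ge> 2 * (real (S k) * h k)"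
  shows "E (m * (t0 + (\<Sum>i<K. M i))) (\<lambda>xs. of_bool (V (take (m * t0) xs) \<and> \<not> climbed xs v0 (d + 2 * K) (h K) (S K)))
    \<le> E (m * t0) (\<lambda>xs. of_bool (\<not> climbed xs v0 d (h 0) (S 0)))
      + (\<Sum>k<K. exp (- (real (M k) * ((h k + \<delta>) * (real (S (Suc k)) * h (Suc k)) / (cc (m * t))\<^sup>2))))"
  using assms
proof (induction K)
  case 0
  have "E (m * t0) (\<lambda>xs. of_bool (V (take (m * t0) xs) \<and> \<not> climbed xs v0 d (h 0) (S 0)))
     \<le> E (m * t0) (\<lambda>xs. of_bool (\<not> climbed xs v0 d (h 0) (S 0)))"
    by (intro E_mono) auto
  then show ?case by simp
next
  case (Suc K)
  define a where "a = t0 + (\<Sum>i<K. M i)"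
  have "E (m * (a + M K)) (\<lambda>xs. of_bool (V (take (m * t0) xs) \<and> \<not> climbed xs v0 (d + 2 * Suc K) (h (Suc K)) (S (Suc K))))
    \<le> E (m * (a + M K)) (\<lambda>xs. (\<lambda>ys. of_bool (V (take (m * t0) ys) \<and> \<not> climbed ys v0 (d + 2 * K) (h K) (S K))) (take (m * a) xs)
       + of_bool (V (take (m * t0) xs) \<and> climbed (take (m * a) xs) v0 (d + 2 * K) (h K) (S K) \<and> \<not> climbed xs v0 (d + 2 * K + 2) (h (Suc K)) (S (Suc K))))"
  proof (intro E_mono)
    fix xs :: "nat list"
    have "t0 \<le> a" by (simp add: a_def)
    then have "take (m * t0) (take (m * a) xs) = take (m * t0) xs" by (simp add: min_def)
    then show "of_bool (V (take (m * t0) xs) \<and> \<not> climbed xs v0 (d + 2 * Suc K) (h (Suc K)) (S (Suc K)))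
      \<le> (\<lambda>ys. of_bool (V (take (m * t0) ys) \<and> \<not> climbed ys v0 (d + 2 * K) (h K) (S K))) (take (m * a) xs)
       + (of_bool (V (take (m * t0) xs) \<and> climbed (take (m * a) xs) v0 (d + 2 * K) (h K) (S K) \<and> \<not> climbed xs v0 (d + 2 * K + 2) (h (Suc K)) (S (Suc K))) :: real)"
      by (simp add: of_bool_def)
  qed
  also have "\<dots> = E (m * a) (\<lambda>ys. of_bool (V (take (m * t0) ys) \<and> \<not> climbed ys v0 (d + 2 * K) (h K) (S K)))
     + E (m * (a + M K)) (\<lambda>xs. of_bool (V (take (m * t0) xs) \<and> climbed (take (m * a) xs) v0 (d + 2 * K) (h K) (S K) \<and> \<not> climbed xs v0 (d + 2 * K + 2) (h (Suc K)) (S (Suc K))))"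
    unfolding E_add by (rule arg_cong2[where f = "(+)", OF E_take refl]) simp
  also have "\<dots> \<le> (E (m * t0) (\<lambda>xs. of_bool (\<not> climbed xs v0 d (h 0) (S 0)))
      + (\<Sum>k<K. exp (- (real (M k) * ((h k + \<delta>) * (real (S (Suc k)) * h (Suc k)) / (cc (m * t))\<^sup>2)))))
     + exp (- (real (M K) * ((h K + \<delta>) * (real (S (Suc K)) * h (Suc K)) / (cc (m * t))\<^sup>2)))"
  proof (intro add_mono)
    show "E (m * a) (\<lambda>ys. of_bool (V (take (m * t0) ys) \<and> \<not> climbed ys v0 (d + 2 * K) (h K) (S K)))
     \<le> E (m * t0) (\<lambda>xs. of_bool (\<not> climbed xs v0 d (h 0) (S 0)))
      + (\<Sum>k<K. exp (- (real (M k) * ((h k + \<delta>) * (real (S (Suc k)) * h (Suc k)) / (cc (m * t))\<^sup>2))))"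
      unfolding a_def using Suc.prems by (intro Suc.IH) auto
    show "E (m * (a + M K)) (\<lambda>xs. of_bool (V (take (m * t0) xs) \<and> climbed (take (m * a) xs) v0 (d + 2 * K) (h K) (S K) \<and> \<not> climbed xs v0 (d + 2 * K + 2) (h (Suc K)) (S (Suc K))))
     \<le> exp (- (real (M K) * ((h K + \<delta>) * (real (S (Suc K)) * h (Suc K)) / (cc (m * t))\<^sup>2)))"
    proof (rule climb_step)
      have "S K \<le> t0" using Suc.prems(1)[of K] by simp
      then show "S K \<le> a" by (simp add: a_def)
      show "a + M K \<le> t" using Suc.prems(2) by (simp add: a_def)
      show "2 * (real (S (Suc K)) * h (Suc K)) \<le> vol zs (S (Suc K))" if "valid (m * t0) zs" "V zs" for zs
        using Suc.prems(5)[OF that, of "Suc K"] by simp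
    qed (use Suc.prems in \<open>auto simp: a_def\<close>)
  qed
  finally show ?case by (simp add: a_def add.assoc)
qed

end

section \<open>Reaching vertex 1\<close>

lemma sum_double_exp_le:
  fixes a B \<theta> :: real
  assumes a: "a > 0" and B: "B \<ge> 0" and th: "\<theta> > 1" and s: "2 * exp (- a * B * (\<theta> - 1)) \<le> 1 / 2"
  shows "(\<Sum>k<K. 2 ^ k * exp (- a * (B * \<theta> ^ k))) \<le> 2 * exp (- a * B)"
proof -
  define r where "r = 2 * exp (- a * B * (\<theta> - 1))"
  have r: "0 < r" "r \<le> 1 / 2" using s by (auto simp: r_def)
  have "2 ^ k * exp (- a * (B * \<theta> ^ k)) \<le> exp (- a * B) * (1 / 2) ^ k" for k
  proof -
    \<comment> \<open>Bernoulli's inequality turns the doubly exponential decay into a geometric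
      one; \<open>s\<close> makes its ratio small enough to beat the powers of 2.\<close>
    have "1 + real k * (\<theta> - 1) \<le> (1 + (\<theta> - 1)) ^ k" using th by (intro Bernoulli_inequality) auto
    then have "a * B * (1 + real k * (\<theta> - 1)) \<le> a * B * \<theta> ^ k" using a B by (intro mult_left_mono) auto
    then have "exp (- a * (B * \<theta> ^ k)) \<le> exp (- a * B + real k * (- a * B * (\<theta> - 1)))" by (simp add: algebra_simps)
    also have "\<dots> = exp (- a * B) * exp (- a * B * (\<theta> - 1)) ^ k" unfolding exp_add exp_of_nat_mult ..
    finally have "2 ^ k * exp (- a * (B * \<theta> ^ k)) \<le> 2 ^ k * (exp (- a * B) * exp (- a * B * (\<theta> - 1)) ^ k)"
      by (intro mult_left_mono) auto
    also have "\<dots> = exp (- a * B) * r ^ k" by (simp add: r_def power_mult_distrib)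
    also have "\<dots> \<le> exp (- a * B) * (1 / 2) ^ k" using r by (intro mult_left_mono power_mono) auto
    finally show ?thesis .
  qed
  then have "(\<Sum>k<K. 2 ^ k * exp (- a * (B * \<theta> ^ k))) \<le> (\<Sum>k<K. exp (- a * B) * (1 / 2) ^ k)" by (intro sum_mono)
  also have "\<dots> = exp (- a * B) * (\<Sum>k<K. (1 / 2) ^ k)" by (simp add: sum_distrib_left)
  also have "(\<Sum>k<K. (1 / 2 :: real) ^ k) \<le> 2"
  proof -
    have "(\<Sum>k<K. (1 / 2 :: real) ^ k) = (1 - (1 / 2) ^ K) / (1 / 2)" by (subst sum_gp_strict) auto
    also have "\<dots> \<le> 2" by simp
    finally show ?thesis .
  qed
  finally show ?thesis by simp
qed

context pref_att
begin

text \<open>The climb passes through degrees \<open>h k = exp (B * \<theta> ^ k)\<close>, capped at the order of the degree of vertex 1, and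
  looks for targets among the first \<open>S k = t * h k powr - ((1 + \<sigma>) / \<gamma>)\<close> vertices; at the cap \<open>S k = 1\<close>. The
  \<open>k\<close>-th time window consists of \<open>\<eta> * t / 2 ^ (k + 1)\<close> vertices.\<close>

lemma climb_to_root:
  fixes \<theta> \<sigma> \<eta> B :: real and t K J :: nat
  assumes th: "1 < \<theta>" "\<theta> * \<rho> < 1" and sg: "\<sigma> = \<gamma> * (1 / \<theta> - \<rho>) / 2"
    and eta: "0 < \<eta>" "\<eta> \<le> 1 / 2" and B: "B \<ge> 1" "exp B \<ge> 2 * real m"
    and cap: "cap = real t powr (\<gamma> / (1 + \<sigma>))"
    and K1: "K \<ge> 1" and Kl: "\<And>k. k < K \<Longrightarrow> exp (B * \<theta> ^ k) < cap" and Ku: "cap \<le> exp (B * \<theta> ^ K)"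
    and K2: "2 ^ K \<le> \<eta> * real t / 4" and t: "t \<ge> 1"
    and t0: "t0 = t - nat \<lfloor>\<eta> * real t\<rfloor>" and G: "G = nat \<lceil>exp B\<rceil>" and v0: "v0 \<in> {1..t0}"
  shows "E (m * t) (\<lambda>xs. of_bool (\<not> near xs v0 1 (J + 2 * K))) \<le> E (m * t0) (\<lambda>xs. of_bool (bad G J xs v0))
     + (\<Sum>k<K. 2 ^ k * exp (- ((1 - \<theta> * \<rho>) / 2) * (B * \<theta> ^ k))) / (\<eta> / (144 * (real m)\<^sup>2))
     + (8 * (\<Sum>k<K. 2 ^ k * exp (- \<sigma> * (B * \<theta> ^ k))) + 8 * cap powr (- \<sigma>))"
proof -
  \<comment> \<open>Degree \<open>h\<close> is typical for vertices up to order
    \<open>t * h powr (- 1 / \<gamma>)\<close>. The additional \<open>\<sigma>\<close> makes the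
    targets older than that, so that their volume fails only with probability of order
    \<open>h powr (- \<sigma>)\<close>.\<close>
  define e where "e = (1 + \<sigma>) / \<gamma>"
  \<comment> \<open>The gain of one climbing step, not the power-law exponent
    \<open>3 + \<delta> / m\<close>.\<close>
  define \<tau> where "\<tau> = (1 - \<theta> * \<rho>) / 2"
  define h where "h k = min (exp (B * \<theta> ^ k)) cap" for k
  define S where "S k = (if k = 0 then t0 else nat \<lfloor>real t * h k powr (- e)\<rfloor>)" for k
  define M where "M k = nat \<lfloor>\<eta> * real t / 2 ^ Suc k\<rfloor>" for k
  define V where "V zs \<longleftrightarrow> (\<forall>k\<in>{1..K}. 2 * (real (S k) * h k) < vol zs (S k))" for zs
  have sg0: "\<sigma> > 0" using th rho chi unfolding sg by (simp add: field_simps)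
  have e1: "e \<ge> 1" using sg0 chi by (simp add: e_def field_simps)
  have tr: "real t \<ge> 1" using t by simp
  have capB: "exp B < cap" using Kl[of 0] K1 by simp
  have thk: "1 \<le> \<theta> ^ k" for k using th by (intro one_le_power) auto
  have hB: "exp B \<le> h k" for k
  proof -
    have "B * 1 \<le> B * \<theta> ^ k" using B thk by (intro mult_left_mono) auto
    then show ?thesis using capB by (simp add: h_def)
  qed
  have expB: "exp B \<ge> 2"
  proof -
    have "exp B \<ge> 1 + B" by (rule exp_ge_add_one_self)
    then show ?thesis using B by linarith
  qed
  have h2: "h k \<ge> 2" for k using hB[of k] expB by linarith
  have hk: "h k = exp (B * \<theta> ^ k)" if "k < K" for k using Kl[OF that] by (simp add: h_def)
  have hK: "h K = cap" using Ku by (simp add: h_def)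
  have hcap: "h k \<le> cap" for k by (simp add: h_def)
  \<comment> \<open>The cap is the degree at which the target set shrinks to the single vertex
    1.\<close>
  have cap_e: "real t * cap powr (- e) = 1"
  proof -
    have "cap powr (- e) = real t powr (\<gamma> / (1 + \<sigma>) * (- e))" unfolding cap powr_powr ..
    also have "\<gamma> / (1 + \<sigma>) * (- e) = - 1" using sg0 chi by (simp add: e_def)
    finally show ?thesis using tr by (simp add: powr_minus_divide)
  qed
  have Sge1: "real t * h k powr (- e) \<ge> 1" for k
  proof -
    have "cap powr (- e) \<le> h k powr (- e)" using hcap[of k] h2[of k] e1 by (intro powr_mono2') auto
    then have "real t * cap powr (- e) \<le> real t * h k powr (- e)" using tr by (intro mult_left_mono) auto
    then show ?thesis using cap_e by simp
  qed
  have Sup: "real (S k) \<le> real t * h k powr (- e)" if "k \<ge> 1" for k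
    using that Sge1[of k] by (simp add: S_def)
  have Slo: "real (S k) \<ge> real t * h k powr (- e) / 2" "S k \<ge> 1" if "k \<ge> 1" for k
  proof -
    define y where "y = real t * h k powr (- e)"
    have y: "y \<ge> 1" using Sge1[of k] by (simp add: y_def)
    have "S k = nat \<lfloor>y\<rfloor>" using that by (simp add: S_def y_def)
    moreover have "nat \<lfloor>y\<rfloor> \<ge> 1" using y by (simp add: le_nat_floor)
    ultimately have "real (S k) > y - 1" "real (S k) \<ge> 1" using y by linarith+
    then show "real (S k) \<ge> real t * h k powr (- e) / 2" "S k \<ge> 1" unfolding y_def[symmetric] by linarith+
  qed
  have SK: "S K = 1" using K1 hK cap_e by (simp add: S_def)
  have fl: "real (nat \<lfloor>\<eta> * real t\<rfloor>) \<le> \<eta> * real t" using eta tr by simp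
  have flt: "nat \<lfloor>\<eta> * real t\<rfloor> \<le> t"
  proof -
    have "\<eta> * real t \<le> 1 * real t" using eta tr by (intro mult_right_mono) auto
    then have "real (nat \<lfloor>\<eta> * real t\<rfloor>) \<le> real t" using fl by linarith
    then show ?thesis by simp
  qed
  have t0h: "real t0 \<ge> real t / 2"
  proof -
    have "real t0 = real t - real (nat \<lfloor>\<eta> * real t\<rfloor>)" using flt by (simp add: t0 of_nat_diff)
    moreover have "\<eta> * real t \<le> 1 / 2 * real t" using eta tr by (intro mult_right_mono) auto
    ultimately show ?thesis using fl by linarith
  qed
  have t0t: "t0 \<le> t" by (simp add: t0)
  have t0p: "t0 \<ge> 1" using v0 by simp
  have St0: "S k \<le> t0" for k
  proof (cases "k = 0")
    case False
    have "h k powr (- e) \<le> h k powr (- 1)" using e1 h2[of k] by (intro powr_mono) auto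
    also have "\<dots> = 1 / h k" using h2[of k] by (simp add: powr_minus_divide)
    also have "\<dots> \<le> 1 / 2" using h2[of k] by (intro divide_left_mono) auto
    finally have "real t * h k powr (- e) \<le> real t * (1 / 2)" using tr by (intro mult_left_mono) auto
    then have "real (S k) \<le> real t0" using Sup[of k] False t0h by simp
    then show ?thesis by simp
  qed (simp add: S_def)
  have sumM: "t0 + (\<Sum>i<K. M i) \<le> t"
  proof -
    have "real (\<Sum>i<K. M i) = (\<Sum>i<K. real (M i))" by simp
    also have "\<dots> \<le> (\<Sum>i<K. \<eta> * real t / 2 * (1 / 2) ^ i)"
    proof (intro sum_mono)
      fix i
      have "real (M i) \<le> \<eta> * real t / 2 ^ Suc i" unfolding M_def using eta tr by simp
      then show "real (M i) \<le> \<eta> * real t / 2 * (1 / 2) ^ i" by (simp add: power_one_over)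
    qed
    also have "\<dots> = \<eta> * real t / 2 * (\<Sum>i<K. (1 / 2) ^ i)" by (simp add: sum_distrib_left)
    also have "(\<Sum>i<K. (1 / 2 :: real) ^ i) = (1 - (1 / 2) ^ K) / (1 / 2)" by (subst sum_gp_strict) auto
    also have "\<eta> * real t / 2 * ((1 - (1 / 2) ^ K) / (1 / 2)) \<le> \<eta> * real t"
    proof -
      have "\<eta> * real t * (1 - (1 / 2) ^ K) \<le> \<eta> * real t * 1" using eta tr by (intro mult_left_mono) auto
      then show ?thesis by (simp add: algebra_simps)
    qed
    finally have "(\<Sum>i<K. M i) \<le> nat \<lfloor>\<eta> * real t\<rfloor>" by (simp add: le_nat_floor)
    then show ?thesis using flt by (simp add: t0)
  qed
  define a where "a = t0 + (\<Sum>i<K. M i)"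
  \<comment> \<open>Because \<open>exp B \<ge> 2 * m\<close>, the negative
    \<open>\<delta> > - m\<close> takes away at most half of \<open>h k\<close>.\<close>
  have hd: "h k + \<delta> \<ge> h k / 2" for k
    using hB[of k] B(2) delta_gt by linarith
  have PV: "E (m * t0) (\<lambda>zs. of_bool (\<not> V zs)) \<le> 8 * (\<Sum>k<K. 2 ^ k * exp (- \<sigma> * (B * \<theta> ^ k))) + 8 * cap powr (- \<sigma>)"
  proof -
    have "E (m * t0) (\<lambda>zs. of_bool (\<not> V zs)) \<le> E (m * t0) (\<lambda>zs. \<Sum>k\<in>{1..K}. of_bool (vol zs (S k) \<le> 2 * (real (S k) * h k)))"
    proof (intro E_mono)
      fix zs
      show "of_bool (\<not> V zs) \<le> (\<Sum>k\<in>{1..K}. of_bool (vol zs (S k) \<le> 2 * (real (S k) * h k)) :: real)"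
      proof (cases "V zs")
        case False
        then obtain k where k: "k \<in> {1..K}" "vol zs (S k) \<le> 2 * (real (S k) * h k)"
          unfolding V_def using not_less by blast
        have "1 \<le> (\<Sum>k\<in>{1..K}. of_bool (vol zs (S k) \<le> 2 * (real (S k) * h k)) :: real)"
          using member_le_sum[of k "{1..K}" "\<lambda>k. of_bool (vol zs (S k) \<le> 2 * (real (S k) * h k)) :: real"] k by auto
        then show ?thesis using False by simp
      qed (auto intro!: sum_nonneg)
    qed
    also have "\<dots> = (\<Sum>k\<in>{1..K}. E (m * t0) (\<lambda>zs. of_bool (vol zs (S k) \<le> 2 * (real (S k) * h k))))" by (rule E_sum)
    also have "\<dots> \<le> (\<Sum>k\<in>{1..K}. 8 * h k powr (- \<sigma>))"
    proof (intro sum_mono)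
      fix k assume "k \<in> {1..K}"
      then have k: "k \<ge> 1" by simp
      have S0: "real (S k) > 0" using Slo[OF k] by simp
      have "E (m * t0) (\<lambda>zs. of_bool (vol zs (S k) \<le> 2 * (real (S k) * h k)))
        \<le> 2 * (2 * (real (S k) * h k)) / real (S k) * (real (m * S k) / real (m * t0)) powr \<gamma>"
        using Slo[OF k] St0[of k] h2[of k] by (intro vol_lower) auto
      also have "\<dots> = 4 * h k * (real (S k) / real t0) powr \<gamma>" using S0 m_pos by simp
      also have "\<dots> \<le> 4 * h k * (2 * h k powr (- e)) powr \<gamma>"
      proof (intro mult_left_mono powr_mono2)
        have "real (S k) / real t0 \<le> (real t * h k powr (- e)) / (real t / 2)"
          using Sup[OF k] t0h tr by (intro frac_le) auto
        also have "\<dots> = 2 * h k powr (- e)" using tr by simp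
        finally show "real (S k) / real t0 \<le> 2 * h k powr (- e)" .
      qed (use chi h2[of k] in auto)
      also have "(2 * h k powr (- e)) powr \<gamma> = 2 powr \<gamma> * h k powr (- (1 + \<sigma>))"
      proof -
        have "- e * \<gamma> = - (1 + \<sigma>)" using chi by (simp add: e_def)
        then show ?thesis by (simp only: powr_mult powr_powr)
      qed
      also have "4 * h k * (2 powr \<gamma> * h k powr (- (1 + \<sigma>))) \<le> 4 * h k * (2 * h k powr (- (1 + \<sigma>)))"
        using powr_mono[of \<gamma> 1 2] chi h2[of k] by (intro mult_left_mono mult_right_mono) auto
      also have "\<dots> = 8 * (h k powr 1 * h k powr (- (1 + \<sigma>)))" using h2[of k] by simp
      also have "h k powr 1 * h k powr (- (1 + \<sigma>)) = h k powr (- \<sigma>)" unfolding powr_add[symmetric] by simp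
      finally show "E (m * t0) (\<lambda>zs. of_bool (vol zs (S k) \<le> 2 * (real (S k) * h k))) \<le> 8 * h k powr (- \<sigma>)" .
    qed
    also have "\<dots> = 8 * (\<Sum>k\<in>{1..<K}. h k powr (- \<sigma>)) + 8 * cap powr (- \<sigma>)"
    proof -
      have "{1..K} = insert K {1..<K}" using K1 by auto
      then show ?thesis by (simp add: hK sum_distrib_left)
    qed
    also have "(\<Sum>k\<in>{1..<K}. h k powr (- \<sigma>)) \<le> (\<Sum>k<K. 2 ^ k * exp (- \<sigma> * (B * \<theta> ^ k)))"
    proof -
      have "(\<Sum>k\<in>{1..<K}. h k powr (- \<sigma>)) \<le> (\<Sum>k\<in>{1..<K}. 2 ^ k * exp (- \<sigma> * (B * \<theta> ^ k)))"
      proof (intro sum_mono)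
        fix k assume "k \<in> {1..<K}"
        then have "h k powr (- \<sigma>) = 1 * exp (- \<sigma> * (B * \<theta> ^ k))" by (simp add: hk powr_def)
        also have "\<dots> \<le> 2 ^ k * exp (- \<sigma> * (B * \<theta> ^ k))" by (intro mult_right_mono) auto
        finally show "h k powr (- \<sigma>) \<le> 2 ^ k * exp (- \<sigma> * (B * \<theta> ^ k))" .
      qed
      also have "\<dots> \<le> (\<Sum>k<K. 2 ^ k * exp (- \<sigma> * (B * \<theta> ^ k)))" by (intro sum_mono2) auto
      finally show ?thesis .
    qed
    finally show ?thesis by simp
  qed
  have fail: "exp (- (real (M k) * ((h k + \<delta>) * (real (S (Suc k)) * h (Suc k)) / (cc (m * t))\<^sup>2)))
     \<le> 2 ^ k * exp (- \<tau> * (B * \<theta> ^ k)) / (\<eta> / (144 * (real m)\<^sup>2))" if k: "k < K" for k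
  proof -
    \<comment> \<open>144 = 4 * 2 * 2 * 9: 4 from the window length, 2 from
      \<open>h k + \<delta>\<close>, 2 from rounding \<open>S\<close>, and 9 from
      \<open>cc (m * t) \<le> 3 * m * t\<close>.\<close>
    define y where "y = \<eta> / (144 * (real m)\<^sup>2) * (h k powr \<tau> / 2 ^ k)"
    have hk2: "h k \<ge> 2" by (rule h2)
    have y0: "y > 0" using eta m_pos hk2 by (simp add: y_def)
    have Mk: "real (M k) \<ge> \<eta> * real t / (4 * 2 ^ k)"
    proof -
      define z where "z = \<eta> * real t / 2 ^ Suc k"
      have "(2::real) ^ Suc k \<le> 2 ^ K" using k by (intro power_increasing) auto
      then have "2 ^ Suc k * 4 \<le> \<eta> * real t" using K2 by linarith
      then have "z \<ge> 4" by (simp add: z_def field_simps)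
      then have "real (M k) \<ge> z / 2" unfolding M_def z_def[symmetric] by linarith
      then show ?thesis by (simp add: z_def)
    qed
    have Sk: "real (S (Suc k)) * h (Suc k) \<ge> real t / 2 * (h k powr \<theta>) powr (1 - e)"
    proof -
      have hS: "h (Suc k) \<le> h k powr \<theta>"
      proof -
        have "h (Suc k) \<le> exp (B * \<theta> ^ Suc k)" by (simp add: h_def)
        also have "\<dots> = h k powr \<theta>" by (simp add: hk[OF k] powr_def mult_ac)
        finally show ?thesis .
      qed
      have "real t / 2 * (h k powr \<theta>) powr (1 - e) \<le> real t / 2 * h (Suc k) powr (1 - e)"
        using hS h2[of "Suc k"] e1 by (intro mult_left_mono powr_mono2') auto
      also have "h (Suc k) powr (1 - e) = h (Suc k) powr (- e) * h (Suc k)"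
      proof -
        have "h (Suc k) powr (1 - e) = h (Suc k) powr (- e + 1)" by (simp add: add.commute)
        then show ?thesis using h2[of "Suc k"] by (simp only: powr_add) simp
      qed
      also have "real t / 2 * (h (Suc k) powr (- e) * h (Suc k)) = real t * h (Suc k) powr (- e) / 2 * h (Suc k)" by simp
      also have "\<dots> \<le> real (S (Suc k)) * h (Suc k)" using Slo[of "Suc k"] h2[of "Suc k"] by (intro mult_right_mono) auto
      finally show ?thesis .
    qed
    have cct: "(cc (m * t))\<^sup>2 \<le> (3 * real m * real t)\<^sup>2"
    proof (intro power_mono)
      have "real m * real t \<ge> 1 * 1" using m_pos tr by (intro mult_mono) auto
      moreover have "real (m * t) * (1 + \<rho>) \<le> real (m * t) * 2" using rho by (intro mult_left_mono) auto
      ultimately show "cc (m * t) \<le> 3 * real m * real t" unfolding cc_eq using rho by simp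
    qed (use cc_pos[of "m * t"] in auto)
    \<comment> \<open>\<open>\<sigma> / \<gamma>\<close> is half of
      \<open>1 / \<theta> - \<rho>\<close>, hence \<open>\<theta> * (e - 1) = \<theta> * \<rho> + (1
      - \<theta> * \<rho>) / 2\<close> and a positive power of \<open>h k\<close> is left
      over.\<close>
    have exponent: "h k * (h k powr \<theta>) powr (1 - e) = h k powr \<tau>"
    proof -
      have "1 / \<gamma> = 1 + \<rho>" using chi by (simp add: field_simps)
      then have "e = 1 + \<rho> + \<sigma> / \<gamma>" by (simp add: e_def add_divide_distrib)
      also have "\<sigma> / \<gamma> = (1 / \<theta> - \<rho>) / 2" using chi by (simp add: sg)
      finally have "\<theta> * (1 - e) = - (\<theta> * \<rho>) - (1 - \<theta> * \<rho>) / 2" using th by (simp add: field_simps)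
      then have "1 + \<theta> * (1 - e) = \<tau>" by (simp add: \<tau>_def field_simps)
      then have "h k powr \<tau> = h k powr 1 * h k powr (\<theta> * (1 - e))" by (simp only: powr_add[symmetric])
      then show ?thesis using hk2 by (simp add: powr_powr)
    qed
    have "y = (\<eta> * real t / (4 * 2 ^ k)) * ((h k / 2) * (real t / 2 * (h k powr \<theta>) powr (1 - e)) / (3 * real m * real t)\<^sup>2)"
      unfolding y_def exponent[symmetric] using tr m_pos by (simp add: power2_eq_square field_simps)
    also have "\<dots> \<le> real (M k) * ((h k + \<delta>) * (real (S (Suc k)) * h (Suc k)) / (cc (m * t))\<^sup>2)"
    proof (intro mult_mono[OF Mk] frac_le mult_mono[OF hd Sk])
      have "0 \<le> h k + \<delta>" using hd[of k] hk2 by linarith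
      then show "0 \<le> h k + \<delta>" "0 \<le> (h k + \<delta>) * (real (S (Suc k)) * h (Suc k))"
        using h2[of "Suc k"] by (auto intro!: mult_nonneg_nonneg)
    qed (use cct eta tr hk2 cc_pos[of "m * t"] in auto)
    finally have "exp (- (real (M k) * ((h k + \<delta>) * (real (S (Suc k)) * h (Suc k)) / (cc (m * t))\<^sup>2))) \<le> exp (- y)" by simp
    \<comment> \<open>This crude bound is enough: \<open>h k\<close> grows doubly exponentially and
      only has to beat \<open>2 ^ k\<close>.\<close>
    also have "\<dots> \<le> 1 / y"
    proof -
      have "y \<le> exp y" using exp_ge_add_one_self[of y] by linarith
      then have "1 / exp y \<le> 1 / y" using y0 by (intro divide_left_mono) auto
      then show ?thesis by (simp add: exp_minus inverse_eq_divide)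
    qed
    also have "\<dots> = 2 ^ k * (1 / h k powr \<tau>) / (\<eta> / (144 * (real m)\<^sup>2))" by (simp add: y_def mult_ac)
    also have "1 / h k powr \<tau> = exp (- \<tau> * (B * \<theta> ^ k))"
      by (simp add: hk[OF k] powr_def exp_minus inverse_eq_divide)
    finally show ?thesis .
  qed
  have "E (m * t) (\<lambda>xs. of_bool (\<not> near xs v0 1 (J + 2 * K)))
    \<le> E (m * t) (\<lambda>xs. (\<lambda>ys. of_bool (\<not> V (take (m * t0) ys)) + of_bool (V (take (m * t0) ys) \<and> \<not> climbed ys v0 (J + 2 * K) (h K) (S K))) (take (m * a) xs))"
  proof (intro E_mono)
    fix xs :: "nat list"
    define ys where "ys = take (m * a) xs"
    have "near xs v0 1 (J + 2 * K)" if "climbed ys v0 (J + 2 * K) (h K) (S K)"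
    proof -
      have "near ys v0 1 (J + 2 * K)" using that by (auto simp: climbed_def SK)
      then show ?thesis unfolding ys_def by (rule near_take)
    qed
    then show "of_bool (\<not> near xs v0 1 (J + 2 * K)) \<le> (\<lambda>ys. of_bool (\<not> V (take (m * t0) ys)) + of_bool (V (take (m * t0) ys) \<and> \<not> climbed ys v0 (J + 2 * K) (h K) (S K)) :: real) (take (m * a) xs)"
      unfolding ys_def[symmetric] by (auto simp: of_bool_def)
  qed
  also have "\<dots> = E (m * a) (\<lambda>ys. of_bool (\<not> V (take (m * t0) ys)) + of_bool (V (take (m * t0) ys) \<and> \<not> climbed ys v0 (J + 2 * K) (h K) (S K)))"
    using sumM by (intro E_take) (simp add: a_def)
  also have "\<dots> = E (m * a) (\<lambda>ys. (\<lambda>zs. of_bool (\<not> V zs)) (take (m * t0) ys)) + E (m * a) (\<lambda>ys. of_bool (V (take (m * t0) ys) \<and> \<not> climbed ys v0 (J + 2 * K) (h K) (S K)))"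
    by (rule E_add)
  also have "E (m * a) (\<lambda>ys. (\<lambda>zs. of_bool (\<not> V zs)) (take (m * t0) ys)) = E (m * t0) (\<lambda>zs. of_bool (\<not> V zs))"
    by (rule E_take) (simp add: a_def)
  also have "E (m * a) (\<lambda>ys. of_bool (V (take (m * t0) ys) \<and> \<not> climbed ys v0 (J + 2 * K) (h K) (S K)))
    \<le> E (m * t0) (\<lambda>xs. of_bool (\<not> climbed xs v0 J (h 0) (S 0)))
      + (\<Sum>k<K. exp (- (real (M k) * ((h k + \<delta>) * (real (S (Suc k)) * h (Suc k)) / (cc (m * t))\<^sup>2))))"
    unfolding a_def
  proof (rule climb)
    fix k
    show "S k \<le> t0" by (rule St0)
    show "0 \<le> h k + \<delta>" using hd[of k] h2[of k] by linarith
    show "0 \<le> h k" using h2[of k] by linarith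
  next
    fix zs k assume "V zs" "1 \<le> k" "k \<le> K"
    then have "2 * (real (S k) * h k) < vol zs (S k)" unfolding V_def by simp
    then show "2 * (real (S k) * h k) \<le> vol zs (S k)" by linarith
  qed (rule sumM)
  also have "E (m * t0) (\<lambda>xs. of_bool (\<not> climbed xs v0 J (h 0) (S 0))) \<le> E (m * t0) (\<lambda>xs. of_bool (bad G J xs v0))"
  proof (intro E_mono)
    fix xs assume va: "valid (m * t0) xs"
    have "climbed xs v0 J (h 0) (S 0)" if nb: "\<not> bad G J xs v0"
    proof -
      obtain w where w: "w \<in> {1..t0}" "near xs v0 w J" "G \<le> dg xs w" using not_bad_near[OF va v0 nb] by blast
      have "exp B \<le> real G" unfolding G by (rule real_nat_ceiling_ge)
      also have "\<dots> \<le> real (dg xs w)" using w by simp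
      finally have "h 0 \<le> real (dg xs w)" using K1 by (simp add: hk)
      then show ?thesis using w unfolding climbed_def S_def by auto
    qed
    then show "of_bool (\<not> climbed xs v0 J (h 0) (S 0)) \<le> (of_bool (bad G J xs v0) :: real)" by (auto simp: of_bool_def)
  qed
  also have "(\<Sum>k<K. exp (- (real (M k) * ((h k + \<delta>) * (real (S (Suc k)) * h (Suc k)) / (cc (m * t))\<^sup>2))))
     \<le> (\<Sum>k<K. 2 ^ k * exp (- \<tau> * (B * \<theta> ^ k)) / (\<eta> / (144 * (real m)\<^sup>2)))"
    using fail by (intro sum_mono) auto
  also have "\<dots> = (\<Sum>k<K. 2 ^ k * exp (- \<tau> * (B * \<theta> ^ k))) / (\<eta> / (144 * (real m)\<^sup>2))" by (simp only: sum_divide_distrib)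
  also note PV
  finally show ?thesis by (simp add: \<tau>_def)
qed

lemma near_root:
  fixes \<epsilon> \<eta> :: real
  assumes eps: "\<epsilon> > 0" and eta: "\<eta> > 0"
  shows "\<forall>\<^sub>F t in sequentially. \<exists>d. real d \<le> (2 / \<bar>ln \<rho>\<bar> + \<epsilon>) * ln (ln (real t)) \<and>
     E (m * t) (\<lambda>xs. \<Sum>v\<in>{1..t}. of_bool (\<not> near xs v 1 d)) \<le> \<eta> * real t"
proof -
  define l where "l = \<bar>ln \<rho>\<bar>"
  have l: "l > 0" "ln \<rho> = - l" using rho by (auto simp: l_def)
  have rl: "\<rho> = exp (- l)" using l rho by (metis exp_ln)
  \<comment> \<open>Chosen to make the cost of two edges per step come out as
    \<open>2 / ln \<theta> = 2 / l + \<epsilon> / 2\<close>, with \<open>\<theta>\<close> still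
    below \<open>1 / \<rho> = exp l\<close>.\<close>
  define x where "x = \<epsilon> * l / 4"
  have x: "x > 0" using eps l by (simp add: x_def)
  define \<theta> where "\<theta> = exp (l / (1 + x))"
  have lnth: "ln \<theta> = l / (1 + x)" by (simp add: \<theta>_def)
  have th1: "1 < \<theta>" using l x by (simp add: \<theta>_def)
  have th2: "\<theta> * \<rho> < 1"
  proof -
    have "l / (1 + x) < l" using l x by (simp add: field_simps)
    then show ?thesis by (simp add: \<theta>_def rl exp_add[symmetric])
  qed
  have coef: "2 / ln \<theta> = 2 / l + \<epsilon> / 2" using l x by (simp add: lnth x_def field_simps)
  define \<sigma> where "\<sigma> = \<gamma> * (1 / \<theta> - \<rho>) / 2"
  define \<tau> where "\<tau> = (1 - \<theta> * \<rho>) / 2"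
  have sg0: "\<sigma> > 0" using th1 th2 chi unfolding \<sigma>_def by (simp add: field_simps)
  have ta0: "\<tau> > 0" using th2 by (simp add: \<tau>_def)
  \<comment> \<open>The windows occupy vertices among the last \<open>\<eta>0 * t\<close>, which are
    given up as starting points.\<close>
  define \<eta>0 where "\<eta>0 = min (1 / 2) (\<eta> / 4)"
  have e0: "0 < \<eta>0" "\<eta>0 \<le> 1 / 2" "\<eta>0 \<le> \<eta> / 4" using eta by (auto simp: \<eta>0_def)
  define c0 where "c0 = \<eta>0 / (144 * (real m)\<^sup>2)"
  have c0: "c0 > 0" using e0 m_pos by (simp add: c0_def)
  have "\<exists>B. B \<ge> 1 \<and> exp B \<ge> 2 * real m \<and> 2 * exp (- \<tau> * B * (\<theta> - 1)) \<le> 1 / 2 \<and> 2 * exp (- \<sigma> * B * (\<theta> - 1)) \<le> 1 / 2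
    \<and> 2 * exp (- \<tau> * B) / c0 + 8 * (2 * exp (- \<sigma> * B)) \<le> \<eta> / 4"
  proof -
    have ex0: "((\<lambda>B. exp (- a * B)) \<longlongrightarrow> 0) at_top" if "a > 0" for a :: real
      using that by real_asymp
    have "\<forall>\<^sub>F B in at_top. B \<ge> 1 \<and> exp B \<ge> 2 * real m \<and> 2 * exp (- (\<tau> * (\<theta> - 1)) * B) < 1 / 2 \<and> 2 * exp (- (\<sigma> * (\<theta> - 1)) * B) < 1 / 2
      \<and> 2 * exp (- \<tau> * B) / c0 + 8 * (2 * exp (- \<sigma> * B)) < \<eta> / 4"
    proof (intro eventually_conj)
      show "\<forall>\<^sub>F B in at_top. (1::real) \<le> B" by (rule eventually_ge_at_top)
      show "\<forall>\<^sub>F B in at_top. 2 * real m \<le> exp B"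
        using exp_at_top unfolding filterlim_at_top by blast
      have "((\<lambda>B. 2 * exp (- (\<tau> * (\<theta> - 1)) * B)) \<longlongrightarrow> 2 * 0) at_top"
        using ta0 th1 by (intro tendsto_intros ex0) auto
      then show "\<forall>\<^sub>F B in at_top. 2 * exp (- (\<tau> * (\<theta> - 1)) * B) < 1 / 2" by (intro order_tendstoD) auto
      have "((\<lambda>B. 2 * exp (- (\<sigma> * (\<theta> - 1)) * B)) \<longlongrightarrow> 2 * 0) at_top"
        using sg0 th1 by (intro tendsto_intros ex0) auto
      then show "\<forall>\<^sub>F B in at_top. 2 * exp (- (\<sigma> * (\<theta> - 1)) * B) < 1 / 2" by (intro order_tendstoD) auto
      have "((\<lambda>B. 2 * exp (- \<tau> * B) / c0 + 8 * (2 * exp (- \<sigma> * B))) \<longlongrightarrow> 2 * 0 / c0 + 8 * (2 * 0)) at_top"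
        using sg0 ta0 c0 by (intro tendsto_intros ex0) auto
      then show "\<forall>\<^sub>F B in at_top. 2 * exp (- \<tau> * B) / c0 + 8 * (2 * exp (- \<sigma> * B)) < \<eta> / 4"
        using eta by (intro order_tendstoD) auto
    qed
    then obtain B where "B \<ge> 1 \<and> exp B \<ge> 2 * real m \<and> 2 * exp (- (\<tau> * (\<theta> - 1)) * B) < 1 / 2 \<and> 2 * exp (- (\<sigma> * (\<theta> - 1)) * B) < 1 / 2
      \<and> 2 * exp (- \<tau> * B) / c0 + 8 * (2 * exp (- \<sigma> * B)) < \<eta> / 4"
      using eventually_happens'[OF trivial_limit_at_top_linorder] by blast
    then show ?thesis by (intro exI[of _ B]) (auto simp: mult_ac)
  qed
  then obtain B where B: "B \<ge> 1" "exp B \<ge> 2 * real m" and Bt: "2 * exp (- \<tau> * B * (\<theta> - 1)) \<le> 1 / 2"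
    and Bs: "2 * exp (- \<sigma> * B * (\<theta> - 1)) \<le> 1 / 2"
    and Bsum: "2 * exp (- \<tau> * B) / c0 + 8 * (2 * exp (- \<sigma> * B)) \<le> \<eta> / 4" by blast
  define G where "G = nat \<lceil>exp B\<rceil>"
  have G1: "G \<ge> 1" unfolding G_def by (simp add: Suc_le_eq)
  obtain J n0 where J: "\<And>n. n \<ge> n0 \<Longrightarrow> E (m * n) (\<lambda>xs. \<Sum>v\<in>{1..n}. of_bool (bad G J xs v)) \<le> \<eta> / 4 * real n"
    using few_bad_vertices[OF G1, of "\<eta> / 4"] eta by auto
  define ex where "ex = \<gamma> / (1 + \<sigma>)"
  have ex: "0 < ex" "ex < 1" using chi sg0 by (auto simp: ex_def field_simps)
  define cap where "cap t = real t powr ex" for t :: nat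
  have ev1: "\<forall>\<^sub>F t in sequentially. exp B < cap t"
  proof -
    have "filterlim (\<lambda>t. real t powr ex) at_top sequentially" using ex by real_asymp
    then show ?thesis unfolding cap_def filterlim_at_top_dense by blast
  qed
  have ev2: "\<forall>\<^sub>F t in sequentially. 8 * cap t powr (- \<sigma>) < \<eta> / 4"
  proof -
    have "(\<lambda>t. real t powr (- (ex * \<sigma>))) \<longlonglongrightarrow> 0" using ex sg0 by real_asymp
    then have "(\<lambda>t. 8 * real t powr (ex * (- \<sigma>))) \<longlonglongrightarrow> 8 * 0" by (intro tendsto_intros) simp
    from order_tendstoD(2)[OF this, of "\<eta> / 4"] show ?thesis
      unfolding cap_def powr_powr using eta by simp
  qed
  \<comment> \<open>As \<open>K\<close> is of order \<open>ln (ln t)\<close>, \<open>2 ^ K\<close>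
    is bounded by a power of \<open>ln t\<close>; even the shortest window stays long.\<close>
  have ev3: "\<forall>\<^sub>F t in sequentially. 2 * ln (real t) powr (ln 2 / ln \<theta>) \<le> \<eta>0 * real t / 4"
  proof -
    have "(\<lambda>t. ln (real t) powr (ln 2 / ln \<theta>) / real t) \<longlonglongrightarrow> 0" by real_asymp
    then have "\<forall>\<^sub>F t in sequentially. ln (real t) powr (ln 2 / ln \<theta>) / real t < \<eta>0 / 8"
      using e0 by (intro order_tendstoD) auto
    then show ?thesis using eventually_gt_at_top[of 0] by eventually_elim (simp add: field_simps)
  qed
  have ev4: "\<forall>\<^sub>F t in sequentially. \<epsilon> / 2 * ln (ln (real t)) \<ge> real (J + 2)"
  proof -
    have "filterlim (\<lambda>t. \<epsilon> / 2 * ln (ln (real t))) at_top sequentially" using eps by real_asymp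
    then show ?thesis unfolding filterlim_at_top by blast
  qed
  have ev5: "\<forall>\<^sub>F t in sequentially. real (2 * n0 + 1) \<le> real t" by real_asymp
  have ev6: "\<forall>\<^sub>F t in sequentially. ln (real t) \<ge> 1" by real_asymp
  show ?thesis using ev1 ev2 ev3 ev4 ev5 ev6
  proof eventually_elim
    case (elim t)
    have t1: "t \<ge> 1" using elim(5) by simp
    define LL where "LL = ln (ln (real t))"
    have LL0: "LL \<ge> 0" using elim(6) by (simp add: LL_def)
    define P where "P K \<longleftrightarrow> cap t \<le> exp (B * \<theta> ^ K)" for K
    define K' where "K' = nat \<lceil>LL / ln \<theta>\<rceil>"
    have lth: "ln \<theta> > 0" using th1 by simp
    have K'l: "LL / ln \<theta> \<le> real K'" unfolding K'_def by (rule real_nat_ceiling_ge)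
    have K'u: "real K' \<le> LL / ln \<theta> + 1"
    proof -
      have "0 \<le> LL / ln \<theta>" using LL0 lth by simp
      then have "real K' = of_int \<lceil>LL / ln \<theta>\<rceil>" by (simp add: K'_def)
      then show ?thesis using of_int_ceiling_le_add_one[of "LL / ln \<theta>"] by linarith
    qed
    have "P K'"
    proof -
      have "ln (real t) = exp LL" using elim(6) by (simp add: LL_def)
      also have "\<dots> \<le> exp (real K' * ln \<theta>)" using K'l lth by (simp add: field_simps)
      also have "\<dots> = \<theta> ^ K'" using th1 by (simp add: exp_of_nat_mult)
      finally have "ln (real t) \<le> \<theta> ^ K'" .
      also have "\<dots> \<le> B * \<theta> ^ K'" using B th1 by (simp add: mult_le_cancel_right1)
      finally have "exp (ln (real t)) \<le> exp (B * \<theta> ^ K')" by simp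
      moreover have "cap t \<le> real t powr 1" unfolding cap_def using ex t1 by (intro powr_mono) auto
      ultimately show ?thesis using t1 by (simp add: P_def)
    qed
    \<comment> \<open>The first step at which the cap is reached. Since \<open>cap t \<le> t\<close>
      and \<open>B \<ge> 1\<close>, it comes no later than \<open>K'\<close>.\<close>
    define K where "K = (LEAST K. P K)"
    have PK: "P K" unfolding K_def using \<open>P K'\<close> by (rule LeastI)
    have KK': "K \<le> K'" unfolding K_def using \<open>P K'\<close> by (rule Least_le)
    have Kl: "exp (B * \<theta> ^ k) < cap t" if "k < K" for k
      using not_less_Least[of k P] that unfolding K_def P_def by auto
    have K1: "K \<ge> 1"
    proof (rule ccontr)
      assume "\<not> K \<ge> 1"
      then have "P 0" using PK by (simp add: not_le)
      then show False using elim(1) by (simp add: P_def)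
    qed
    have Ku: "real K \<le> LL / ln \<theta> + 1" using KK' K'u by linarith
    have K2: "2 ^ K \<le> \<eta>0 * real t / 4"
    proof -
      have "(2::real) ^ K = exp (real K * ln 2)" by (simp add: exp_of_nat_mult)
      also have "\<dots> \<le> exp ((LL / ln \<theta> + 1) * ln 2)" using Ku by simp
      also have "\<dots> = 2 * exp (ln 2 / ln \<theta> * LL)" by (simp add: exp_add algebra_simps)
      also have "exp (ln 2 / ln \<theta> * LL) = ln (real t) powr (ln 2 / ln \<theta>)"
        using elim(6) by (simp add: powr_def LL_def)
      finally show ?thesis using elim(3) by linarith
    qed
    define t0 where "t0 = t - nat \<lfloor>\<eta>0 * real t\<rfloor>"
    have fl: "real (nat \<lfloor>\<eta>0 * real t\<rfloor>) \<le> \<eta>0 * real t" using e0 by simp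
    have half: "\<eta>0 * real t \<le> 1 / 2 * real t" using e0 by (intro mult_right_mono) auto
    have "real (nat \<lfloor>\<eta>0 * real t\<rfloor>) \<le> real t" using fl half by linarith
    then have flt: "nat \<lfloor>\<eta>0 * real t\<rfloor> \<le> t" by simp
    have t0r: "real t0 = real t - real (nat \<lfloor>\<eta>0 * real t\<rfloor>)" using flt by (simp add: t0_def of_nat_diff)
    have t0n: "t0 \<ge> n0"
    proof -
      have "2 * real n0 + 1 \<le> real t" using elim(5) by simp
      then have "real n0 \<le> real t0" using t0r fl half by linarith
      then show ?thesis by simp
    qed
    have t0t: "t0 \<le> t" by (simp add: t0_def)
    define d where "d = J + 2 * K"
    have "real d \<le> real J + 2 * (LL / ln \<theta> + 1)" using Ku by (simp add: d_def)
    also have "\<dots> = real (J + 2) + (2 / ln \<theta>) * LL" by (simp add: algebra_simps)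
    also have "\<dots> \<le> \<epsilon> / 2 * LL + (2 / l + \<epsilon> / 2) * LL" using elim(4) unfolding coef LL_def by simp
    also have "\<dots> = (2 / \<bar>ln \<rho>\<bar> + \<epsilon>) * ln (ln (real t))" by (simp add: LL_def l_def algebra_simps)
    finally have d: "real d \<le> (2 / \<bar>ln \<rho>\<bar> + \<epsilon>) * ln (ln (real t))" .
    have each: "E (m * t) (\<lambda>xs. of_bool (\<not> near xs v 1 d)) \<le> E (m * t0) (\<lambda>xs. of_bool (bad G J xs v)) + \<eta> / 2" if v: "v \<in> {1..t0}" for v
    proof -
      have "E (m * t) (\<lambda>xs. of_bool (\<not> near xs v 1 (J + 2 * K))) \<le> E (m * t0) (\<lambda>xs. of_bool (bad G J xs v))
       + (\<Sum>k<K. 2 ^ k * exp (- ((1 - \<theta> * \<rho>) / 2) * (B * \<theta> ^ k))) / (\<eta>0 / (144 * (real m)\<^sup>2))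
       + (8 * (\<Sum>k<K. 2 ^ k * exp (- \<sigma> * (B * \<theta> ^ k))) + 8 * cap t powr (- \<sigma>))"
        using th1 th2 \<sigma>_def e0(1,2) B _ K1 Kl _ K2 t1 t0_def G_def v
      proof (rule climb_to_root)
        show "cap t = real t powr (\<gamma> / (1 + \<sigma>))" by (simp add: cap_def ex_def)
        show "cap t \<le> exp (B * \<theta> ^ K)" using PK by (simp add: P_def)
      qed
      also have "(\<Sum>k<K. 2 ^ k * exp (- ((1 - \<theta> * \<rho>) / 2) * (B * \<theta> ^ k))) / (\<eta>0 / (144 * (real m)\<^sup>2)) \<le> 2 * exp (- \<tau> * B) / c0"
        unfolding \<tau>_def[symmetric] c0_def[symmetric]
        using sum_double_exp_le[OF ta0 _ th1 Bt, of K] B c0 by (intro divide_right_mono) auto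
      also have "(\<Sum>k<K. 2 ^ k * exp (- \<sigma> * (B * \<theta> ^ k))) \<le> 2 * exp (- \<sigma> * B)"
        using sum_double_exp_le[OF sg0 _ th1 Bs, of K] B by simp
      finally show ?thesis using Bsum elim(2) unfolding d_def by linarith
    qed
    have "E (m * t) (\<lambda>xs. \<Sum>v\<in>{1..t}. of_bool (\<not> near xs v 1 d)) = (\<Sum>v\<in>{1..t}. E (m * t) (\<lambda>xs. of_bool (\<not> near xs v 1 d)))" by (rule E_sum)
    also have "\<dots> = (\<Sum>v\<in>{1..t0}. E (m * t) (\<lambda>xs. of_bool (\<not> near xs v 1 d))) + (\<Sum>v\<in>{t0 + 1..t}. E (m * t) (\<lambda>xs. of_bool (\<not> near xs v 1 d)))"
    proof -
      have "{1..t} = {1..t0} \<union> {t0 + 1..t}" using t0t by auto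
      then show ?thesis by (simp add: sum.union_disjoint)
    qed
    also have "\<dots> \<le> (\<Sum>v\<in>{1..t0}. E (m * t0) (\<lambda>xs. of_bool (bad G J xs v)) + \<eta> / 2) + (\<Sum>v\<in>{t0 + 1..t}. 1)"
    proof (intro add_mono sum_mono each)
      fix v
      have "E (m * t) (\<lambda>xs. of_bool (\<not> near xs v 1 d)) \<le> E (m * t) (\<lambda>_. 1)" by (intro E_mono) simp
      then show "E (m * t) (\<lambda>xs. of_bool (\<not> near xs v 1 d)) \<le> 1" by (simp add: E_const)
    qed
    also have "\<dots> = E (m * t0) (\<lambda>xs. \<Sum>v\<in>{1..t0}. of_bool (bad G J xs v)) + real t0 * (\<eta> / 2) + (real t - real t0)"
      unfolding E_sum sum.distrib using t0t by (simp add: of_nat_diff)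
    also have "\<dots> \<le> \<eta> / 4 * real t0 + real t0 * (\<eta> / 2) + \<eta> / 4 * real t"
    proof (intro add_mono order_refl J t0n)
      have "\<eta>0 * real t \<le> \<eta> / 4 * real t" using e0 by (intro mult_right_mono) auto
      then show "real t - real t0 \<le> \<eta> / 4 * real t" using t0r fl by linarith
    qed
    also have "\<dots> \<le> \<eta> * real t"
    proof -
      have "\<eta> * (3 / 4) * real t0 \<le> \<eta> * (3 / 4) * real t" using eta t0t by (intro mult_left_mono) auto
      then show ?thesis by (simp add: algebra_simps)
    qed
    finally show ?case using d by blast
  qed
qed

text \<open>The two vertices are joined through vertex 1, which doubles both the distance and the
  error of \<open>near_root\<close>.\<close>

lemma upper_bound:
  fixes \<epsilon> \<eta> :: real
  assumes eps: "\<epsilon> > 0" and eta: "\<eta> > 0"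
  shows "\<forall>\<^sub>F t in sequentially.
    E (m * t) (\<lambda>xs. \<Sum>u\<in>{1..t}. \<Sum>v\<in>{1..t}. of_bool (\<not> (\<exists>n. graph_dist (pa_adj m xs) u v = enat n \<and>
       real n \<le> (4 / \<bar>ln \<rho>\<bar> + \<epsilon>) * ln (ln (real t))))) \<le> \<eta> * (real t)\<^sup>2"
proof -
  have "\<epsilon> / 2 > 0" "\<eta> / 2 > 0" using assms by auto
  from near_root[OF this] show ?thesis
  proof eventually_elim
    case (elim t)
    then obtain d where d: "real d \<le> (2 / \<bar>ln \<rho>\<bar> + \<epsilon> / 2) * ln (ln (real t))"
      and En: "E (m * t) (\<lambda>xs. \<Sum>v\<in>{1..t}. of_bool (\<not> near xs v 1 d)) \<le> \<eta> / 2 * real t" by blast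
    define b where "b xs v = (of_bool (\<not> near xs v 1 d) :: real)" for xs v
    have "E (m * t) (\<lambda>xs. \<Sum>u\<in>{1..t}. \<Sum>v\<in>{1..t}. of_bool (\<not> (\<exists>n. graph_dist (pa_adj m xs) u v = enat n \<and>
       real n \<le> (4 / \<bar>ln \<rho>\<bar> + \<epsilon>) * ln (ln (real t)))))
      \<le> E (m * t) (\<lambda>xs. \<Sum>u\<in>{1..t}. \<Sum>v\<in>{1..t}. b xs u + b xs v)"
    proof (intro E_mono sum_mono)
      fix xs u v
      have "\<exists>n. graph_dist (pa_adj m xs) u v = enat n \<and> real n \<le> (4 / \<bar>ln \<rho>\<bar> + \<epsilon>) * ln (ln (real t))"
        if "near xs u 1 d" "near xs v 1 d"
      proof -
        have "near xs u v (d + d)" using that near_sym near_trans by blast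
        then obtain k where k: "k \<le> d + d" "walk_of_len (pa_adj m xs) u v k" unfolding near_def by blast
        define n where "n = (LEAST n. walk_of_len (pa_adj m xs) u v n)"
        have "n \<le> k" unfolding n_def using k(2) by (rule Least_le)
        then have "real n \<le> 2 * real d" using k(1) by linarith
        also have "\<dots> \<le> 2 * ((2 / \<bar>ln \<rho>\<bar> + \<epsilon> / 2) * ln (ln (real t)))" using d by simp
        also have "\<dots> = (4 / \<bar>ln \<rho>\<bar> + \<epsilon>) * ln (ln (real t))" by (simp add: algebra_simps)
        finally have "real n \<le> (4 / \<bar>ln \<rho>\<bar> + \<epsilon>) * ln (ln (real t))" .
        moreover have "graph_dist (pa_adj m xs) u v = enat n" unfolding graph_dist_def n_def using k(2) by auto
        ultimately show ?thesis by blast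
      qed
      then show "of_bool (\<not> (\<exists>n. graph_dist (pa_adj m xs) u v = enat n \<and>
         real n \<le> (4 / \<bar>ln \<rho>\<bar> + \<epsilon>) * ln (ln (real t)))) \<le> b xs u + b xs v"
        unfolding b_def by (auto simp: of_bool_def)
    qed
    also have "\<dots> = E (m * t) (\<lambda>xs. 2 * real t * (\<Sum>v\<in>{1..t}. b xs v))"
      by (intro E_cong) (simp add: sum.distrib sum_distrib_left[symmetric])
    also have "\<dots> = 2 * real t * E (m * t) (\<lambda>xs. \<Sum>v\<in>{1..t}. b xs v)" by (rule E_cmult)
    also have "\<dots> \<le> 2 * real t * (\<eta> / 2 * real t)" using En unfolding b_def by (intro mult_left_mono) auto
    also have "\<dots> = \<eta> * (real t)\<^sup>2" by (simp add: power2_eq_square)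
    finally show ?case .
  qed
qed

section \<open>Transfer to the typical distance\<close>

lemma prob_typical_dist:
  assumes t: "t \<ge> 1"
  shows "measure_pmf.prob (typical_dist m \<delta> t) A =
    E (m * t) (\<lambda>xs. \<Sum>u\<in>{1..t}. \<Sum>v\<in>{1..t}. of_bool (graph_dist (pa_adj m xs) u v \<in> A)) / (real t)\<^sup>2"
proof -
  define U where "U = pmf_of_set {1..t}"
  have U: "set_pmf U = {1..t}" using t by (simp add: U_def)
  define D where "D xs = bind_pmf U (\<lambda>u. bind_pmf U (\<lambda>v. return_pmf (graph_dist (pa_adj m xs) u v)))" for xs
  have fin: "finite (set_pmf (bind_pmf U (\<lambda>v. return_pmf (graph_dist (pa_adj m xs) u v))))" for xs u
    by (simp add: U)
  have finD: "finite (set_pmf (D xs))" for xs by (simp add: D_def U)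
  have ED: "measure_pmf.expectation (D xs) (indicat_real A)
    = (\<Sum>u\<in>{1..t}. \<Sum>v\<in>{1..t}. of_bool (graph_dist (pa_adj m xs) u v \<in> A)) / (real t)\<^sup>2" for xs
  proof -
    have i: "measure_pmf.expectation (bind_pmf U (\<lambda>v. return_pmf (graph_dist (pa_adj m xs) u v))) (indicat_real A)
      = (\<Sum>v\<in>{1..t}. of_bool (graph_dist (pa_adj m xs) u v \<in> A)) / real t" for u
      unfolding U_def using t
      by (subst pmf_expectation_bind_pmf_of_set) (auto simp: indicator_def of_bool_def divide_inverse mult.commute sum_distrib_left)
    have "measure_pmf.expectation (D xs) (indicat_real A) = (\<Sum>u\<in>{1..t}. (\<Sum>v\<in>{1..t}. of_bool (graph_dist (pa_adj m xs) u v \<in> A)) / real t) / real t"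
      unfolding D_def i[symmetric] U_def using t fin[unfolded U_def]
      by (subst pmf_expectation_bind_pmf_of_set) (auto simp: divide_inverse mult.commute sum_distrib_left)
    then show ?thesis by (simp add: sum_divide_distrib[symmetric] power2_eq_square)
  qed
  have td: "typical_dist m \<delta> t = bind_pmf (pa_hist m \<delta> (m * t)) D"
    by (simp add: typical_dist_def PA_def D_def[abs_def] U_def)
  have "measure_pmf.prob (typical_dist m \<delta> t) A = measure_pmf.expectation (typical_dist m \<delta> t) (indicat_real A)" by simp
  also have "\<dots> = measure_pmf.expectation (bind_pmf (pa_hist m \<delta> (m * t)) D) (indicat_real A)" unfolding td ..
  also have "measure_pmf.expectation (bind_pmf (pa_hist m \<delta> (m * t)) D) (indicat_real A)
     = (\<Sum>xs | valid (m * t) xs. pmf (pa_hist m \<delta> (m * t)) xs * measure_pmf.expectation (D xs) (indicat_real A))"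
    using set_pa_hist finD by (subst pmf_expectation_bind[OF finite_pa_valid[of m "m * t"]]) auto
  also have "\<dots> = E (m * t) (\<lambda>xs. measure_pmf.expectation (D xs) (indicat_real A))" by (simp add: E_eq_sum)
  also have "\<dots> = E (m * t) (\<lambda>xs. 1 / (real t)\<^sup>2 * (\<Sum>u\<in>{1..t}. \<Sum>v\<in>{1..t}. of_bool (graph_dist (pa_adj m xs) u v \<in> A)))"
    unfolding ED by simp
  finally show ?thesis unfolding E_cmult by simp
qed

end

theorem theorem1p6:
  fixes m :: nat and \<delta> :: real
  assumes "m \<ge> 2" and "- real m < \<delta>" and "\<delta> < 0"
  shows "\<forall>\<epsilon>>0. (\<lambda>t. measure_pmf.prob (typical_dist m \<delta> t)
            {h. \<not> (\<exists>n. h = enat n \<and>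
                 \<bar>real n / ln (ln (real t)) - 4 / \<bar>ln ((3 + \<delta> / real m) - 2)\<bar>\<bar> \<le> \<epsilon>)})
          \<longlonglongrightarrow> 0"
proof (intro allI impI)
  fix \<epsilon> :: real assume eps: "\<epsilon> > 0"
  interpret pref_att m \<delta> by standard (use assms in auto)
  have r: "(3 + \<delta> / real m) - 2 = \<rho>" by (simp add: \<rho>_def)
  define c where "c = 4 / \<bar>ln \<rho>\<bar>"
  \<comment> \<open>An infinite distance belongs to the exceptional set, so connectedness is part of
    the claim; \<open>upper_bound\<close> covers it.\<close>
  define A where "A t = {h. \<not> (\<exists>n. h = enat n \<and> \<bar>real n / ln (ln (real t)) - c\<bar> \<le> \<epsilon>)}" for t :: nat
  have "(\<lambda>t. measure_pmf.prob (typical_dist m \<delta> t) (A t)) \<longlonglongrightarrow> 0"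
  proof (rule tendstoI)
    fix \<eta> :: real assume eta: "\<eta> > 0"
    have ev: "\<forall>\<^sub>F t in sequentially. ln (ln (real t)) > 0" by real_asymp
    have "\<eta> / 3 > 0" using eta by simp
    from lower_bound[OF eps this] upper_bound[OF eps this] ev eventually_ge_at_top[of 1]
    show "\<forall>\<^sub>F t in sequentially. dist (measure_pmf.prob (typical_dist m \<delta> t) (A t)) 0 < \<eta>"
    proof eventually_elim
      case (elim t)
      define lo where "lo xs u v = (of_bool (\<exists>n. graph_dist (pa_adj m xs) u v = enat n \<and>
         real n < (4 / \<bar>ln \<rho>\<bar> - \<epsilon>) * ln (ln (real t))) :: real)" for xs u v
      define up where "up xs u v = (of_bool (\<not> (\<exists>n. graph_dist (pa_adj m xs) u v = enat n \<and>
         real n \<le> (4 / \<bar>ln \<rho>\<bar> + \<epsilon>) * ln (ln (real t)))) :: real)" for xs u v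
      have "E (m * t) (\<lambda>xs. \<Sum>u\<in>{1..t}. \<Sum>v\<in>{1..t}. of_bool (graph_dist (pa_adj m xs) u v \<in> A t))
        \<le> E (m * t) (\<lambda>xs. (\<Sum>u\<in>{1..t}. \<Sum>v\<in>{1..t}. lo xs u v) + (\<Sum>u\<in>{1..t}. \<Sum>v\<in>{1..t}. up xs u v))"
        unfolding sum.distrib[symmetric]
      proof (intro E_mono sum_mono)
        fix xs u v
        show "of_bool (graph_dist (pa_adj m xs) u v \<in> A t) \<le> lo xs u v + up xs u v"
        proof (cases "lo xs u v = 0 \<and> up xs u v = 0")
          case True
          then obtain n where n: "graph_dist (pa_adj m xs) u v = enat n" "real n \<le> (c + \<epsilon>) * ln (ln (real t))"
            by (auto simp: up_def c_def)
          moreover have "real n \<ge> (c - \<epsilon>) * ln (ln (real t))" using True n(1) by (auto simp: lo_def c_def not_less)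
          ultimately have "\<bar>real n / ln (ln (real t)) - c\<bar> \<le> \<epsilon>"
            using elim(3) by (simp add: abs_le_iff field_simps)
          then have "graph_dist (pa_adj m xs) u v \<notin> A t" using n(1) by (simp add: A_def)
          then show ?thesis using True by simp
        next
          case False
          then have "1 \<le> lo xs u v + up xs u v" by (auto simp: lo_def up_def of_bool_def split: if_splits)
          then show ?thesis by (auto simp: of_bool_def)
        qed
      qed
      also have "\<dots> \<le> \<eta> / 3 * (real t)\<^sup>2 + \<eta> / 3 * (real t)\<^sup>2"
        unfolding E_add lo_def up_def using elim(1,2) by (rule add_mono)
      finally have b: "E (m * t) (\<lambda>xs. \<Sum>u\<in>{1..t}. \<Sum>v\<in>{1..t}. of_bool (graph_dist (pa_adj m xs) u v \<in> A t)) \<le> 2 * \<eta> / 3 * (real t)\<^sup>2"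
        by simp
      have "measure_pmf.prob (typical_dist m \<delta> t) (A t) \<le> 2 * \<eta> / 3 * (real t)\<^sup>2 / (real t)\<^sup>2"
        unfolding prob_typical_dist[OF elim(4)] by (intro divide_right_mono b) auto
      also have "\<dots> < \<eta>" using eta elim(4) by simp
      finally show ?case by simp
    qed
  qed
  then show "(\<lambda>t. measure_pmf.prob (typical_dist m \<delta> t)
            {h. \<not> (\<exists>n. h = enat n \<and>
                 \<bar>real n / ln (ln (real t)) - 4 / \<bar>ln ((3 + \<delta> / real m) - 2)\<bar>\<bar> \<le> \<epsilon>)}) \<longlonglongrightarrow> 0"
    unfolding A_def c_def r .
qed

end
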